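(* Let $u$ be a smooth real function on $\mathbb{R}$, let $L=\frac{\partial^2}{\partial x^2}+u(x)$, and let $G_n[u]$, $n\in\mathbb{N}$, be the KdV-hierarchy polynomials in the formal variables $u_0,u_1,u_2,\dots$, defined from the heat invariants of $L$ as described in the context. For $k\ge n\ge 1$, let $P_{kn}[u]$ be the polynomial obtained from $L^k\left[x^{2k-2n}\right]\big|_{x=0}$ (a polynomial in $u(0),u'(0),\dots,u^{(2k-2)}(0)$) by the formal change of variables $u^{(i)}(0)\to u_i$, $i=0,\dots,2k-2$. Then for every $n\in\mathbb{N}$, $$ G_n[u]=\sum_{m=n}^{2n}\sum_{k=n}^{m}\frac{(-1)^{n+k}\binom{m}{k}\binom{m}{n}\binom{2m}{m}}{2^{2m-2n+1}\binom{2m}{2n}\,(2k-2n)!}\,P_{kn}[u]. $$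
   Context: The heat kernel $H(t,x,y)$ of $L=\frac{\partial^2}{\partial x^2}+u(x)$ is the fundamental solution of the heat equation $\left(\frac{\partial}{\partial t}-L\right)f=0$. On the diagonal it has the asymptotic expansion, as $t\to 0+$, $$H(t,x,x)\sim \frac{1}{\sqrt{4\pi t}}\sum_{n=0}^{\infty} h_n[u]\,t^n,$$ where the heat invariants $h_n[u]$ are universal polynomials in $u(x)$ and its derivatives. Writing $u_i$ for the formal variable standing for $\partial^i u/\partial x^i$ (with $u_0=u$), one defines $G_n[u]=G_n[u_0,u_1,u_2,\dots]=\frac{(2n)!}{2\cdot n!}\,h_n[u]$ for $n\in\mathbb{N}$; the KdV hierarchy is $\frac{\partial u}{\partial t}=\frac{\partial}{\partial x}G_n[u]$. *)

theory Defs
  imports "HOL-Analysis.Analysis" "HOL-Library.Landau_Symbols"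
begin

text \<open>Polynomial functions of the formal variables u_0, u_1, u_2, ...
  A point is a real sequence s, with s i standing for u_i.
  Polynomials with real coefficients in finitely many of these variables
  are generated by constants, variables, sums and products.\<close>

inductive_set poly_fun :: "((nat \<Rightarrow> real) \<Rightarrow> real) set" where
  pf_const: "(\<lambda>s. c) \<in> poly_fun"
| pf_var: "(\<lambda>s. s i) \<in> poly_fun"
| pf_add: "p \<in> poly_fun \<Longrightarrow> q \<in> poly_fun \<Longrightarrow> (\<lambda>s. p s + q s) \<in> poly_fun"
| pf_mult: "p \<in> poly_fun \<Longrightarrow> q \<in> poly_fun \<Longrightarrow> (\<lambda>s. p s * q s) \<in> poly_fun"

definition jet :: "(real \<Rightarrow> real) \<Rightarrow> real \<Rightarrow> nat \<Rightarrow> real" where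
  "jet u x = (\<lambda>i. (deriv ^^ i) u x)"

text \<open>Smooth real functions all of whose derivatives are bounded
  (the class of potentials used to pin down the universal heat invariants).\<close>
definition smooth_bdd :: "(real \<Rightarrow> real) \<Rightarrow> bool" where
  "smooth_bdd u \<longleftrightarrow>
     (\<forall>k x. ((deriv ^^ k) u) differentiable (at x)) \<and>
     (\<forall>k. bounded (range ((deriv ^^ k) u)))"

definition heat_kernel :: "(real \<Rightarrow> real) \<Rightarrow> (real \<Rightarrow> real \<Rightarrow> real \<Rightarrow> real) \<Rightarrow> bool" where
  "heat_kernel u H \<longleftrightarrow>
     (\<forall>t>0. \<forall>x y.
        (\<lambda>s. H s x y) differentiable (at t) \<and>
        (\<lambda>z. H t z y) differentiable (at x) \<and>
        (\<lambda>z. deriv (\<lambda>w. H t w y) z) differentiable (at x) \<and>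
        deriv (\<lambda>s. H s x y) t = deriv (\<lambda>z. deriv (\<lambda>w. H t w y) z) x + u x * H t x y) \<and>
     (\<exists>C c. c > 0 \<and> (\<forall>t\<in>{0<..1}. \<forall>x y.
        \<bar>H t x y\<bar> \<le> C / sqrt t * exp (- ((x - y)\<^sup>2) / (c * t)))) \<and>
     (\<forall>f y. continuous_on UNIV f \<longrightarrow> bounded (range f) \<longrightarrow>
        ((\<lambda>t. LINT x|lborel. H t x y * f x) \<longlongrightarrow> f y) (at_right 0))"

definition is_heat_invariants :: "(nat \<Rightarrow> (nat \<Rightarrow> real) \<Rightarrow> real) \<Rightarrow> bool" where
  "is_heat_invariants h \<longleftrightarrow>
     (\<forall>n. h n \<in> poly_fun) \<and>
     (\<forall>u H x N. smooth_bdd u \<longrightarrow> heat_kernel u H \<longrightarrow>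
        (\<lambda>t. H t x x - (1 / sqrt (4 * pi * t)) * (\<Sum>n<N. h n (jet u x) * t ^ n))
          \<in> O[at_right 0](\<lambda>t. t powr (real N - 1 / 2)))"

definition heat_inv :: "nat \<Rightarrow> (nat \<Rightarrow> real) \<Rightarrow> real" where
  "heat_inv = (THE h. is_heat_invariants h)"

definition KdV_G :: "nat \<Rightarrow> (nat \<Rightarrow> real) \<Rightarrow> real" where
  "KdV_G n s = fact (2 * n) / (2 * fact n) * heat_inv n s"

definition Lop :: "(real \<Rightarrow> real) \<Rightarrow> (real \<Rightarrow> real) \<Rightarrow> (real \<Rightarrow> real)" where
  "Lop u f = (\<lambda>x. deriv (deriv f) x + u x * f x)"

text \<open>P_kn[u]: L^k[x^(2k-2n)] at x = 0, a polynomial in u(0),...,u^(2k-2)(0),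
  with u^(i)(0) replaced by u_i = s i. It is evaluated by taking the
  polynomial potential whose derivatives at 0 of order i <= 2k-2 are s i.\<close>
definition P :: "nat \<Rightarrow> nat \<Rightarrow> (nat \<Rightarrow> real) \<Rightarrow> real" where
  "P k n s =
     (let u = (\<lambda>x. \<Sum>i\<le>2 * k - 2. s i * x ^ i / fact i)
      in ((Lop u ^^ k) (\<lambda>x. x ^ (2 * k - 2 * n))) 0)"

end

theory Submission
  imports Defs "HOL-Probability.Probability" "HOL-Computational_Algebra.Polynomial_FPS"
begin

text \<open>
  Let \<open>G\<close> be the Gaussian kernel. The transport equations give coefficients \<open>a\<^sub>n(x, z)\<close> such that
  \<open>K\<^sub>N = G(t, x - z) \<Sum>\<^sub>n\<^sub>\<le>\<^sub>N a\<^sub>n(x, z) t\<^sup>n\<close> solves the heat equation up to \<open>- G t\<^sup>N L a\<^sub>N\<close>, and \<open>a\<^sub>n(x, x)\<close> is a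
  polynomial in the jet of \<open>u\<close> at \<open>x\<close>. A maximum principle compares \<open>H(\<epsilon> + \<tau>, x, y)\<close> with
  \<open>\<integral> K\<^sub>N(\<tau>, x, z) H(\<epsilon>, z, y) dz\<close>; letting \<open>\<epsilon> \<rightarrow> 0\<close> gives the diagonal expansion of every heat kernel. The kernel
  is only assumed to be separately differentiable, so joint continuity is not available. What the maximum principle
  needs is upper semicontinuity forward in time, and this holds for bounded subsolutions: Baire's theorem
  yields a portion of the closure of the bad points on which the function is uniformly Lipschitz in each
  variable, and the heat flow controls the strips between that portion and a later time.

  The invariants are unique because every finite jet is the jet of a trigonometric polynomial \<open>u\<close>, whose heat kernel
  can be written down as \<open>G\<close> times a convergent perturbation series.

  Finally \<open>L\<^sup>k[x\<^sup>2\<^sup>j](0) / k!\<close> is the coefficient of \<open>t\<^sup>k\<close> in the formal pairing of the heat expansion at \<open>0\<close>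
  with \<open>x\<^sup>2\<^sup>j\<close>, hence a combination of Taylor coefficients of the \<open>a\<^sub>n(x, 0)\<close> with Gaussian moments as weights. The
  double sum of the theorem is Newton's interpolation at \<open>-1/2\<close> of \<open>4\<^sup>l (x + 1/2)\<^sub>l\<close>, which kills
  all Taylor coefficients except the value \<open>a\<^sub>n(0, 0)\<close>.
\<close>

section \<open>The Gaussian kernel\<close>

text \<open>\<open>heat_kernel\<close> prescribes the initial behaviour only weakly, through
  integrals over the first argument against bounded continuous functions. This decides the form of
  the comparison: at a positive time \<epsilon> the column H(\<epsilon>, ., y) is a bounded
  continuous datum from which a maximum principle can start, and as \<epsilon> tends to 0 the
  parametrix itself serves as the test function. The error must therefore be uniform in \<epsilon>;
  its order t^(N + 1/2) comes from integrating a source of size t^N / sqrt t in time. The assumed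
  Gaussian bound has unknown constants, so it is used only for its mass, its supremum and a decay
  like 1/R at the sides of a box of half-width R, an error that disappears as R grows. For
  uniqueness, heat kernels must exist for enough potentials. Multiplication by a trigonometric
  polynomial only shifts frequencies and phases, so every term of the perturbation series is an
  iterated integral of explicit exponentials, and its derivatives can be bounded by hand.\<close>

definition heatG :: "real \<Rightarrow> real \<Rightarrow> real" where
  "heatG t x = exp (- x\<^sup>2 / (4 * t)) / sqrt (4 * pi * t)"

lemma heatG_normal_density: "0 < t \<Longrightarrow> heatG t (x - z) = normal_density x (sqrt (2 * t)) z"
proof -
  assume "0 < t"
  moreover have "(x - z)\<^sup>2 = (z - x)\<^sup>2" by (rule power2_commute)
  moreover have "2 * (sqrt (2 * t))\<^sup>2 = 4 * t" "2 * pi * (sqrt (2 * t))\<^sup>2 = 4 * pi * t"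
    using \<open>0 < t\<close> by simp_all
  ultimately show ?thesis unfolding heatG_def normal_density_def by simp
qed

lemma heatG_minus: "heatG t (x - z) = heatG t (z - x)"
  by (simp add: heatG_def power2_commute)

lemma heatG_nonneg: "0 < t \<Longrightarrow> 0 \<le> heatG t x"
  by (simp add: heatG_def)

lemma integrable_heatG: "0 < t \<Longrightarrow> integrable lborel (\<lambda>z. heatG t (x - z))"
  by (simp add: heatG_normal_density)

lemma integral_heatG: "0 < t \<Longrightarrow> (LINT z|lborel. heatG t (x - z)) = 1"
  by (simp add: heatG_normal_density)

lemma integrable_heatG_moment:
  assumes "0 < t"
  shows "integrable lborel (\<lambda>z. heatG t (x - z) * (z - x) ^ k)"
  using integrable_normal_moment[of "sqrt (2 * t)" x k] assms by (simp add: heatG_normal_density)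

lemma integral_heatG_moment_1: "0 < t \<Longrightarrow> (LINT z|lborel. heatG t (x - z) * (z - x)) = 0"
  using integral_normal_moment_odd[of "sqrt (2 * t)" x 0] by (simp add: heatG_normal_density)

lemma integral_heatG_moment_2: "0 < t \<Longrightarrow> (LINT z|lborel. heatG t (x - z) * (z - x)\<^sup>2) = 2 * t"
proof -
  assume t: "0 < t"
  have "fact (2 * 1) / ((2 / (sqrt (2 * t))\<^sup>2) ^ 1 * fact 1) = 2 * t"
    using t by (simp add: fact_numeral)
  moreover have s: "0 < sqrt (2 * t)" using t by simp
  ultimately show ?thesis
    using integral_normal_moment_even[of "sqrt (2 * t)" x 1, OF s] t
    by (simp only: heatG_normal_density mult_1_right)
qed

text \<open>The Gaussian has second moment 2t + (x - x0)^2 about \<open>x0\<close>, so a quadratic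
  modulus of continuity integrates exactly. A function bounded by M and continuous at
  \<open>x0\<close> has such a modulus for every \<open>e\<close> > 0, with \<open>B\<close> of the
  form 2M/d^2.\<close>

lemma heatG_approx_identity:
  fixes g :: "real \<Rightarrow> real"
  assumes t: "0 < t" and m: "g \<in> borel_measurable borel"
    and b: "\<And>z. \<bar>g z - g0\<bar> \<le> e + B * (z - x0)\<^sup>2"
  shows "\<bar>(LINT z|lborel. heatG t (x - z) * g z) - g0\<bar> \<le> e + B * (2 * t + (x - x0)\<^sup>2)"
    and "integrable lborel (\<lambda>z. heatG t (x - z) * g z)"
proof -
  let ?G = "\<lambda>z. heatG t (x - z)"
  \<comment> \<open>(z - x0)^2 is expanded about the centre \<open>x\<close> of the Gaussian, where
    the moments of order 0, 1 and 2 are known.\<close>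
  let ?M = "\<lambda>z. e * ?G z + B * (?G z * (z - x)\<^sup>2 + 2 * (x - x0) * (?G z * (z - x)) + (x - x0)\<^sup>2 * ?G z)"
  have iM: "integrable lborel ?M"
    using integrable_heatG[OF t, of x] integrable_heatG_moment[OF t, of x 2]
      integrable_heatG_moment[OF t, of x 1] by simp
  have M: "(LINT z|lborel. ?M z) = e + B * (2 * t + (x - x0)\<^sup>2)"
    using integrable_heatG[OF t, of x] integrable_heatG_moment[OF t, of x 2]
      integrable_heatG_moment[OF t, of x 1]
    by (simp add: integral_heatG t integral_heatG_moment_1 integral_heatG_moment_2)
  have mG: "?G \<in> borel_measurable borel"
    by (simp add: heatG_normal_density t)
  have le: "norm (?G z * (g z - g0)) \<le> ?M z" for z
  proof -
    have "?M z = ?G z * (e + B * (z - x0)\<^sup>2)"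
      by (simp add: algebra_simps power2_eq_square)
    moreover have "norm (?G z * (g z - g0)) = ?G z * \<bar>g z - g0\<bar>"
      by (simp add: abs_mult heatG_nonneg t)
    ultimately show ?thesis using mult_left_mono[OF b[of z] heatG_nonneg[OF t]] by simp
  qed
  have le': "norm (?G z * (g z - g0)) \<le> norm (?M z)" for z
    using le[of z] by (smt (verit) real_norm_def)
  have i1: "integrable lborel (\<lambda>z. ?G z * (g z - g0))"
    by (rule Bochner_Integration.integrable_bound[OF iM]) (use m mG le' in auto)
  have eq: "?G z * g z = ?G z * (g z - g0) + g0 * ?G z" for z by (simp add: algebra_simps)
  show "integrable lborel (\<lambda>z. ?G z * g z)"
    unfolding eq using i1 integrable_heatG[OF t, of x] by simp
  have 1: "(LINT z|lborel. ?G z * g z) - g0 = (LINT z|lborel. ?G z * (g z - g0))"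
    unfolding eq using i1 integrable_heatG[OF t, of x] by (simp add: integral_heatG t)
  show "\<bar>(LINT z|lborel. ?G z * g z) - g0\<bar> \<le> e + B * (2 * t + (x - x0)\<^sup>2)"
    unfolding 1
    using Bochner_Integration.integral_norm_bound_integral[OF i1 iM le] unfolding M real_norm_def .
qed

lemma heatG_le: "0 < t \<Longrightarrow> heatG t x \<le> 1 / sqrt (4 * pi * t)"
  unfolding heatG_def by (rule divide_right_mono) auto

text \<open>With w = x^2/(4t), the inequality sqrt w <= exp w makes \<open>t\<close> cancel. The
  bound is uniform in time, which is what the lateral sides of a large box require.\<close>

lemma heatG_le_inverse:
  assumes t: "0 < t" and x: "0 < \<bar>x\<bar>"
  shows "heatG t x \<le> 1 / \<bar>x\<bar>"
proof -
  define w where "w = x\<^sup>2 / (4 * t)"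
  have w: "w > 0" using t x by (simp add: w_def)
  have "sqrt w \<le> exp w"
  proof (rule power2_le_imp_le)
    have "w \<le> exp w" using exp_ge_add_one_self[of w] by linarith
    also have "\<dots> \<le> (exp w)\<^sup>2"
      using w by (simp add: power2_eq_square)
    finally show "(sqrt w)\<^sup>2 \<le> (exp w)\<^sup>2" using w by simp
  qed simp
  hence 1: "exp (- w) \<le> 1 / sqrt w" using w by (simp add: exp_minus field_simps)
  have "heatG t x = exp (- w) / sqrt (4 * pi * t)" by (simp add: heatG_def w_def)
  also have "\<dots> \<le> (1 / sqrt w) / sqrt (4 * pi * t)"
    by (rule divide_right_mono[OF 1]) (use t in simp)
  also have "\<dots> = 1 / sqrt (w * (4 * pi * t))" by (simp add: real_sqrt_mult)
  also have "w * (4 * pi * t) = pi * x\<^sup>2" using t by (simp add: w_def)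
  also have "1 / sqrt (pi * x\<^sup>2) \<le> 1 / \<bar>x\<bar>"
  proof -
    have "1 \<le> sqrt pi" using pi_gt3 by (simp add: real_le_rsqrt)
    hence "\<bar>x\<bar> \<le> sqrt pi * \<bar>x\<bar>" using mult_right_mono[of 1 "sqrt pi" "\<bar>x\<bar>"] by simp
    thus ?thesis using x by (simp add: real_sqrt_mult frac_le)
  qed
  finally show ?thesis .
qed

lemma heatG_DERIV_x:
  "0 < t \<Longrightarrow> (heatG t has_real_derivative (- x / (2 * t) * heatG t x)) (at x)"
  unfolding heatG_def
  by (auto intro!: derivative_eq_intros simp: field_simps power2_eq_square)

lemma heatG_DERIV_t:
  assumes "0 < t"
  shows "((\<lambda>s. heatG s x) has_real_derivative ((x\<^sup>2 / (4 * t\<^sup>2) - 1 / (2 * t)) * heatG t x)) (at t)"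
proof -
  have "sqrt (4 * pi * t) * sqrt (4 * pi * t) = 4 * pi * t" using assms by simp
  moreover have "pi * t > 0" using assms by simp
  moreover have "sqrt (4 * pi * t) > 0" using assms by simp
  ultimately show ?thesis
    unfolding heatG_def using assms
    by (auto intro!: derivative_eq_intros simp: field_simps power2_eq_square mult_less_0_iff)
qed

lemma continuous_on_heatG:
  assumes "continuous_on S f" "continuous_on S g" "\<And>p. p \<in> S \<Longrightarrow> 0 < f p"
  shows "continuous_on S (\<lambda>p. heatG (f p) (g p))"
proof -
  have "4 * f p \<noteq> 0" "sqrt (4 * pi * f p) \<noteq> 0" if "p \<in> S" for p
    using assms(3)[OF that] by auto
  thus ?thesis
    unfolding heatG_def by (intro continuous_intros assms) blast+
qed

section \<open>A maximum principle without joint continuity\<close>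

text \<open>If \<open>q\<close> were positive, \<open>g'\<close> would be positive just to the right
  of its zero \<open>x\<close>, and \<open>g\<close> would exceed its maximum there.\<close>

lemma max_second_derivative:
  fixes g :: "real \<Rightarrow> real"
  assumes d: "0 < d" and g: "\<And>z. \<bar>z - x\<bar> < d \<Longrightarrow> (g has_real_derivative g' z) (at z)"
    and q: "(g' has_real_derivative q) (at x)"
    and max: "\<And>z. \<bar>z - x\<bar> < d \<Longrightarrow> g z \<le> g x"
  shows "q \<le> 0"
proof (rule ccontr)
  assume "\<not> q \<le> 0"
  hence q0: "0 < q" by simp
  have g'0: "g' x = 0"
    by (rule DERIV_local_max[OF g[of x] d]) (use max d in \<open>auto simp: abs_minus_commute\<close>)
  obtain e where e: "0 < e" "\<And>h. 0 < h \<Longrightarrow> h < e \<Longrightarrow> g' x < g' (x + h)"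
    using DERIV_pos_inc_right[OF q q0] by blast
  define r where "r = min d e / 2"
  have r: "0 < r" "r < d" "r < e" using d e by (auto simp: r_def)
  have "g x < g (x + r)"
  proof (rule DERIV_pos_imp_increasing_open[of x "x + r" g])
    fix z assume z: "x < z" "z < x + r"
    have "(g has_real_derivative g' z) (at z)" using z r by (intro g) auto
    moreover have "g' z > 0" using e(2)[of "z - x"] z r g'0 by auto
    ultimately show "\<exists>y. (g has_real_derivative y) (at z) \<and> 0 < y" by blast
  next
    have "continuous (at z) g" if "z \<in> {x..x + r}" for z
      using that r by (intro DERIV_isCont[OF g]) auto
    thus "continuous_on {x..x + r} g" by (simp add: continuous_at_imp_continuous_on)
  qed (use r in auto)
  with max[of "x + r"] r show False by auto
qed

text \<open>Only strictly later times enter, because the maximum principle approaches a first bad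
  time, an infimum, from the right. Along the row \<open>t\<close> itself ordinary continuity in
  \<open>x\<close> is used instead.\<close>

definition forward_usc :: "(real \<Rightarrow> real \<Rightarrow> real) \<Rightarrow> real \<Rightarrow> real \<Rightarrow> bool" where
  "forward_usc f t x \<longleftrightarrow>
     (\<forall>e>0. \<exists>d>0. \<forall>s y. t < s \<longrightarrow> s < t + d \<longrightarrow> \<bar>y - x\<bar> < d \<longrightarrow> f s y < f t x + e)"

text \<open>\<open>w\<close> is compared with \<open>b\<mu>\<close>, an exponential that takes the
  supposed positive value \<open>\<mu>\<close> at time \<open>t\<close>. Its rate \<open>lm\<close>
  exceeds \<open>C\<close>, so at a first time of contact the differential inequality at a spatial
  maximum lets \<open>w\<close> grow more slowly than the barrier; then \<open>w\<close> was above
  the barrier just before. Forward semicontinuity is what makes a first time of contact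
  exist.\<close>

lemma max_principle:
  fixes w :: "real \<Rightarrow> real \<Rightarrow> real"
  assumes ab: "a < b"
    and cont: "\<And>t. t0 < t \<Longrightarrow> t \<le> t1 \<Longrightarrow> continuous_on {a..b} (w t)"
    and fu: "\<And>t x. t0 < t \<Longrightarrow> t < t1 \<Longrightarrow> a \<le> x \<Longrightarrow> x \<le> b \<Longrightarrow> forward_usc w t x"
    and bottom: "\<And>x e. a \<le> x \<Longrightarrow> x \<le> b \<Longrightarrow> 0 < e \<Longrightarrow>
      \<exists>d>0. \<forall>s y. t0 < s \<longrightarrow> s < t0 + d \<longrightarrow> \<bar>y - x\<bar> < d \<longrightarrow> a \<le> y \<longrightarrow> y \<le> b \<longrightarrow> w s y < e"
    and lateral: "\<And>t. t0 < t \<Longrightarrow> t \<le> t1 \<Longrightarrow> w t a \<le> 0 \<and> w t b \<le> 0"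
    and pde: "\<And>t x. t0 < t \<Longrightarrow> t \<le> t1 \<Longrightarrow> a < x \<Longrightarrow> x < b \<Longrightarrow> 0 < w t x \<Longrightarrow>
      \<exists>p q wx d. ((\<lambda>s. w s x) has_real_derivative p) (at t) \<and> 0 < d \<and>
        (\<forall>z. \<bar>z - x\<bar> < d \<longrightarrow> (w t has_real_derivative wx z) (at z)) \<and>
        (wx has_real_derivative q) (at x) \<and> p \<le> q + C * w t x"
    and t: "t0 < t" "t \<le> t1" and x: "a \<le> x" "x \<le> b"
  shows "w t x \<le> 0"
proof (rule ccontr)
  assume "\<not> w t x \<le> 0"
  define \<mu> where "\<mu> = w t x"
  have \<mu>: "0 < \<mu>" using \<open>\<not> w t x \<le> 0\<close> by (simp add: \<mu>_def)
  define lm where "lm = max C 0 + 1"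
  have lm: "0 < lm" "C < lm" by (auto simp: lm_def)
  define b\<mu> where "b\<mu> = (\<lambda>s. \<mu> * exp (lm * (s - t)))"
  have b\<mu>_pos: "0 < b\<mu> s" for s using \<mu> by (simp add: b\<mu>_def)
  have b\<mu>_mono: "b\<mu> s \<le> b\<mu> s'" if "s \<le> s'" for s s'
    using that \<mu> lm by (simp add: b\<mu>_def)
  define S where "S = {s. t0 < s \<and> s \<le> t \<and> (\<exists>y\<in>{a..b}. b\<mu> s \<le> w s y)}"
  have tS: "t \<in> S" using t x by (auto simp: S_def b\<mu>_def \<mu>_def)
  have bdd: "bdd_below S" by (rule bdd_belowI[of _ t0]) (auto simp: S_def)
  define \<sigma> where "\<sigma> = Inf S"
  have \<sigma>le: "\<sigma> \<le> s" if "s \<in> S" for s unfolding \<sigma>_def by (rule cInf_lower[OF that bdd])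
  have \<sigma>0: "t0 \<le> \<sigma>"
    unfolding \<sigma>_def by (rule cInf_greatest) (use tS in \<open>auto simp: S_def\<close>)
  have \<sigma>S: "\<sigma> \<in> S"
  proof (rule ccontr)
    assume n: "\<sigma> \<notin> S"
    have \<sigma>t: "\<sigma> < t" using \<sigma>le[OF tS] n tS by (cases "\<sigma> = t") auto
    \<comment> \<open>If \<sigma> were not attained, \<open>w\<close> would lie below the barrier on
      the whole row \<sigma>. Semicontinuity, or \<open>bottom\<close> when \<sigma> = t0, carries
      this to slightly later times near each point, and compactness of [a, b] makes the time
      uniform.\<close>
    have loc: "\<exists>d>0. \<forall>s y. \<sigma> < s \<longrightarrow> s < \<sigma> + d \<longrightarrow> \<bar>y - z\<bar> < d \<longrightarrow> a \<le> y \<longrightarrow> y \<le> b \<longrightarrow> w s y < b\<mu> \<sigma>"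
      if z: "z \<in> {a..b}" for z
    proof (cases "\<sigma> = t0")
      case True
      thus ?thesis using bottom[of z "b\<mu> \<sigma>"] z b\<mu>_pos by auto
    next
      case False
      hence "t0 < \<sigma>" using \<sigma>0 by simp
      with n \<sigma>t z have lt: "w \<sigma> z < b\<mu> \<sigma>" by (auto simp: S_def not_le)
      have "forward_usc w \<sigma> z" using \<open>t0 < \<sigma>\<close> \<sigma>t t z by (intro fu) auto
      then obtain d where "d > 0" "\<forall>s y. \<sigma> < s \<longrightarrow> s < \<sigma> + d \<longrightarrow> \<bar>y - z\<bar> < d \<longrightarrow> w s y < w \<sigma> z + (b\<mu> \<sigma> - w \<sigma> z)"
        unfolding forward_usc_def using lt by (metis diff_gt_0_iff_gt)
      thus ?thesis by (intro exI[of _ d]) auto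
    qed
    then obtain D where D: "\<And>z. z \<in> {a..b} \<Longrightarrow> 0 < D z"
      "\<And>z s y. z \<in> {a..b} \<Longrightarrow> \<sigma> < s \<Longrightarrow> s < \<sigma> + D z \<Longrightarrow> \<bar>y - z\<bar> < D z \<Longrightarrow> a \<le> y \<Longrightarrow> y \<le> b \<Longrightarrow> w s y < b\<mu> \<sigma>"
      by metis
    obtain F where F: "F \<subseteq> {a..b}" "finite F" "{a..b} \<subseteq> (\<Union>z\<in>F. ball z (D z))"
      by (rule compactE_image[of "{a..b}" "{a..b}" "\<lambda>z. ball z (D z)"])
        (use D(1) in \<open>auto intro!: bexI\<close>)
    have Fne: "F \<noteq> {}" using F ab by auto
    define d where "d = Min (D ` F)"
    have d: "0 < d" "\<And>z. z \<in> F \<Longrightarrow> d \<le> D z"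
      using F D(1) Fne by (auto simp: d_def)
    obtain s where s: "s \<in> S" "s < \<sigma> + d"
      using cInf_less_iff[of S "\<sigma> + d"] tS bdd d(1) unfolding \<sigma>_def by fastforce
    have s\<sigma>: "\<sigma> < s" using \<sigma>le[OF s(1)] n s(1) by (cases "\<sigma> = s") auto
    obtain y where y: "y \<in> {a..b}" "b\<mu> s \<le> w s y" using s by (auto simp: S_def)
    obtain z where z: "z \<in> F" "\<bar>y - z\<bar> < D z" using F y by (auto simp: dist_real_def)
    have "w s y < b\<mu> \<sigma>"
      using z y F d(2)[OF z(1)] s s\<sigma> by (intro D(2)[of z]) auto
    thus False using b\<mu>_mono[of \<sigma> s] s\<sigma> y by simp
  qed
  have \<sigma>1: "t0 < \<sigma>" "\<sigma> \<le> t" using \<sigma>S by (auto simp: S_def)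
  obtain y where y: "y \<in> {a..b}" "b\<mu> \<sigma> \<le> w \<sigma> y" using \<sigma>S by (auto simp: S_def)
  obtain m where m: "m \<in> {a..b}" "\<And>z. z \<in> {a..b} \<Longrightarrow> w \<sigma> z \<le> w \<sigma> m"
    using continuous_attains_sup[of "{a..b}" "w \<sigma>"] cont[of \<sigma>] \<sigma>1 t ab by auto
  have wm: "b\<mu> \<sigma> \<le> w \<sigma> m" using m y by force
  hence wmp: "0 < w \<sigma> m" using b\<mu>_pos[of \<sigma>] by linarith
  have "m \<noteq> a" "m \<noteq> b" using wmp lateral[of \<sigma>] \<sigma>1 t by auto
  hence mab: "a < m" "m < b" using m by auto
  obtain p q wx d where pq: "((\<lambda>s. w s m) has_real_derivative p) (at \<sigma>)" "0 < d"
      "\<And>z. \<bar>z - m\<bar> < d \<Longrightarrow> (w \<sigma> has_real_derivative wx z) (at z)"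
      "(wx has_real_derivative q) (at m)" "p \<le> q + C * w \<sigma> m"
    using pde[OF \<sigma>1(1) _ mab wmp] \<sigma>1 t by auto
  have "q \<le> 0"
  proof (rule max_second_derivative[of "min d (min (m - a) (b - m))" m "w \<sigma>" wx])
    fix z assume "\<bar>z - m\<bar> < min d (min (m - a) (b - m))"
    thus "(w \<sigma> has_real_derivative wx z) (at z)" "w \<sigma> z \<le> w \<sigma> m"
      using pq(3)[of z] m(2)[of z] by (auto simp: abs_if split: if_splits)
  qed (use pq mab in auto)
  hence pC: "p \<le> C * w \<sigma> m" using pq(5) by simp
  \<comment> \<open>The barrier is also reached shortly before \<sigma>, against minimality: in the
    case of equality by comparing time derivatives, otherwise by continuity in time.\<close>
  have "\<exists>e>0. \<forall>h. 0 < h \<longrightarrow> h < e \<longrightarrow> b\<mu> (\<sigma> - h) \<le> w (\<sigma> - h) m"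
  proof (cases "b\<mu> \<sigma> = w \<sigma> m")
    case True
    have "((\<lambda>s. w s m - b\<mu> s) has_real_derivative (p - lm * b\<mu> \<sigma>)) (at \<sigma>)"
      unfolding b\<mu>_def by (rule derivative_eq_intros pq(1) refl | simp)+
    moreover have "p - lm * b\<mu> \<sigma> < 0"
      using pC lm(2) wmp True by (smt (verit) mult_strict_right_mono)
    ultimately obtain e where "0 < e" "\<forall>h>0. h < e \<longrightarrow> w \<sigma> m - b\<mu> \<sigma> < w (\<sigma> - h) m - b\<mu> (\<sigma> - h)"
      using DERIV_neg_dec_left by blast
    thus ?thesis using True by (intro exI[of _ e]) force
  next
    case False
    hence lt: "0 < w \<sigma> m - b\<mu> \<sigma>" using wm by simp
    have "isCont (\<lambda>s. w s m - b\<mu> s) \<sigma>"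
      unfolding b\<mu>_def by (intro continuous_intros DERIV_isCont[OF pq(1)])
    then obtain e where e: "0 < e" "\<And>s. \<bar>s - \<sigma>\<bar> < e \<Longrightarrow> \<bar>(w s m - b\<mu> s) - (w \<sigma> m - b\<mu> \<sigma>)\<bar> < w \<sigma> m - b\<mu> \<sigma>"
      using lt unfolding continuous_at_eps_delta by (metis dist_real_def)
    show ?thesis
    proof (intro exI[of _ e] conjI allI impI e(1))
      fix h assume "0 < h" "h < e"
      thus "b\<mu> (\<sigma> - h) \<le> w (\<sigma> - h) m" using e(2)[of "\<sigma> - h"] by auto
    qed
  qed
  then obtain e where e: "0 < e" "\<And>h. 0 < h \<Longrightarrow> h < e \<Longrightarrow> b\<mu> (\<sigma> - h) \<le> w (\<sigma> - h) m" by blast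
  define h where "h = min e (\<sigma> - t0) / 2"
  have h: "0 < h" "h < e" "h < \<sigma> - t0" using e \<sigma>1 by (auto simp: h_def)
  have "\<sigma> - h \<in> S" using h e(2)[of h] \<sigma>1 m by (auto simp: S_def)
  from \<sigma>le[OF this] h show False by simp
qed

section \<open>Gaussian convolutions: derivatives and initial values\<close>

lemma DERIV_integral_param:
  fixes f f' :: "real \<Rightarrow> real \<Rightarrow> real"
  assumes U: "open U" "convex U" "x \<in> U"
    and d: "\<And>y z. y \<in> U \<Longrightarrow> z \<in> {a..b} \<Longrightarrow> ((\<lambda>y. f y z) has_real_derivative f' y z) (at y)"
    and c: "\<And>y. y \<in> U \<Longrightarrow> continuous_on {a..b} (f y)"
    and c': "continuous_on (U \<times> {a..b}) (\<lambda>(y, z). f' y z)"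
  shows "((\<lambda>y. integral {a..b} (f y)) has_real_derivative integral {a..b} (f' x)) (at x)"
proof -
  have "((\<lambda>y. integral (cbox a b) (f y)) has_real_derivative integral (cbox a b) (f' x)) (at x within U)"
  proof (rule leibniz_rule_field_derivative[OF _ _ _ U(3,2)])
    show "f y integrable_on cbox a b" if "y \<in> U" for y
      using integrable_continuous_real[OF c[OF that]] by simp
    show "((\<lambda>x. f x z) has_real_derivative f' y z) (at y within U)" if "y \<in> U" "z \<in> cbox a b" for y z
      using d[of y z] that by (auto intro: has_field_derivative_at_within)
    show "continuous_on (U \<times> cbox a b) (\<lambda>(y, z). f' y z)" using c' by simp
  qed
  thus ?thesis unfolding at_within_open[OF U(3,1)] by simp
qed

lemma continuous_on_compose3:
  fixes B :: "real \<Rightarrow> real \<Rightarrow> real \<Rightarrow> real"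
  assumes c: "continuous_on T (\<lambda>(t, x, z). B t x z)"
    and "continuous_on S f" "continuous_on S g" "continuous_on S h"
    and sub: "\<And>q. q \<in> S \<Longrightarrow> (f q, g q, h q) \<in> T"
  shows "continuous_on S (\<lambda>q. B (f q) (g q) (h q))"
proof -
  have "continuous_on S (\<lambda>q. (\<lambda>(t, x, z). B t x z) (f q, g q, h q))"
    by (rule continuous_on_compose2[OF c]) (use assms in \<open>auto intro!: continuous_on_Pair\<close>)
  thus ?thesis by simp
qed

definition heat_conv :: "(real \<Rightarrow> real \<Rightarrow> real \<Rightarrow> real) \<Rightarrow> real \<Rightarrow> real \<Rightarrow> real \<Rightarrow> real \<Rightarrow> real" where
  "heat_conv B a b t x = integral {a..b} (\<lambda>z. heatG t (x - z) * B t x z)"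

context
  fixes B Bt Bx Bxx :: "real \<Rightarrow> real \<Rightarrow> real \<Rightarrow> real" and a b :: real
  assumes cB: "continuous_on ({0<..} \<times> UNIV \<times> {a..b}) (\<lambda>(t, x, z). B t x z)"
    and cBt: "continuous_on ({0<..} \<times> UNIV \<times> {a..b}) (\<lambda>(t, x, z). Bt t x z)"
    and cBx: "continuous_on ({0<..} \<times> UNIV \<times> {a..b}) (\<lambda>(t, x, z). Bx t x z)"
    and cBxx: "continuous_on ({0<..} \<times> UNIV \<times> {a..b}) (\<lambda>(t, x, z). Bxx t x z)"
    and dBt: "\<And>t x z. 0 < t \<Longrightarrow> z \<in> {a..b} \<Longrightarrow> ((\<lambda>t. B t x z) has_real_derivative Bt t x z) (at t)"
    and dBx: "\<And>t x z. 0 < t \<Longrightarrow> z \<in> {a..b} \<Longrightarrow> ((\<lambda>x. B t x z) has_real_derivative Bx t x z) (at x)"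
    and dBxx: "\<And>t x z. 0 < t \<Longrightarrow> z \<in> {a..b} \<Longrightarrow> ((\<lambda>x. Bx t x z) has_real_derivative Bxx t x z) (at x)"
begin

lemma continuous_on_heat_conv: "continuous_on ({0<..} \<times> UNIV) (\<lambda>(t, x). heat_conv B a b t x)"
proof -
  have "continuous_on (({0<..} \<times> UNIV) \<times> cbox a b)
    (\<lambda>(p, z). heatG (fst p) (snd p - z) * B (fst p) (snd p) z)"
    unfolding case_prod_beta
    by (intro continuous_intros continuous_on_heatG continuous_on_compose3[OF cB]) auto
  from integral_continuous_on_param[OF this] show ?thesis
    by (simp add: heat_conv_def case_prod_beta)
qed

text \<open>Since the Gaussian satisfies G_t = G_xx, the terms with undifferentiated
  \<open>B\<close> cancel. What remains is B_t - B_xx and the cross term -2 G_x B_x = ((x - z)/t) G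
  B_x, the transport operator that the parametrix coefficients are built to control.\<close>

lemma heat_conv_pde:
  assumes t: "0 < t"
  shows "\<exists>p q Vx. ((\<lambda>s. heat_conv B a b s x) has_real_derivative p) (at t) \<and>
    (\<forall>y. (heat_conv B a b t has_real_derivative Vx y) (at y)) \<and>
    (Vx has_real_derivative q) (at x) \<and>
    p = q + integral {a..b} (\<lambda>z. heatG t (x - z) * (Bt t x z - Bxx t x z + (x - z) / t * Bx t x z))"
proof -
  let ?Gx = "\<lambda>t x. - x / (2 * t) * heatG t x"
  let ?Gxx = "\<lambda>t x. (x\<^sup>2 / (4 * t\<^sup>2) - 1 / (2 * t)) * heatG t x"
  note cts = continuous_on_compose3[OF cB] continuous_on_compose3[OF cBt]
    continuous_on_compose3[OF cBx] continuous_on_compose3[OF cBxx]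
  define p where "p = integral {a..b} (\<lambda>z. ?Gxx t (x - z) * B t x z + heatG t (x - z) * Bt t x z)"
  define Vx where "Vx = (\<lambda>y. integral {a..b} (\<lambda>z. ?Gx t (y - z) * B t y z + heatG t (y - z) * Bx t y z))"
  define q where "q = integral {a..b} (\<lambda>z. ?Gxx t (x - z) * B t x z + 2 * (?Gx t (x - z) * Bx t x z) + heatG t (x - z) * Bxx t x z)"
  have 1: "((\<lambda>s. heat_conv B a b s x) has_real_derivative p) (at t)"
    unfolding heat_conv_def p_def
    apply (rule DERIV_integral_param[where U = "{0<..}"])
    subgoal by simp
    subgoal by simp
    subgoal using t by simp
    subgoal for y z using DERIV_mult'[OF heatG_DERIV_t[of y "x - z"] dBt[of y z x]] by (simp add: add.commute)
    subgoal by (intro continuous_intros continuous_on_heatG cts) auto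
    subgoal unfolding case_prod_beta by (intro continuous_intros continuous_on_heatG cts) auto
    done
  have GD: "((\<lambda>x. heatG t (x - z)) has_real_derivative ?Gx t (x - z)) (at x)" for x z
  proof -
    have "((\<lambda>x. heatG t (x - z)) has_real_derivative ?Gx t (x - z) * 1) (at x)"
      by (rule DERIV_chain2[OF heatG_DERIV_x[OF t]]) (auto intro!: derivative_eq_intros)
    thus ?thesis by simp
  qed
  have GDD: "((\<lambda>x. ?Gx t (x - z)) has_real_derivative ?Gxx t (x - z)) (at x)" for x z
  proof -
    have 1: "((\<lambda>x. - (x - z) / (2 * t)) has_real_derivative - 1 / (2 * t)) (at x)"
      using t by (auto intro!: derivative_eq_intros)
    have 2: "- (x - z) / (2 * t) * ?Gx t (x - z) + - 1 / (2 * t) * heatG t (x - z) = ?Gxx t (x - z)"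
      using t by (simp add: field_simps power2_eq_square)
    show ?thesis using DERIV_mult'[OF 1 GD[of z x]] unfolding 2 .
  qed
  have 2: "(heat_conv B a b t has_real_derivative Vx y) (at y)" for y
    unfolding heat_conv_def Vx_def
    apply (rule DERIV_integral_param[where U = UNIV])
    subgoal by simp
    subgoal by simp
    subgoal by simp
    subgoal for y z using DERIV_mult'[OF GD[of z y] dBx[OF t, of z y]] by (simp add: add.commute)
    subgoal using t by (intro continuous_intros continuous_on_heatG cts) auto
    subgoal unfolding case_prod_beta using t by (intro continuous_intros continuous_on_heatG cts) auto
    done
  have 3: "(Vx has_real_derivative q) (at x)"
    unfolding Vx_def q_def
    apply (rule DERIV_integral_param[where U = UNIV])
    subgoal by simp
    subgoal by simp
    subgoal by simp
    subgoal for y z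
      by (rule DERIV_cong[OF DERIV_add[OF DERIV_mult'[OF GDD[of z y] dBx[OF t, of z y]] DERIV_mult'[OF GD[of z y] dBxx[OF t, of z y]]]])
        simp_all
    subgoal using t by (intro continuous_intros continuous_on_heatG cts) auto
    subgoal unfolding case_prod_beta using t by (intro continuous_intros continuous_on_heatG cts) auto
    done
  have alg: "X * G * b0 + G * b1 - (X * G * b0 + 2 * (- y / (2 * t) * G * b2) + G * b3) = G * (b1 - b3 + y / t * b2)"
    for X G b0 b1 b2 b3 y :: real
    using t by (simp add: algebra_simps)
  have "p - q = integral {a..b} (\<lambda>z. heatG t (x - z) * (Bt t x z - Bxx t x z + (x - z) / t * Bx t x z))"
    unfolding p_def q_def
    apply (subst Henstock_Kurzweil_Integration.integral_diff[symmetric])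
    subgoal using t by (intro integrable_continuous_real continuous_intros continuous_on_heatG cts) auto
    subgoal using t by (intro integrable_continuous_real continuous_intros continuous_on_heatG cts) auto
    subgoal by (simp only: alg)
    done
  hence "p = q + integral {a..b} (\<lambda>z. heatG t (x - z) * (Bt t x z - Bxx t x z + (x - z) / t * Bx t x z))"
    by simp
  with 1 2 3 show ?thesis by blast
qed

end

lemma integral_heatG_eq_LINT:
  assumes "0 < t" "continuous_on {a..b} g"
  shows "integral {a..b} (\<lambda>z. heatG t (x - z) * g z) = (LINT z|lborel. heatG t (x - z) * (indicator {a..b} z * g z))"
proof -
  have "set_integrable lborel {a..b} (\<lambda>z. heatG t (x - z) * g z)"
    by (intro borel_integrable_atLeastAtMost' continuous_intros continuous_on_heatG assms)
  from set_borel_integral_eq_integral(2)[OF this] show ?thesis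
    by (simp add: set_lebesgue_integral_def mult.left_commute)
qed

lemma borel_measurable_indicator_Icc:
  fixes g :: "real \<Rightarrow> real"
  assumes "continuous_on {a..b} g"
  shows "(\<lambda>z. indicator {a..b} z * g z) \<in> borel_measurable borel"
  using borel_measurable_continuous_on_indicator[OF _ assms] by simp

lemma heat_integral_initial:
  assumes g: "continuous_on {a..b} g" and x0: "a < x0" "x0 < b" and e: "0 < e"
  shows "\<exists>d>0. \<forall>s y. 0 < s \<longrightarrow> s < d \<longrightarrow> \<bar>y - x0\<bar> < d \<longrightarrow>
    \<bar>integral {a..b} (\<lambda>z. heatG s (y - z) * g z) - g x0\<bar> < e"
proof -
  have "compact (g ` {a..b})" by (rule compact_continuous_image[OF g]) simp
  then obtain M0 where M0': "\<forall>y\<in>g ` {a..b}. norm y \<le> M0"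
    using compact_imp_bounded bounded_iff by blast
  have M0: "\<bar>g z\<bar> \<le> M0" if "z \<in> {a..b}" for z
    using bspec[OF M0' imageI[OF that]] by simp
  define M where "M = max M0 0"
  have M: "\<bar>g z\<bar> \<le> M" if "z \<in> {a..b}" for z using M0[OF that] by (simp add: M_def)
  have M': "0 \<le> M" by (simp add: M_def)
  have "\<exists>d>0. \<forall>z\<in>{a..b}. dist z x0 < d \<longrightarrow> dist (g z) (g x0) < e / 2"
    using g x0 e unfolding continuous_on_iff by (meson atLeastAtMost_iff half_gt_zero less_imp_le)
  then obtain d0 where d0: "0 < d0"
    "\<And>z. z \<in> {a..b} \<Longrightarrow> \<bar>z - x0\<bar> < d0 \<Longrightarrow> \<bar>g z - g x0\<bar> \<le> e / 2"
    unfolding dist_real_def by (meson less_imp_le)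
  define d1 where "d1 = min d0 (min (x0 - a) (b - x0))"
  have d1: "0 < d1" using d0 x0 by (auto simp: d1_def)
  \<comment> \<open>Outside the radius \<open>d1\<close> the term B (z - x0)^2 is at least 2M and
    dominates the oscillation of \<open>g\<close>, also where the indicator cuts it off.\<close>
  define B where "B = 2 * M / d1\<^sup>2"
  have B: "0 \<le> B" using M' by (simp add: B_def)
  let ?g = "\<lambda>z. indicator {a..b} z * g z"
  have bnd: "\<bar>?g z - g x0\<bar> \<le> e / 2 + B * (z - x0)\<^sup>2" for z
  proof (cases "\<bar>z - x0\<bar> < d1")
    case True
    hence "z \<in> {a..b}" "\<bar>z - x0\<bar> < d0" by (auto simp: d1_def)
    hence "\<bar>?g z - g x0\<bar> \<le> e / 2" using d0(2) by simp
    thus ?thesis using B by (smt (verit) mult_nonneg_nonneg zero_le_power2)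
  next
    case False
    have "\<bar>?g z\<bar> \<le> M" using M[of z] M' by (simp add: indicator_def)
    moreover have "\<bar>g x0\<bar> \<le> M" using M x0 by simp
    ultimately have "\<bar>?g z - g x0\<bar> \<le> 2 * M" by linarith
    also have "2 * M \<le> B * (z - x0)\<^sup>2"
    proof -
      have "d1\<^sup>2 \<le> (z - x0)\<^sup>2" using False d1 by (simp add: abs_le_square_iff[symmetric])
      hence "B * d1\<^sup>2 \<le> B * (z - x0)\<^sup>2" using B by (rule mult_left_mono)
      thus ?thesis using d1 by (simp add: B_def)
    qed
    finally show ?thesis using e by simp
  qed
  \<comment> \<open>This choice gives 8 B d <= e, while 2 s + (y - x0)^2 <= 3 d because d <=
    1.\<close>
  define d where "d = min 1 (e / (8 * (B + 1)))"
  have d: "0 < d" "d \<le> 1" "d \<le> e / (8 * (B + 1))" using e B by (auto simp: d_def)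
  have Bd: "8 * B * d \<le> e"
  proof -
    have "d * (8 * (B + 1)) \<le> e" using d(3) B by (simp add: pos_le_divide_eq)
    thus ?thesis using d(1) by (simp add: algebra_simps)
  qed
  show ?thesis
  proof (intro exI[of _ d] conjI allI impI d(1))
    fix s y assume s: "0 < s" "s < d" and y: "\<bar>y - x0\<bar> < d"
    have "(y - x0)\<^sup>2 \<le> d\<^sup>2" using y by (simp add: abs_le_square_iff[symmetric])
    also have "\<dots> \<le> d" using d by (simp add: power2_eq_square mult_left_le)
    finally have "2 * s + (y - x0)\<^sup>2 \<le> 3 * d" using s by simp
    hence "B * (2 * s + (y - x0)\<^sup>2) \<le> B * (3 * d)" using B by (rule mult_left_mono)
    hence 1: "B * (2 * s + (y - x0)\<^sup>2) < e / 2" using Bd e by linarith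
    have "\<bar>(LINT z|lborel. heatG s (y - z) * ?g z) - g x0\<bar> \<le> e / 2 + B * (2 * s + (y - x0)\<^sup>2)"
      by (rule heatG_approx_identity(1)[OF s(1) borel_measurable_indicator_Icc[OF g] bnd])
    thus "\<bar>integral {a..b} (\<lambda>z. heatG s (y - z) * g z) - g x0\<bar> < e"
      unfolding integral_heatG_eq_LINT[OF s(1) g] using 1 by linarith
  qed
qed

section \<open>Bounded subsolutions on a thin strip\<close>

lemma forward_usc_add:
  assumes f: "forward_usc f t x" and g: "isCont (\<lambda>(s, y). g s y) (t, x)"
  shows "forward_usc (\<lambda>s y. f s y + g s y) t x"
  unfolding forward_usc_def
proof (intro allI impI)
  fix e :: real assume e: "0 < e"
  obtain d1 where d1: "0 < d1" "\<And>s y. t < s \<Longrightarrow> s < t + d1 \<Longrightarrow> \<bar>y - x\<bar> < d1 \<Longrightarrow> f s y < f t x + e / 2"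
    using f e unfolding forward_usc_def by (meson half_gt_zero)
  have "\<exists>d>0. \<forall>p. dist p (t, x) < d \<longrightarrow> dist (case p of (s, y) \<Rightarrow> g s y) (case (t, x) of (s, y) \<Rightarrow> g s y) < e / 2"
    using g e unfolding continuous_at_eps_delta by (meson half_gt_zero)
  then obtain d2 where d2: "0 < d2" "\<And>s y. dist (s, y) (t, x) < d2 \<Longrightarrow> \<bar>g s y - g t x\<bar> < e / 2"
    by (auto simp: dist_real_def)
  define d where "d = min d1 (d2 / 2)"
  show "\<exists>d>0. \<forall>s y. t < s \<longrightarrow> s < t + d \<longrightarrow> \<bar>y - x\<bar> < d \<longrightarrow> f s y + g s y < f t x + g t x + e"
  proof (intro exI[of _ d] conjI allI impI)
    fix s y assume s: "t < s" "s < t + d" and y: "\<bar>y - x\<bar> < d"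
    have "dist (s, y) (t, x) \<le> \<bar>s - t\<bar> + \<bar>y - x\<bar>"
      by (simp add: dist_Pair_Pair dist_real_def sqrt_sum_squares_le_sum_abs)
    also have "\<dots> < d2" using s y unfolding d_def by linarith
    finally have "\<bar>g s y - g t x\<bar> < e / 2" by (rule d2(2))
    moreover have "f s y < f t x + e / 2" by (rule d1(2)) (use s y in \<open>simp_all add: d_def\<close>)
    ultimately show "f s y + g s y < f t x + g t x + e" by linarith
  next
    show "0 < d" using d1(1) d2(1) by (simp add: d_def)
  qed
qed

text \<open>For a heat kernel column the zeroth-order term u f is absorbed into \<open>C\<close> by
  means of a bound on f, so that both f and -f become instances.\<close>

locale subsolution =
  fixes f ft fx fxx :: "real \<Rightarrow> real \<Rightarrow> real" and T1 T2 X1 X2 K C :: real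
  assumes bd: "\<And>t x. T1 < t \<Longrightarrow> t < T2 \<Longrightarrow> X1 < x \<Longrightarrow> x < X2 \<Longrightarrow> \<bar>f t x\<bar> \<le> K"
    and dt: "\<And>t x. T1 < t \<Longrightarrow> t < T2 \<Longrightarrow> X1 < x \<Longrightarrow> x < X2 \<Longrightarrow> ((\<lambda>s. f s x) has_real_derivative ft t x) (at t)"
    and dx: "\<And>t x. T1 < t \<Longrightarrow> t < T2 \<Longrightarrow> X1 < x \<Longrightarrow> x < X2 \<Longrightarrow> (f t has_real_derivative fx t x) (at x)"
    and dxx: "\<And>t x. T1 < t \<Longrightarrow> t < T2 \<Longrightarrow> X1 < x \<Longrightarrow> x < X2 \<Longrightarrow> (fx t has_real_derivative fxx t x) (at x)"
    and le: "\<And>t x. T1 < t \<Longrightarrow> t < T2 \<Longrightarrow> X1 < x \<Longrightarrow> x < X2 \<Longrightarrow> ft t x \<le> fxx t x + C"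
    and C: "0 \<le> C" and K: "0 \<le> K"
begin

lemma continuous_on_x: "T1 < t \<Longrightarrow> t < T2 \<Longrightarrow> X1 < a \<Longrightarrow> b < X2 \<Longrightarrow> continuous_on {a..b} (f t)"
  by (intro continuous_at_imp_continuous_on ballI DERIV_isCont[OF dx]) auto

text \<open>The comparison function is \<open>m\<close>, plus linear growth from \<open>C\<close>,
  plus a quadratic solution of the heat equation, plus the heat flow of the positive part of
  \<open>f c - m\<close>. The factor 2 K / r^2 makes the quadratic at least 2 K, hence at least f -
  m, on the sides |x - x0| = r.\<close>

lemma strip_estimate_aux:
  assumes c: "T1 < c" "c < s" "s < T2" and r: "0 < r" "X1 < x0 - r" "x0 + r < X2"
    and fu: "\<And>\<tau> y. c \<le> \<tau> \<Longrightarrow> \<tau> < s \<Longrightarrow> \<bar>y - x0\<bar> \<le> r \<Longrightarrow> forward_usc f \<tau> y"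
    and m: "- K \<le> m" and x: "\<bar>x - x0\<bar> \<le> r"
  shows "f s x \<le> m + C * (s - c) + 2 * K / r\<^sup>2 * ((x - x0)\<^sup>2 + 2 * (s - c))
    + integral {x0 - r..x0 + r} (\<lambda>z. heatG (s - c) (x - z) * max 0 (f c z - m))"
proof -
  define a b Q where "a = x0 - r" and "b = x0 + r" and "Q = 2 * K / r\<^sup>2"
  have Q: "0 \<le> Q" using K by (simp add: Q_def)
  define \<psi> where "\<psi> = (\<lambda>z. max 0 (f c z - m))"
  have c\<psi>: "continuous_on {a..b} \<psi>"
    unfolding \<psi>_def using c r by (intro continuous_intros continuous_on_x) (auto simp: a_def b_def)
  define V where "V = heat_conv (\<lambda>_ _. \<psi>) a b"
  have V: "V t x = integral {a..b} (\<lambda>z. heatG t (x - z) * \<psi> z)" for t x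
    by (simp add: V_def heat_conv_def)
  have cB: "continuous_on ({0<..} \<times> UNIV \<times> {a..b}) (\<lambda>(t::real, x::real, z). \<psi> z)"
    unfolding case_prod_beta by (intro continuous_on_compose2[OF c\<psi>] continuous_intros) auto
  have c0: "continuous_on ({0<..} \<times> UNIV \<times> {a..b}) (\<lambda>(t::real, x::real, z::real). 0::real)"
    by (simp add: case_prod_beta)
  have cV: "continuous_on ({0<..} \<times> UNIV) (\<lambda>(t, x). V t x)"
    unfolding V_def by (rule continuous_on_heat_conv[OF cB c0 c0 c0]) auto
  have pdeV: "\<exists>p q Vx. ((\<lambda>s. V s x) has_real_derivative p) (at t) \<and>
    (\<forall>y. (V t has_real_derivative Vx y) (at y)) \<and> (Vx has_real_derivative q) (at x) \<and> p = q"
    if "0 < t" for t x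
    using heat_conv_pde[OF cB c0 c0 c0 _ _ _ that, of x] by (auto simp: V_def)
  have V0: "0 \<le> V t x" if "0 < t" for t x
    unfolding V
    by (rule Henstock_Kurzweil_Integration.integral_nonneg)
      (use that c\<psi> in \<open>auto simp: \<psi>_def heatG_nonneg intro!: integrable_continuous_real continuous_intros continuous_on_heatG\<close>)
  define w where "w = (\<lambda>t x. f t x + - (m + C * (t - c) + Q * ((x - x0)\<^sup>2 + 2 * (t - c)) + V (t - c) x))"
  have isC: "isCont (\<lambda>(t, x). - (m + C * (t - c) + Q * ((x - x0)\<^sup>2 + 2 * (t - c)) + V (t - c) x)) (t, y)"
    if "c < t" for t y
  proof -
    have "continuous_on ({c<..} \<times> UNIV) (\<lambda>p. V (fst p - c) (snd p))"
      by (rule continuous_on_compose2[OF cV, of _ "\<lambda>p. (fst p - c, snd p)", unfolded case_prod_beta fst_conv snd_conv])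
        (auto intro!: continuous_intros)
    hence "continuous_on ({c<..} \<times> UNIV) (\<lambda>(t, x). - (m + C * (t - c) + Q * ((x - x0)\<^sup>2 + 2 * (t - c)) + V (t - c) x))"
      unfolding case_prod_beta by (intro continuous_intros)
    moreover have "open ({c<..} \<times> (UNIV :: real set))" by (intro open_Times) auto
    ultimately show ?thesis using that by (simp add: continuous_on_eq_continuous_at)
  qed
  have rQ: "Q * r\<^sup>2 = 2 * K" using r by (simp add: Q_def)
  have "w s x \<le> 0"
  proof (rule max_principle[where w = w and a = a and b = b and ?t0.0 = c and ?t1.0 = s and C = 0])
    show "a < b" using r by (simp add: a_def b_def)
    fix t assume t: "c < t" "t \<le> s"
    have dom: "T1 < t" "t < T2" using t c by auto
    show "continuous_on {a..b} (w t)"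
    proof -
      have "continuous_on {a..b} (V (t - c))"
        by (rule continuous_on_compose2[OF cV, of _ "\<lambda>x. (t - c, x)", unfolded case_prod_beta fst_conv snd_conv])
          (use t in \<open>auto intro!: continuous_intros\<close>)
      thus ?thesis unfolding w_def using dom r
        by (intro continuous_intros continuous_on_x) (auto simp: a_def b_def)
    qed
    have Vp: "0 \<le> V (t - c) y" for y using V0 t by simp
    have "w t y \<le> 0" if "\<bar>y - x0\<bar> = r" for y
    proof -
      have y2: "(y - x0)\<^sup>2 = r\<^sup>2" using that by (metis power2_abs)
      have "X1 < y" "y < X2" using that r by linarith+
      hence "f t y \<le> K" using bd[of t y] dom by auto
      moreover have "0 \<le> C * (t - c)" "0 \<le> Q * (2 * (t - c))" using C Q t by auto
      ultimately show ?thesis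
        unfolding w_def y2 using rQ Vp[of y] m by (simp add: distrib_left)
    qed
    from this[of a] this[of b] show "w t a \<le> 0 \<and> w t b \<le> 0" using r by (simp add: a_def b_def)
    fix y assume y: "a < y" "y < b"
    define d where "d = min (y - a) (b - y)"
    have yd: "X1 < z" "z < X2" if "\<bar>z - y\<bar> < d" for z using that r by (auto simp: d_def a_def b_def)
    have d: "0 < d" using y by (simp add: d_def)
    have yX: "X1 < y" "y < X2" using yd[of y] d by auto
    obtain p q Vx where p: "((\<lambda>s. V s y) has_real_derivative p) (at (t - c))"
      and Vx: "\<And>y. (V (t - c) has_real_derivative Vx y) (at y)" and q: "(Vx has_real_derivative q) (at y)"
      and pq: "p = q" using pdeV[of "t - c" y] t by auto
    have p': "((\<lambda>s. V (s - c) y) has_real_derivative p) (at t)"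
      using DERIV_shift[of "\<lambda>s. V s y" p t "- c"] p by simp
    show "\<exists>p q wx d. ((\<lambda>s. w s y) has_real_derivative p) (at t) \<and> 0 < d \<and>
        (\<forall>z. \<bar>z - y\<bar> < d \<longrightarrow> (w t has_real_derivative wx z) (at z)) \<and>
        (wx has_real_derivative q) (at y) \<and> p \<le> q + 0 * w t y"
    proof (intro exI conjI allI impI)
      show "((\<lambda>s. w s y) has_real_derivative (ft t y - (C + 2 * Q + p))) (at t)"
        unfolding w_def by (auto intro!: derivative_eq_intros dt[OF dom yX] p')
      show "(w t has_real_derivative (\<lambda>z. fx t z - (2 * Q * (z - x0) + Vx z)) z) (at z)" if "\<bar>z - y\<bar> < d" for z
        unfolding w_def by (auto intro!: derivative_eq_intros dx[OF dom yd[OF that]] Vx)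
      show "((\<lambda>z. fx t z - (2 * Q * (z - x0) + Vx z)) has_real_derivative (fxx t y - (2 * Q + q))) (at y)"
        by (auto intro!: derivative_eq_intros dxx[OF dom yX] q)
      show "ft t y - (C + 2 * Q + p) \<le> fxx t y - (2 * Q + q) + 0 * w t y"
        using le[OF dom yX] pq by simp
    qed (rule d)
  next
    fix t y assume t: "c < t" "t < s" and y: "a \<le> y" "y \<le> b"
    have "forward_usc f t y" using fu[of t y] t y by (auto simp: a_def b_def)
    thus "forward_usc w t y" unfolding w_def by (rule forward_usc_add[OF _ isC[OF t(1)]])
  next
    fix y e :: real assume y: "a \<le> y" "y \<le> b" and e: "0 < e"
    have yr: "\<bar>y - x0\<bar> \<le> r" using y by (auto simp: a_def b_def)
    show "\<exists>d>0. \<forall>s' y'. c < s' \<longrightarrow> s' < c + d \<longrightarrow> \<bar>y' - y\<bar> < d \<longrightarrow> a \<le> y' \<longrightarrow> y' \<le> b \<longrightarrow> w s' y' < e"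
    proof (cases "a < y \<and> y < b")
      case True
      obtain d1 where d1: "0 < d1" "\<And>s' y'. c < s' \<Longrightarrow> s' < c + d1 \<Longrightarrow> \<bar>y' - y\<bar> < d1 \<Longrightarrow> f s' y' < f c y + e / 2"
        using fu[of c y] c yr e unfolding forward_usc_def by (meson half_gt_zero order_refl)
      obtain d2 where d2: "0 < d2" "\<And>s y'. 0 < s \<Longrightarrow> s < d2 \<Longrightarrow> \<bar>y' - y\<bar> < d2 \<Longrightarrow> \<bar>V s y' - \<psi> y\<bar> < e / 2"
        using heat_integral_initial[OF c\<psi>, of y "e/2"] True e unfolding V by auto
      show ?thesis
      proof (intro exI[of _ "min d1 d2"] conjI allI impI)
        fix s' y' assume s': "c < s'" "s' < c + min d1 d2" and y': "\<bar>y' - y\<bar> < min d1 d2" "a \<le> y'" "y' \<le> b"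
        have "f s' y' < f c y + e / 2" using s' y' by (intro d1(2)) auto
        moreover have "\<bar>V (s' - c) y' - \<psi> y\<bar> < e / 2" using s' y' by (intro d2(2)) auto
        moreover have "f c y - m \<le> \<psi> y" by (simp add: \<psi>_def)
        moreover have "0 \<le> C * (s' - c)" "0 \<le> Q * ((y' - x0)\<^sup>2 + 2 * (s' - c))" using C Q s' by auto
        ultimately show "w s' y' < e" unfolding w_def by linarith
      next
        show "0 < min d1 d2" using d1(1) d2(1) by simp
      qed
    next
      \<comment> \<open>At an endpoint the heat flow of the truncated datum need not tend to
        \<open>\<psi> y\<close>. The quadratic term, close to 2 K there, suffices without
        it.\<close>
      case False
      hence "\<bar>y - x0\<bar> = r" using y by (auto simp: a_def b_def)
      hence y2: "Q * (y - x0)\<^sup>2 = 2 * K" using rQ by (metis power2_abs)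
      have "isCont (\<lambda>y. Q * (y - x0)\<^sup>2) y" by (intro continuous_intros)
      then obtain d where d: "0 < d" "\<And>y'. \<bar>y' - y\<bar> < d \<Longrightarrow> \<bar>Q * (y' - x0)\<^sup>2 - 2 * K\<bar> < e"
        using e y2 unfolding continuous_at_eps_delta dist_real_def by metis
      show ?thesis
      proof (intro exI[of _ "min d (s - c)"] conjI allI impI)
        fix s' y' assume s': "c < s'" "s' < c + min d (s - c)" and y': "\<bar>y' - y\<bar> < min d (s - c)" "a \<le> y'" "y' \<le> b"
        have "s' < T2" "T1 < s'" "X1 < y'" "y' < X2" using s' c r y' by (auto simp: a_def b_def)
        hence "f s' y' \<le> K" using bd[of s' y'] by auto
        moreover have "\<bar>Q * (y' - x0)\<^sup>2 - 2 * K\<bar> < e" using y' by (intro d(2)) auto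
        moreover have "0 \<le> C * (s' - c)" "0 \<le> Q * (2 * (s' - c))" "0 \<le> V (s' - c) y'" using C Q s' V0 by auto
        ultimately show "w s' y' < e" unfolding w_def distrib_left using m by linarith
      next
        show "0 < min d (s - c)" using d(1) c by simp
      qed
    qed
  next
    show "a \<le> x" "x \<le> b" using x unfolding a_def b_def by linarith+
  qed (use c in simp_all)
  thus ?thesis unfolding w_def V \<psi>_def Q_def a_def b_def by linarith
qed

text \<open>Semicontinuity is now available only after time \<open>c\<close>, so the auxiliary
  estimate is started at times \<open>c' j\<close> decreasing to \<open>c\<close>. Continuity in
  time at each fixed point gives f (c' j) z -> f c z <= m, and dominated convergence removes the
  integral of the excess over \<open>m\<close>.\<close>

lemma strip_estimate:
  assumes c: "T1 < c" "c < s" "s < T2" and r: "0 < r" "X1 < x0 - r" "x0 + r < X2"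
    and fu: "\<And>\<tau> y. c < \<tau> \<Longrightarrow> \<tau> < s \<Longrightarrow> \<bar>y - x0\<bar> \<le> r \<Longrightarrow> forward_usc f \<tau> y"
    and m: "- K \<le> m" "\<And>y. \<bar>y - x0\<bar> \<le> r \<Longrightarrow> f c y \<le> m" and x: "\<bar>x - x0\<bar> \<le> r"
  shows "f s x \<le> m + C * (s - c) + 2 * K / r\<^sup>2 * ((x - x0)\<^sup>2 + 2 * (s - c))"
proof -
  \<comment> \<open>The offset 2 keeps every \<open>c' j\<close> in the first half of the strip, so
    the Gaussians at times s - c' j share one bound.\<close>
  define c' where "c' = (\<lambda>j::nat. c + (s - c) * inverse (real (Suc (Suc j))))"
  have pos: "0 < (s - c) * inverse (real (Suc (Suc j)))" "(s - c) * inverse (real (Suc (Suc j))) \<le> (s - c) / 2" for j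
  proof -
    have "inverse (real (Suc (Suc j))) \<le> inverse 2" by (rule le_imp_inverse_le) auto
    hence "(s - c) * inverse (real (Suc (Suc j))) \<le> (s - c) * inverse 2"
      using c by (intro mult_left_mono) auto
    thus "(s - c) * inverse (real (Suc (Suc j))) \<le> (s - c) / 2" by (simp only: divide_inverse)
  qed (use c in simp)
  have c': "c < c' j" "c' j < s" "(s - c) / 2 \<le> s - c' j" for j
  proof -
    define i where "i = (s - c) * inverse (real (Suc (Suc j)))"
    have "0 < i" "i \<le> (s - c) / 2" "c' j = c + i"
      using pos[of j] unfolding i_def c'_def by (blast, blast, simp only:)
    with c(2) show "c < c' j" "c' j < s" "(s - c) / 2 \<le> s - c' j" by simp_all
  qed
  have c'lim: "c' \<longlonglongrightarrow> c"
    unfolding c'_def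
    using tendsto_add[OF tendsto_const tendsto_mult[OF tendsto_const LIMSEQ_Suc[OF LIMSEQ_inverse_real_of_nat]], of c "s - c"]
    by simp
  let ?S = "{x0 - r..x0 + r}"
  define h where "h = (\<lambda>j z. heatG (s - c' j) (x - z) * max 0 (f (c' j) z - m))"
  have cts: "continuous_on ?S (h j)" for j
    unfolding h_def using c' c r order.strict_trans[OF c(1) c'(1)] order.strict_trans[OF c'(2) c(3)]
    by (intro continuous_intros continuous_on_heatG continuous_on_x) auto
  have est: "f s x \<le> m + C * (s - c' j) + 2 * K / r\<^sup>2 * ((x - x0)\<^sup>2 + 2 * (s - c' j)) + integral ?S (h j)" for j
    unfolding h_def
    by (rule strip_estimate_aux) (use c' c r m x fu order.strict_trans[OF c(1) c'(1)] less_le_trans[OF c'(1)] in auto)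
  define M where "M = 1 / sqrt (4 * pi * ((s - c) / 2))"
  have G: "0 \<le> heatG (s - c' j) y" "heatG (s - c' j) y \<le> M" for j y
  proof -
    have p: "0 < s - c' j" using c' by simp
    show "0 \<le> heatG (s - c' j) y" by (rule heatG_nonneg[OF p])
    have "heatG (s - c' j) y \<le> 1 / sqrt (4 * pi * (s - c' j))" by (rule heatG_le[OF p])
    also have "\<dots> \<le> M" unfolding M_def
    proof (rule divide_left_mono)
      show "sqrt (4 * pi * ((s - c) / 2)) \<le> sqrt (4 * pi * (s - c' j))"
        using c'(3)[of j] by (intro real_sqrt_le_mono mult_left_mono) auto
      show "0 < sqrt (4 * pi * (s - c' j)) * sqrt (4 * pi * ((s - c) / 2))"
        using p c by simp
    qed simp
    finally show "heatG (s - c' j) y \<le> M" .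
  qed
  have M0: "0 \<le> M" using G[of 0 0] by linarith
  have "(\<lambda>j. integral ?S (h j)) \<longlonglongrightarrow> integral ?S (\<lambda>z. 0)"
  proof (rule dominated_convergence(2)[where h = "\<lambda>_. M * (2 * K)"])
    show "h j integrable_on ?S" for j by (rule integrable_continuous_real[OF cts])
    show "norm (h j z) \<le> M * (2 * K)" if "z \<in> ?S" for j z
    proof -
      have "f (c' j) z \<le> K"
        using bd[of "c' j" z] c'[of j] c r that by auto
      hence "max 0 (f (c' j) z - m) \<le> 2 * K" using m K by auto
      hence "heatG (s - c' j) (x - z) * max 0 (f (c' j) z - m) \<le> M * (2 * K)"
        using G M0 by (intro mult_mono) auto
      thus ?thesis using G[of j "x - z"] by (simp add: h_def abs_mult)
    qed
    show "(\<lambda>j. h j z) \<longlonglongrightarrow> 0" if "z \<in> ?S" for z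
    proof -
      have "isCont (\<lambda>t. f t z) c" using that c r by (intro DERIV_isCont[OF dt]) auto
      hence "(\<lambda>j. f (c' j) z) \<longlonglongrightarrow> f c z" using c'lim by (simp add: continuous_at_sequentially o_def)
      hence "(\<lambda>j. M * max 0 (f (c' j) z - m)) \<longlonglongrightarrow> M * max 0 (f c z - m)" by (intro tendsto_intros)
      moreover have "max 0 (f c z - m) = 0" using m(2)[of z] that by (auto simp: abs_if)
      ultimately have "(\<lambda>j. M * max 0 (f (c' j) z - m)) \<longlonglongrightarrow> 0" by simp
      thus ?thesis
        by (rule Lim_null_comparison[rotated]) (use G in \<open>auto simp: h_def abs_mult intro!: mult_right_mono always_eventually\<close>)
    qed
  qed auto
  hence "(\<lambda>j. integral ?S (h j)) \<longlonglongrightarrow> 0" by simp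
  hence "(\<lambda>j. m + C * (s - c' j) + 2 * K / r\<^sup>2 * ((x - x0)\<^sup>2 + 2 * (s - c' j)) + integral ?S (h j))
    \<longlonglongrightarrow> m + C * (s - c) + 2 * K / r\<^sup>2 * ((x - x0)\<^sup>2 + 2 * (s - c)) + 0"
    by (intro tendsto_intros c'lim)
  from LIMSEQ_le_const[OF this] est show ?thesis by auto
qed

end

section \<open>Forward semicontinuity of bounded subsolutions\<close>

text \<open>Joint continuity is avoided by comparing both g(t + h, xs j) and g(t, xs j) with g(ts j,
  xs j), and then letting xs j tend to x along the two fixed first arguments t + h and t. This makes
  the sets of uniform Lipschitz points closed.\<close>

lemma locally_lipschitz_limit:
  fixes g :: "real \<Rightarrow> real \<Rightarrow> real"
  assumes t: "ts \<longlonglongrightarrow> t" and x: "xs \<longlonglongrightarrow> x"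
    and lip: "\<And>j h. \<bar>h\<bar> < r \<Longrightarrow> \<bar>g (ts j + h) (xs j) - g (ts j) (xs j)\<bar> \<le> L * \<bar>h\<bar>"
    and cont: "\<And>h. \<bar>h\<bar> < r \<Longrightarrow> isCont (g (t + h)) x"
    and h: "\<bar>h\<bar> < r"
  shows "\<bar>g (t + h) x - g t x\<bar> \<le> L * \<bar>h\<bar>"
proof -
  have conv: "(\<lambda>j. g (t + k) (xs j)) \<longlonglongrightarrow> g (t + k) x" if "\<bar>k\<bar> < r" for k
    by (rule isCont_tendsto_compose[OF cont[OF that] x])
  have ev: "eventually (\<lambda>j. \<bar>g (t + k) (xs j) - g (ts j) (xs j)\<bar> \<le> L * \<bar>t + k - ts j\<bar>) sequentially"
    if "\<bar>k\<bar> < r" for k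
  proof -
    have "(\<lambda>j. \<bar>t + k - ts j\<bar>) \<longlonglongrightarrow> \<bar>t + k - t\<bar>" by (intro tendsto_intros t)
    hence "eventually (\<lambda>j. \<bar>t + k - ts j\<bar> < r) sequentially"
      using that by (intro order_tendstoD(2)) auto
    thus ?thesis
    proof eventually_elim
      case (elim j)
      have eq: "ts j + (t + k - ts j) = t + k" by simp
      show ?case using lip[OF elim, of j] unfolding eq .
    qed
  qed
  have lim: "(\<lambda>j. L * \<bar>t + k - ts j\<bar>) \<longlonglongrightarrow> L * \<bar>k\<bar>" for k
    using tendsto_mult[OF tendsto_const tendsto_rabs[OF tendsto_diff[OF tendsto_const t]], of L "t + k"] by simp
  have r: "\<bar>0::real\<bar> < r" using h by simp
  have "(\<lambda>j. \<bar>g (t + h) (xs j) - g (t + 0) (xs j)\<bar>) \<longlonglongrightarrow> \<bar>g (t + h) x - g (t + 0) x\<bar>"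
    by (intro tendsto_intros conv h r)
  moreover have "(\<lambda>j. L * \<bar>t + h - ts j\<bar> + L * \<bar>t + 0 - ts j\<bar>) \<longlonglongrightarrow> L * \<bar>h\<bar> + L * \<bar>0\<bar>"
    by (intro tendsto_add lim)
  moreover have "eventually (\<lambda>j. \<bar>g (t + h) (xs j) - g (t + 0) (xs j)\<bar> \<le> L * \<bar>t + h - ts j\<bar> + L * \<bar>t + 0 - ts j\<bar>) sequentially"
    using ev[OF h] ev[OF r] by eventually_elim linarith
  ultimately have "\<bar>g (t + h) x - g (t + 0) x\<bar> \<le> L * \<bar>h\<bar> + L * \<bar>0\<bar>"
    by (intro tendsto_le[OF trivial_limit_sequentially])
  thus ?thesis by simp
qed

text \<open>Differentiability bounds the difference quotient near 0 and boundedness bounds it away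
  from 0. Hence countably many Lipschitz constants cover all points, as Baire's theorem
  requires.\<close>

lemma pointwise_lipschitz:
  fixes g :: "real \<Rightarrow> real"
  assumes d: "(g has_real_derivative D) (at t)" and b: "\<And>h. \<bar>h\<bar> < r \<Longrightarrow> \<bar>g (t + h)\<bar> \<le> K" and r: "0 < r"
  shows "\<exists>L. \<forall>h. \<bar>h\<bar> < r \<longrightarrow> \<bar>g (t + h) - g t\<bar> \<le> L * \<bar>h\<bar>"
proof -
  have "(\<lambda>h. (g (t + h) - g t) / h) \<midarrow>0\<rightarrow> D" using d by (simp add: DERIV_def)
  then obtain s where s: "0 < s" "\<And>h. h \<noteq> 0 \<Longrightarrow> \<bar>h\<bar> < s \<Longrightarrow> \<bar>(g (t + h) - g t) / h - D\<bar> < 1"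
    unfolding LIM_eq by (metis diff_zero real_norm_def zero_less_one)
  have K: "\<bar>g t\<bar> \<le> K" using b[of 0] r by simp
  show ?thesis
  proof (intro exI[of _ "\<bar>D\<bar> + 1 + 2 * K / s"] allI impI)
    fix h assume h: "\<bar>h\<bar> < r"
    have K0: "0 \<le> K" using K by linarith
    have split: "(\<bar>D\<bar> + 1 + 2 * K / s) * \<bar>h\<bar> = (\<bar>D\<bar> + 1) * \<bar>h\<bar> + 2 * K / s * \<bar>h\<bar>" by (simp add: algebra_simps)
    show "\<bar>g (t + h) - g t\<bar> \<le> (\<bar>D\<bar> + 1 + 2 * K / s) * \<bar>h\<bar>"
    proof (cases "\<bar>h\<bar> < s")
      case True
      show ?thesis
      proof (cases "h = 0")
        case False
        have "\<bar>(g (t + h) - g t) / h\<bar> \<le> \<bar>D\<bar> + 1" using s(2)[OF False True] by linarith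
        hence "\<bar>g (t + h) - g t\<bar> \<le> (\<bar>D\<bar> + 1) * \<bar>h\<bar>" using False by (simp add: field_simps abs_divide)
        moreover have "0 \<le> 2 * K / s * \<bar>h\<bar>" using K0 s by simp
        ultimately show ?thesis unfolding split by linarith
      qed simp
    next
      case False
      have "2 * K = 2 * K / s * s" using s by simp
      also have "\<dots> \<le> 2 * K / s * \<bar>h\<bar>" using False K0 s by (intro mult_left_mono) auto
      finally have "2 * K \<le> 2 * K / s * \<bar>h\<bar>" .
      moreover have "\<bar>g (t + h) - g t\<bar> \<le> 2 * K" using b[OF h] K by linarith
      moreover have "0 \<le> (\<bar>D\<bar> + 1) * \<bar>h\<bar>" by simp
      ultimately show ?thesis unfolding split by linarith
    qed
  qed
qed

context subsolution
begin

text \<open>The Lipschitz bounds on \<open>F\<close> transport the value at (\<sigma>, x0) to the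
  last row that meets \<open>F\<close> before the time of interest; from there on the strip contains
  only good points and the strip estimate applies.\<close>

lemma forward_usc_of_lipschitz:
  assumes \<epsilon>: "0 < \<epsilon>" "\<And>\<tau> y. \<bar>\<tau> - \<sigma>\<bar> < \<epsilon> \<Longrightarrow> \<bar>y - x0\<bar> < \<epsilon> \<Longrightarrow> T1 < \<tau> \<and> \<tau> < T2 \<and> X1 < y \<and> y < X2"
    and F: "closed F" "(\<sigma>, x0) \<in> F"
    and good: "\<And>\<tau> y. \<bar>\<tau> - \<sigma>\<bar> < \<epsilon> \<Longrightarrow> \<bar>y - x0\<bar> < \<epsilon> \<Longrightarrow> (\<tau>, y) \<notin> F \<Longrightarrow> forward_usc f \<tau> y"
    and L: "0 \<le> L" and r0: "0 < r0"
    and lipt: "\<And>\<tau> y h. \<bar>\<tau> - \<sigma>\<bar> < \<epsilon> \<Longrightarrow> \<bar>y - x0\<bar> < \<epsilon> \<Longrightarrow> (\<tau>, y) \<in> F \<Longrightarrow> \<bar>h\<bar> < r0 \<Longrightarrow> \<bar>f (\<tau> + h) y - f \<tau> y\<bar> \<le> L * \<bar>h\<bar>"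
    and lipx: "\<And>\<tau> y h. \<bar>\<tau> - \<sigma>\<bar> < \<epsilon> \<Longrightarrow> \<bar>y - x0\<bar> < \<epsilon> \<Longrightarrow> (\<tau>, y) \<in> F \<Longrightarrow> \<bar>h\<bar> < r0 \<Longrightarrow> \<bar>f \<tau> (y + h) - f \<tau> y\<bar> \<le> L * \<bar>h\<bar>"
  shows "forward_usc f \<sigma> x0"
  unfolding forward_usc_def
proof (intro allI impI)
  fix e :: real assume e: "0 < e"
  \<comment> \<open>The Lipschitz moves below cost 3 L r + L (s - \<sigma>). The choice of
    \<open>r\<close> makes 3 L r less than e/2, and \<open>d\<close> makes everything proportional
    to \<open>d\<close>, collected in A d, at most e/2.\<close>
  define r where "r = min (min (\<epsilon> / 2) (r0 / 3)) (e / (8 * (L + 1)))"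
  have r: "0 < r" "r < \<epsilon>" "3 * r \<le> r0" "2 * r < r0" using \<epsilon> r0 e L by (auto simp: r_def)
  have "r * (8 * (L + 1)) \<le> e" using L unfolding r_def by (subst pos_le_divide_eq[symmetric]) auto
  hence Lr: "8 * (L * r) < e" using r(1) by (simp add: algebra_simps)
  define Q where "Q = 2 * K / r\<^sup>2"
  have Q: "0 \<le> Q" using K by (simp add: Q_def)
  define A where "A = L + C + 3 * Q + 1"
  have A: "0 < A" using L C Q by (simp add: A_def)
  define d where "d = min (min r 1) (e / (2 * A))"
  have d: "0 < d" "d \<le> r" "d \<le> 1" using r e A by (auto simp: d_def)
  have "d * (2 * A) \<le> e" using A unfolding d_def by (subst pos_le_divide_eq[symmetric]) auto
  hence Ad: "2 * (A * d) \<le> e" by (simp add: algebra_simps)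
  show "\<exists>d>0. \<forall>s y. \<sigma> < s \<longrightarrow> s < \<sigma> + d \<longrightarrow> \<bar>y - x0\<bar> < d \<longrightarrow> f s y < f \<sigma> x0 + e"
  proof (intro exI[of _ d] conjI allI impI d(1))
    fix s x assume s: "\<sigma> < s" "s < \<sigma> + d" and x: "\<bar>x - x0\<bar> < d"
    \<comment> \<open>A point of \<open>F\<close> in this compact box with the largest time
      \<open>c\<close> is selected; later rows of the box are free of \<open>F\<close>.\<close>
    let ?D = "F \<inter> ({\<sigma>..s} \<times> {x0 - r..x0 + r})"
    have "compact ?D"
      by (intro closed_Int_compact F compact_Times compact_Icc)
    moreover have "(\<sigma>, x0) \<in> ?D" using F s r by auto
    ultimately have "\<exists>p\<in>?D. \<forall>q\<in>?D. fst q \<le> fst p"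
      by (intro continuous_attains_sup continuous_intros) auto
    then obtain p where p: "p \<in> ?D" "\<And>q. q \<in> ?D \<Longrightarrow> fst q \<le> fst p" by blast
    obtain c z where pcz: "p = (c, z)" by (cases p)
    have cz: "(c, z) \<in> F" "\<sigma> \<le> c" "c \<le> s" "\<bar>z - x0\<bar> \<le> r" using p(1) pcz by (auto simp: abs_le_iff)
    have cm: "\<tau> \<le> c" if "(\<tau>, y) \<in> F" "\<sigma> \<le> \<tau>" "\<tau> \<le> s" "\<bar>y - x0\<bar> \<le> r" for \<tau> y
      using p(2)[of "(\<tau>, y)"] that pcz by (auto simp: abs_le_iff)
    \<comment> \<open>The way from (\<sigma>, x0) to (c, y) leads through (\<sigma>, z) and (c, z).
      Each of the three moves has an end in \<open>F\<close>, so the Lipschitz bounds apply.\<close>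
    define m where "m = f \<sigma> x0 + L * r + L * (s - \<sigma>) + L * (2 * r)"
    have row: "f c y \<le> m" if "\<bar>y - x0\<bar> \<le> r" for y
    proof -
      have "\<bar>f c (z + (y - z)) - f c z\<bar> \<le> L * \<bar>y - z\<bar>"
        by (rule lipx) (use cz that s d r \<epsilon> in linarith)+
      moreover have "L * \<bar>y - z\<bar> \<le> L * (2 * r)" using cz that L by (intro mult_left_mono) linarith+
      moreover have "\<bar>f (c + (\<sigma> - c)) z - f c z\<bar> \<le> L * \<bar>\<sigma> - c\<bar>"
        by (rule lipt) (use cz that s d r \<epsilon> in linarith)+
      moreover have "L * \<bar>\<sigma> - c\<bar> \<le> L * (s - \<sigma>)" using cz L by (intro mult_left_mono) linarith+
      moreover have "\<bar>f \<sigma> (x0 + (z - x0)) - f \<sigma> x0\<bar> \<le> L * \<bar>z - x0\<bar>"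
        by (rule lipx) (use F cz that s d r \<epsilon> in \<open>simp | linarith\<close>)+
      moreover have "L * \<bar>z - x0\<bar> \<le> L * r" using cz L by (intro mult_left_mono) linarith+
      ultimately show ?thesis unfolding m_def by simp
    qed
    have Ls: "L * (s - \<sigma>) \<le> L * d" using s L by (intro mult_left_mono) linarith+
    have "f s x \<le> m + C * d + Q * (3 * d)"
    proof (cases "c = s")
      case True
      have "f s x \<le> m" using row[of x] x d True by auto
      thus ?thesis using C Q d(1) by (smt (verit) mult_nonneg_nonneg)
    next
      case False
      hence cs: "c < s" using cz by simp
      have inT: "T1 < c" "s < T2" using \<epsilon>(2)[of c x0] \<epsilon>(2)[of s x0] cz s d r \<epsilon> by auto
      have inX: "X1 < x0 - r" "x0 + r < X2" using \<epsilon>(2)[of \<sigma> "x0 - r"] \<epsilon>(2)[of \<sigma> "x0 + r"] r by auto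
      have fuc: "forward_usc f \<tau> y" if "c < \<tau>" "\<tau> < s" "\<bar>y - x0\<bar> \<le> r" for \<tau> y
      proof (rule good)
        show "\<bar>\<tau> - \<sigma>\<bar> < \<epsilon>" "\<bar>y - x0\<bar> < \<epsilon>" using that cz s d r by auto
        show "(\<tau>, y) \<notin> F" using cm[of \<tau> y] that cz by auto
      qed
      have "\<bar>f \<sigma> x0\<bar> \<le> K" using \<epsilon>(2)[of \<sigma> x0] \<epsilon>(1) by (intro bd) auto
      moreover have "0 \<le> L * r" "0 \<le> L * (s - \<sigma>)" using L r s by auto
      ultimately have mK: "- K \<le> m" unfolding m_def by linarith
      have "f s x \<le> m + C * (s - c) + Q * ((x - x0)\<^sup>2 + 2 * (s - c))"
        unfolding Q_def by (rule strip_estimate[OF inT(1) cs inT(2) r(1) inX fuc mK row]) (use x d in auto)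
      moreover have "C * (s - c) \<le> C * d" using cz s C by (intro mult_left_mono) linarith+
      moreover have "(x - x0)\<^sup>2 \<le> d"
      proof -
        have "(x - x0)\<^sup>2 \<le> d\<^sup>2" using x by (simp add: abs_le_square_iff[symmetric])
        also have "d\<^sup>2 \<le> d" using d by (simp add: power2_eq_square mult_left_le)
        finally show ?thesis .
      qed
      moreover have "s - c \<le> d" using cz s by linarith
      ultimately have "(x - x0)\<^sup>2 + 2 * (s - c) \<le> 3 * d" by simp
      hence "Q * ((x - x0)\<^sup>2 + 2 * (s - c)) \<le> Q * (3 * d)" using Q by (intro mult_left_mono) linarith+
      thus ?thesis using \<open>f s x \<le> m + C * (s - c) + Q * ((x - x0)\<^sup>2 + 2 * (s - c))\<close> \<open>C * (s - c) \<le> C * d\<close>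
        by linarith
    qed
    also have "\<dots> \<le> f \<sigma> x0 + 3 * (L * r) + (L * d + C * d + Q * (3 * d))" unfolding m_def using Ls by linarith
    also have "L * d + C * d + Q * (3 * d) \<le> A * d" unfolding A_def using d(1) by (simp add: algebra_simps)
    also have "f \<sigma> x0 + 3 * (L * r) + A * d < f \<sigma> x0 + e" using Lr Ad L r(1) e by linarith
    finally show "f s x < f \<sigma> x0 + e" by simp
  qed
qed

text \<open>The closed sets \<open>E n\<close> cover the closure \<open>F\<close> of the bad points
  near (t, x). Near some bad point \<open>F\<close> lies inside one \<open>E n\<close>, while all
  points off \<open>F\<close> are good; \<open>forward_usc_of_lipschitz\<close> then declares that
  bad point good.\<close>

theorem subsolution_forward_usc:
  assumes "T1 < t" "t < T2" "X1 < x" "x < X2"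
  shows "forward_usc f t x"
proof (rule ccontr)
  assume nfu: "\<not> forward_usc f t x"
  define dom where "dom = {T1<..<T2} \<times> {X1<..<X2}"
  define Bad where "Bad = {p \<in> dom. \<not> forward_usc f (fst p) (snd p)}"
  have p0: "(t, x) \<in> Bad" using assms nfu by (simp add: Bad_def dom_def)
  \<comment> \<open>A third of the margin: points of \<open>closure U\<close> are within
    \<open>r0\<close> of (t, x) and increments are below \<open>r0\<close>, so shifted points stay
    inside the rectangle.\<close>
  define r0 where "r0 = min (min (t - T1) (T2 - t)) (min (x - X1) (X2 - x)) / 3"
  have r0: "0 < r0" "3 * r0 \<le> t - T1" "3 * r0 \<le> T2 - t" "3 * r0 \<le> x - X1" "3 * r0 \<le> X2 - x"
    using assms by (auto simp: r0_def)
  define U where "U = ball (t, x) r0"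
  have Ubox: "\<bar>fst q - t\<bar> \<le> r0 \<and> \<bar>snd q - x\<bar> \<le> r0" if "q \<in> closure U" for q
  proof -
    have "dist (t, x) q \<le> r0" using that closure_minimal[OF ball_subset_cball closed_cball, of "(t, x)" r0] unfolding U_def by auto
    thus ?thesis using dist_fst_le[of q "(t, x)"] dist_snd_le[of q "(t, x)"]
      by (auto simp: dist_commute dist_real_def)
  qed
  define F where "F = closure (Bad \<inter> U)"
  have FU: "F \<subseteq> closure U" unfolding F_def by (intro closure_mono) auto
  define E where "E = (\<lambda>n::nat. {p \<in> F. \<forall>h. \<bar>h\<bar> < r0 \<longrightarrow>
    \<bar>f (fst p + h) (snd p) - f (fst p) (snd p)\<bar> \<le> real n * \<bar>h\<bar> \<and>
    \<bar>f (fst p) (snd p + h) - f (fst p) (snd p)\<bar> \<le> real n * \<bar>h\<bar>})"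
  have inT: "T1 < fst p + h" "fst p + h < T2" and inX: "X1 < snd p + h" "snd p + h < X2"
    if "p \<in> F" "\<bar>h\<bar> < r0" for p h
    using Ubox[OF subsetD[OF FU that(1)]] that(2) r0 by (auto simp: abs_le_iff)
  have clE: "closed (E n)" for n
    unfolding closed_sequential_limits
  proof (intro allI impI, elim conjE)
    fix ps p assume ps: "\<forall>j. ps j \<in> E n" and lim: "ps \<longlonglongrightarrow> p"
    have psF: "ps j \<in> F" for j using ps by (simp add: E_def)
    have pF: "p \<in> F" using closed_sequentially[OF _ _ lim, of F] psF by (simp add: F_def)
    have l1: "(\<lambda>j. fst (ps j)) \<longlonglongrightarrow> fst p" and l2: "(\<lambda>j. snd (ps j)) \<longlonglongrightarrow> snd p"
      using lim by (auto intro: tendsto_fst tendsto_snd)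
    have z: "\<bar>0::real\<bar> < r0" using r0 by simp
    have "\<bar>f (fst p + h) (snd p) - f (fst p) (snd p)\<bar> \<le> real n * \<bar>h\<bar>" if "\<bar>h\<bar> < r0" for h
    proof (rule locally_lipschitz_limit[OF l1 l2 _ _ that])
      show "\<bar>f (fst (ps j) + h) (snd (ps j)) - f (fst (ps j)) (snd (ps j))\<bar> \<le> real n * \<bar>h\<bar>" if "\<bar>h\<bar> < r0" for j h
        using ps that by (simp add: E_def)
      show "isCont (f (fst p + h)) (snd p)" if "\<bar>h\<bar> < r0" for h
        using inT[OF pF that] inX[OF pF z] by (intro DERIV_isCont[OF dx]) auto
    qed
    moreover have "\<bar>f (fst p) (snd p + h) - f (fst p) (snd p)\<bar> \<le> real n * \<bar>h\<bar>" if "\<bar>h\<bar> < r0" for h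
    proof (rule locally_lipschitz_limit[OF l2 l1 _ _ that, of "\<lambda>x t. f t x"])
      show "\<bar>f (fst (ps j)) (snd (ps j) + h) - f (fst (ps j)) (snd (ps j))\<bar> \<le> real n * \<bar>h\<bar>" if "\<bar>h\<bar> < r0" for j h
        using ps that by (simp add: E_def)
      show "isCont (\<lambda>t. f t (snd p + h)) (fst p)" if "\<bar>h\<bar> < r0" for h
        using inX[OF pF that] inT[OF pF z] by (intro DERIV_isCont[OF dt]) auto
    qed
    ultimately show "p \<in> E n" using pF by (simp add: E_def)
  qed
  have cover: "\<exists>n. p \<in> E n" if pF: "p \<in> F" for p
  proof -
    have z: "\<bar>0::real\<bar> < r0" using r0 by simp
    have "\<exists>L. \<forall>h. \<bar>h\<bar> < r0 \<longrightarrow> \<bar>f (fst p + h) (snd p) - f (fst p) (snd p)\<bar> \<le> L * \<bar>h\<bar>"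
      by (rule pointwise_lipschitz[OF dt _ r0(1)]) (use inT[OF pF z] inX[OF pF z] inT[OF pF] in \<open>auto intro!: bd\<close>)
    then obtain L1 where L1: "\<And>h. \<bar>h\<bar> < r0 \<Longrightarrow> \<bar>f (fst p + h) (snd p) - f (fst p) (snd p)\<bar> \<le> L1 * \<bar>h\<bar>" by blast
    have "\<exists>L. \<forall>h. \<bar>h\<bar> < r0 \<longrightarrow> \<bar>f (fst p) (snd p + h) - f (fst p) (snd p)\<bar> \<le> L * \<bar>h\<bar>"
      by (rule pointwise_lipschitz[OF dx _ r0(1)]) (use inT[OF pF z] inX[OF pF z] inX[OF pF] in \<open>auto intro!: bd\<close>)
    then obtain L2 where L2: "\<And>h. \<bar>h\<bar> < r0 \<Longrightarrow> \<bar>f (fst p) (snd p + h) - f (fst p) (snd p)\<bar> \<le> L2 * \<bar>h\<bar>" by blast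
    obtain n :: nat where n: "max L1 L2 \<le> real n" using real_arch_simple by blast
    have "L1 * \<bar>h\<bar> \<le> real n * \<bar>h\<bar>" "L2 * \<bar>h\<bar> \<le> real n * \<bar>h\<bar>" for h
      using n by (auto intro!: mult_right_mono)
    hence "p \<in> E n" unfolding E_def using pF L1 L2 by (fastforce intro: order_trans)
    thus ?thesis ..
  qed
  have pF: "(t, x) \<in> F" unfolding F_def U_def using p0 r0 by (intro subsetD[OF closure_subset]) auto
  have "\<exists>n. \<not> F \<subseteq> closure (F - E n)"
  proof (rule ccontr)
    assume "\<not> ?thesis"
    hence dense: "\<And>n. F \<subseteq> closure (F - E n)" by blast
    have "F \<subseteq> closure (\<Inter> (range (\<lambda>n. F - E n)))"
    proof (rule Baire)
      show "closed F" by (simp add: F_def)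
      fix T assume "T \<in> range (\<lambda>n. F - E n)"
      then obtain n where T: "T = F - E n" by blast
      have "openin (top_of_set F) (F - E n)"
        using openin_open_Int[of "- E n" F] clE[of n] by (simp add: Diff_eq open_Compl)
      thus "openin (top_of_set F) T \<and> F \<subseteq> closure T" using dense T by blast
    qed simp
    moreover have "\<Inter> (range (\<lambda>n. F - E n)) = {}" using cover by blast
    ultimately have "F \<subseteq> closure {}" by (simp only:)
    thus False using pF by auto
  qed
  then obtain n q where q: "q \<in> F" "q \<notin> closure (F - E n)" by blast
  define V where "V = - closure (F - E n)"
  have V: "open V" "q \<in> V" using q by (auto simp: V_def)
  \<comment> \<open>The open set \<open>V\<close> meets the closure \<open>F\<close>, hence the bad
    set itself; the contradiction needs a base point that is really bad.\<close>
  have "V \<inter> (Bad \<inter> U) \<noteq> {}"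
    using q(1) V open_Int_closure_eq_empty[of V "Bad \<inter> U"] unfolding F_def by blast
  then obtain p1 where p1: "p1 \<in> V" "p1 \<in> Bad" "p1 \<in> U" by blast
  obtain \<sigma> x0 where px: "p1 = (\<sigma>, x0)" by (cases p1)
  have "open (V \<inter> U)" unfolding U_def by (intro open_Int V open_ball)
  then obtain \<epsilon>0 where \<epsilon>0: "0 < \<epsilon>0" "ball p1 \<epsilon>0 \<subseteq> V \<inter> U" using p1 openE by blast
  define \<epsilon> where "\<epsilon> = \<epsilon>0 / 2"
  have \<epsilon>: "0 < \<epsilon>" using \<epsilon>0 by (simp add: \<epsilon>_def)
  have box: "(\<tau>, y) \<in> V \<inter> U" if "\<bar>\<tau> - \<sigma>\<bar> < \<epsilon>" "\<bar>y - x0\<bar> < \<epsilon>" for \<tau> y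
  proof -
    have "dist p1 (\<tau>, y) \<le> \<bar>\<sigma> - \<tau>\<bar> + \<bar>x0 - y\<bar>"
      unfolding px by (simp add: dist_Pair_Pair dist_real_def sqrt_sum_squares_le_sum_abs)
    also have "\<dots> < \<epsilon>0" using that unfolding \<epsilon>_def by linarith
    finally have "(\<tau>, y) \<in> ball p1 \<epsilon>0" unfolding mem_ball .
    thus ?thesis by (rule subsetD[OF \<epsilon>0(2)])
  qed
  have inE: "(\<tau>, y) \<in> E n" if "\<bar>\<tau> - \<sigma>\<bar> < \<epsilon>" "\<bar>y - x0\<bar> < \<epsilon>" "(\<tau>, y) \<in> F" for \<tau> y
  proof (rule ccontr)
    assume "(\<tau>, y) \<notin> E n"
    hence "(\<tau>, y) \<in> closure (F - E n)" using that(3) by (intro subsetD[OF closure_subset]) simp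
    thus False using box[OF that(1,2)] unfolding V_def by blast
  qed
  have inside: "T1 < \<tau> \<and> \<tau> < T2 \<and> X1 < y \<and> y < X2" if "\<bar>\<tau> - \<sigma>\<bar> < \<epsilon>" "\<bar>y - x0\<bar> < \<epsilon>" for \<tau> y
  proof -
    have "(\<tau>, y) \<in> closure U" by (rule subsetD[OF closure_subset IntD2[OF box[OF that]]])
    from Ubox[OF this] have "\<bar>\<tau> - t\<bar> \<le> r0" "\<bar>y - x\<bar> \<le> r0" by simp_all
    thus ?thesis using r0 unfolding abs_le_iff by linarith
  qed
  have "forward_usc f \<sigma> x0"
  proof (rule forward_usc_of_lipschitz[where F = F and L = "real n" and \<epsilon> = \<epsilon> and ?r0.0 = r0])
    show "T1 < \<tau> \<and> \<tau> < T2 \<and> X1 < y \<and> y < X2" if "\<bar>\<tau> - \<sigma>\<bar> < \<epsilon>" "\<bar>y - x0\<bar> < \<epsilon>" for \<tau> y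
      by (rule inside[OF that])
    show "(\<sigma>, x0) \<in> F" using p1 unfolding F_def px by (intro subsetD[OF closure_subset]) simp
    show "forward_usc f \<tau> y" if "\<bar>\<tau> - \<sigma>\<bar> < \<epsilon>" "\<bar>y - x0\<bar> < \<epsilon>" "(\<tau>, y) \<notin> F" for \<tau> y
    proof (rule ccontr)
      assume "\<not> forward_usc f \<tau> y"
      moreover have "(\<tau>, y) \<in> dom"
        using inside[OF that(1,2)] by (simp add: dom_def)
      ultimately have "(\<tau>, y) \<in> Bad \<inter> U" using box[OF that(1,2)] by (simp add: Bad_def)
      hence "(\<tau>, y) \<in> F" unfolding F_def by (rule subsetD[OF closure_subset])
      thus False using that(3) by contradiction
    qed
    show "\<bar>f (\<tau> + h) y - f \<tau> y\<bar> \<le> real n * \<bar>h\<bar>"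
      if "\<bar>\<tau> - \<sigma>\<bar> < \<epsilon>" "\<bar>y - x0\<bar> < \<epsilon>" "(\<tau>, y) \<in> F" "\<bar>h\<bar> < r0" for \<tau> y h
      using inE[OF that(1-3)] that(4) by (simp add: E_def)
    show "\<bar>f \<tau> (y + h) - f \<tau> y\<bar> \<le> real n * \<bar>h\<bar>"
      if "\<bar>\<tau> - \<sigma>\<bar> < \<epsilon>" "\<bar>y - x0\<bar> < \<epsilon>" "(\<tau>, y) \<in> F" "\<bar>h\<bar> < r0" for \<tau> y h
      using inE[OF that(1-3)] that(4) by (simp add: E_def)
    show "closed F" by (simp add: F_def)
  qed (use \<epsilon> r0 in auto)
  thus False using p1 px by (simp add: Bad_def)
qed

end

section \<open>The parametrix\<close>

text \<open>Differentiating a Leibniz sum of order \<open>j\<close> once more and regrouping by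
  Pascal's rule; \<open>d\<close> and \<open>a\<close> are the derivative sequences of the two
  factors.\<close>

lemma leibniz_pascal:
  fixes d a :: "nat \<Rightarrow> 'a::comm_ring_1"
  shows "(\<Sum>i\<le>j. of_nat (j choose i) * (d (Suc i) * a (j - i) + d i * a (Suc (j - i)))) =
    (\<Sum>i\<le>Suc j. of_nat (Suc j choose i) * (d i * a (Suc j - i)))"
proof -
  have "(\<Sum>i\<le>Suc j. of_nat (Suc j choose i) * (d i * a (Suc j - i))) =
      d 0 * a (Suc j) + (\<Sum>i\<le>j. of_nat ((j choose i) + (j choose Suc i)) * (d (Suc i) * a (j - i)))"
    by (simp only: sum.atMost_Suc_shift) simp
  also have "\<dots> = (\<Sum>i\<le>j. of_nat (j choose i) * (d (Suc i) * a (j - i))) +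
      (d 0 * a (Suc j) + (\<Sum>i\<le>j. of_nat (j choose Suc i) * (d (Suc i) * a (j - i))))"
    by (simp add: algebra_simps sum.distrib)
  also have "d 0 * a (Suc j) + (\<Sum>i\<le>j. of_nat (j choose Suc i) * (d (Suc i) * a (j - i))) =
      (\<Sum>i\<le>Suc j. of_nat (j choose i) * (d i * a (Suc j - i)))"
    by (simp only: sum.atMost_Suc_shift) simp
  also have "\<dots> = (\<Sum>i\<le>j. of_nat (j choose i) * (d i * a (Suc (j - i))))"
    by (simp add: Suc_diff_le binomial_eq_0)
  finally show ?thesis by (simp add: algebra_simps sum.distrib)
qed

text \<open>\<open>heat_poly n j\<close> evaluated at the jet of \<open>u\<close> at \<open>z\<close> is the \<open>j\<close>-th \<open>x\<close>-derivative of \<open>a\<^sub>n(x, z)\<close> at \<open>x = z\<close>.\<close>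
fun heat_poly :: "nat \<Rightarrow> nat \<Rightarrow> (nat \<Rightarrow> real) \<Rightarrow> real" where
  "heat_poly 0 j s = (if j = 0 then 1 else 0)"
| "heat_poly (Suc n) j s =
    (heat_poly n (j + 2) s + (\<Sum>i\<le>j. real (j choose i) * (s i * heat_poly n (j - i) s))) / real (n + j + 1)"

text \<open>\<open>pcoef u n j x z\<close> is the \<open>j\<close>-th \<open>x\<close>-derivative of \<open>a\<^sub>n(x, z)\<close>, obtained by integrating the transport equation
  \<open>n a\<^sub>n + (x - z) \<partial>\<^sub>x a\<^sub>n = L a\<^sub>n\<^sub>-\<^sub>1\<close> along the segment from \<open>z\<close> to \<open>x\<close>.\<close>
fun pcoef :: "(real \<Rightarrow> real) \<Rightarrow> nat \<Rightarrow> nat \<Rightarrow> real \<Rightarrow> real \<Rightarrow> real" where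
  "pcoef u 0 j x z = (if j = 0 then 1 else 0)"
| "pcoef u (Suc n) j x z = integral {0..1} (\<lambda>\<sigma>. \<sigma> ^ (n + j) *
    (pcoef u n (j + 2) (z + \<sigma> * (x - z)) z +
     (\<Sum>i\<le>j. real (j choose i) * (jet u (z + \<sigma> * (x - z)) i * pcoef u n (j - i) (z + \<sigma> * (x - z)) z))))"

text \<open>The \<open>j\<close>-th x-derivative of L a_n(x, z) by Leibniz' rule, that is, the
  source in the transport equation for the next coefficient.\<close>

definition psrc :: "(real \<Rightarrow> real) \<Rightarrow> nat \<Rightarrow> nat \<Rightarrow> real \<Rightarrow> real \<Rightarrow> real" where
  "psrc u n j x z = pcoef u n (j + 2) x z + (\<Sum>i\<le>j. real (j choose i) * (jet u x i * pcoef u n (j - i) x z))"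

lemma pcoef_Suc: "pcoef u (Suc n) j x z = integral {0..1} (\<lambda>\<sigma>. \<sigma> ^ (n + j) * psrc u n j (z + \<sigma> * (x - z)) z)"
  by (simp add: psrc_def)

declare pcoef.simps(2)[simp del]

text \<open>The \<open>j\<close>-th x-derivative of the amplitude that multiplies the Gaussian in
  the parametrix K_N.\<close>

definition pamp :: "(real \<Rightarrow> real) \<Rightarrow> nat \<Rightarrow> nat \<Rightarrow> real \<Rightarrow> real \<Rightarrow> real \<Rightarrow> real" where
  "pamp u j N t x z = (\<Sum>n\<le>N. t ^ n * pcoef u n j x z)"

definition pamp_t :: "(real \<Rightarrow> real) \<Rightarrow> nat \<Rightarrow> real \<Rightarrow> real \<Rightarrow> real \<Rightarrow> real" where
  "pamp_t u N t x z = (\<Sum>n\<le>N. real n * t ^ (n - 1) * pcoef u n 0 x z)"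

context
  fixes u :: "real \<Rightarrow> real"
  assumes u: "smooth_bdd u"
begin

lemma jet_DERIV: "((\<lambda>x. jet u x i) has_real_derivative jet u x (Suc i)) (at x)"
proof -
  have "((deriv ^^ i) u has_real_derivative deriv ((deriv ^^ i) u) x) (at x)"
    using u unfolding smooth_bdd_def by (simp add: DERIV_deriv_iff_real_differentiable)
  thus ?thesis by (simp add: jet_def)
qed

lemma jet_0: "jet u x 0 = u x" by (simp add: jet_def)

lemma jet_bounded: "\<exists>B. \<forall>x. \<bar>jet u x i\<bar> \<le> B"
  using u unfolding smooth_bdd_def bounded_iff jet_def by (auto simp: image_iff)

lemma continuous_on_jet: "continuous_on S (\<lambda>x. jet u x i)"
  by (intro continuous_at_imp_continuous_on ballI DERIV_isCont[OF jet_DERIV])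

lemma psrc_props:
  assumes c: "\<And>j. continuous_on UNIV (\<lambda>(x, z). pcoef u n j x z)"
    and b: "\<And>j. \<exists>B. \<forall>x z. \<bar>pcoef u n j x z\<bar> \<le> B"
    and d: "\<And>j x z. ((\<lambda>x. pcoef u n j x z) has_real_derivative pcoef u n (Suc j) x z) (at x)"
  shows "continuous_on UNIV (\<lambda>(x, z). psrc u n j x z)"
    and "\<exists>B. \<forall>x z. \<bar>psrc u n j x z\<bar> \<le> B"
    and "((\<lambda>x. psrc u n j x z) has_real_derivative psrc u n (Suc j) x z) (at x)"
proof -
  note c' = c[unfolded case_prod_beta]
  show "continuous_on UNIV (\<lambda>(x, z). psrc u n j x z)"
    unfolding psrc_def case_prod_beta
    by (intro continuous_intros c' continuous_on_compose2[OF continuous_on_jet[of UNIV]]) auto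
  from b obtain B where B: "\<And>j x z. \<bar>pcoef u n j x z\<bar> \<le> B j" by metis
  obtain M where M: "\<And>i x. \<bar>jet u x i\<bar> \<le> M i" using jet_bounded by metis
  have M0: "0 \<le> M i" for i using M[where x = 0 and i = i] by linarith
  show "\<exists>B. \<forall>x z. \<bar>psrc u n j x z\<bar> \<le> B"
  proof (intro exI allI)
    fix x z
    have "\<bar>psrc u n j x z\<bar> \<le> \<bar>pcoef u n (j + 2) x z\<bar> + \<bar>\<Sum>i\<le>j. real (j choose i) * (jet u x i * pcoef u n (j - i) x z)\<bar>"
      unfolding psrc_def by (rule abs_triangle_ineq)
    also have "\<dots> \<le> B (j + 2) + (\<Sum>i\<le>j. real (j choose i) * (M i * B (j - i)))"
    proof (rule add_mono[OF B order_trans[OF sum_abs sum_mono]])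
      fix i
      show "\<bar>real (j choose i) * (jet u x i * pcoef u n (j - i) x z)\<bar> \<le> real (j choose i) * (M i * B (j - i))"
        unfolding abs_mult by (intro mult_mono B M order_refl) (auto simp: M0)
    qed
    finally show "\<bar>psrc u n j x z\<bar> \<le> B (j + 2) + (\<Sum>i\<le>j. real (j choose i) * (M i * B (j - i)))" .
  qed
  have "((\<lambda>x. \<Sum>i\<le>j. real (j choose i) * (jet u x i * pcoef u n (j - i) x z)) has_real_derivative
      (\<Sum>i\<le>j. real (j choose i) * (jet u x (Suc i) * pcoef u n (j - i) x z + jet u x i * pcoef u n (Suc (j - i)) x z))) (at x)"
  proof (rule DERIV_sum)
    fix i
    have "((\<lambda>x. jet u x i * pcoef u n (j - i) x z) has_real_derivative
      (jet u x i * pcoef u n (Suc (j - i)) x z + jet u x (Suc i) * pcoef u n (j - i) x z)) (at x)"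
      by (rule DERIV_mult'[OF jet_DERIV d])
    from DERIV_cmult[OF this, of "real (j choose i)"]
    show "((\<lambda>x. real (j choose i) * (jet u x i * pcoef u n (j - i) x z)) has_real_derivative
       real (j choose i) * (jet u x (Suc i) * pcoef u n (j - i) x z + jet u x i * pcoef u n (Suc (j - i)) x z)) (at x)"
      by (simp only: add.commute)
  qed
  from DERIV_add[OF d[of "j + 2" z x] this]
  show "((\<lambda>x. psrc u n j x z) has_real_derivative psrc u n (Suc j) x z) (at x)"
    unfolding psrc_def leibniz_pascal[of j "jet u x" "\<lambda>i. pcoef u n i x z"] by simp
qed

text \<open>All orders \<open>j\<close> are treated together, because level n + 1 at order j uses
  level n up to order j + 2.\<close>

lemma pcoef_props:
  shows "continuous_on UNIV (\<lambda>(x, z). pcoef u n j x z)"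
    and "\<exists>B. \<forall>x z. \<bar>pcoef u n j x z\<bar> \<le> B"
    and "((\<lambda>x. pcoef u n j x z) has_real_derivative pcoef u n (Suc j) x z) (at x)"
proof (induction n arbitrary: j x z)
  case 0
  {
    case 1 show ?case by (simp add: case_prod_beta)
  next
    case 2 show ?case by (auto intro: exI[of _ 1])
  next
    case 3 show ?case by simp
  }
next
  case (Suc n)
  note sp = psrc_props[OF Suc.IH]
  have cs: "continuous_on S (\<lambda>q. psrc u n j (f q) (g q))" if "continuous_on S f" "continuous_on S g"
    for S :: "'a::topological_space set" and f g j
    using continuous_on_compose2[OF sp(1), of S "\<lambda>q. (f q, g q)" j] that by (simp add: continuous_on_Pair)
  {
    case 1
    have "continuous_on (UNIV \<times> cbox 0 1) (\<lambda>(p, \<sigma>). \<sigma> ^ (n + j) * psrc u n j (snd p + \<sigma> * (fst p - snd p)) (snd p))"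
      unfolding case_prod_beta by (intro continuous_intros cs)
    from integral_continuous_on_param[OF this]
    show ?case by (simp add: pcoef_Suc case_prod_beta)
  next
    case 2
    obtain B where B: "\<And>x z. \<bar>psrc u n j x z\<bar> \<le> B" using sp(2)[of j] by blast
    show ?case
    proof (intro exI allI)
      fix x z
      have "\<bar>pcoef u (Suc n) j x z\<bar> \<le> integral {0..1::real} (\<lambda>_. B)"
        unfolding pcoef_Suc real_norm_def[symmetric]
      proof (rule Henstock_Kurzweil_Integration.integral_norm_bound_integral)
        show "(\<lambda>\<sigma>. \<sigma> ^ (n + j) * psrc u n j (z + \<sigma> * (x - z)) z) integrable_on {0..1}"
          by (intro integrable_continuous_real continuous_intros cs)
        show "norm (\<sigma> ^ (n + j) * psrc u n j (z + \<sigma> * (x - z)) z) \<le> B" if "\<sigma> \<in> {0..1}" for \<sigma>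
        proof -
          have "\<bar>\<sigma> ^ (n + j)\<bar> * \<bar>psrc u n j (z + \<sigma> * (x - z)) z\<bar> \<le> 1 * B"
            using that by (intro mult_mono B) (auto simp: power_le_one)
          thus ?thesis by (simp add: abs_mult)
        qed
      qed (rule integrable_const_ivl)
      thus "\<bar>pcoef u (Suc n) j x z\<bar> \<le> B" by simp
    qed
  next
    case 3
    have "((\<lambda>x. integral {0..1} (\<lambda>\<sigma>. \<sigma> ^ (n + j) * psrc u n j (z + \<sigma> * (x - z)) z)) has_real_derivative
      integral {0..1} (\<lambda>\<sigma>. \<sigma> ^ (n + Suc j) * psrc u n (Suc j) (z + \<sigma> * (x - z)) z)) (at x)"
    proof (rule DERIV_integral_param[where U = UNIV])
      fix y \<sigma> :: real
      have "((\<lambda>y. psrc u n j (z + \<sigma> * (y - z)) z) has_real_derivative psrc u n (Suc j) (z + \<sigma> * (y - z)) z * \<sigma>) (at y)"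
        by (rule DERIV_chain2[OF sp(3)]) (auto intro!: derivative_eq_intros)
      from DERIV_cmult[OF this, of "\<sigma> ^ (n + j)"]
      show "((\<lambda>y. \<sigma> ^ (n + j) * psrc u n j (z + \<sigma> * (y - z)) z) has_real_derivative
          \<sigma> ^ (n + Suc j) * psrc u n (Suc j) (z + \<sigma> * (y - z)) z) (at y)"
        by (simp add: mult_ac)
      show "continuous_on {0..1} (\<lambda>\<sigma>. \<sigma> ^ (n + j) * psrc u n j (z + \<sigma> * (y - z)) z)"
        by (intro continuous_intros cs)
    next
      show "continuous_on (UNIV \<times> {0..1}) (\<lambda>(y, \<sigma>). \<sigma> ^ (n + Suc j) * psrc u n (Suc j) (z + \<sigma> * (y - z)) z)"
        unfolding case_prod_beta by (intro continuous_intros cs)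
    qed auto
    thus ?case by (simp only: pcoef_Suc)
  }
qed

lemmas psrc_continuous = psrc_props(1)[OF pcoef_props]
lemmas psrc_bounded = psrc_props(2)[OF pcoef_props]
lemmas psrc_DERIV = psrc_props(3)[OF pcoef_props]

lemma continuous_on_pcoef:
  assumes "continuous_on S f" "continuous_on S g"
  shows "continuous_on S (\<lambda>q. pcoef u n j (f q) (g q))"
  using continuous_on_compose2[OF pcoef_props(1)[of n j], of S "\<lambda>q. (f q, g q)"] assms
  by (simp add: continuous_on_Pair)

lemma continuous_on_psrc:
  assumes "continuous_on S f" "continuous_on S g"
  shows "continuous_on S (\<lambda>q. psrc u n j (f q) (g q))"
  using continuous_on_compose2[OF psrc_continuous[of n j], of S "\<lambda>q. (f q, g q)"] assms
  by (simp add: continuous_on_Pair)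

text \<open>On the diagonal the segment shrinks to a point, the source is constant along it, and the
  integral of \<sigma>^(n + j) produces the divisor n + j + 1 of \<open>heat_poly\<close>.\<close>

lemma pcoef_diagonal: "pcoef u n j z z = heat_poly n j (jet u z)"
proof (induction n arbitrary: j)
  case (Suc n)
  have I: "((\<lambda>\<sigma>::real. \<sigma> ^ (n + j)) has_integral (1 / real (n + j + 1))) {0..1}"
  proof -
    have "((\<lambda>\<sigma>::real. \<sigma> ^ (n + j)) has_integral (1 ^ Suc (n + j) / real (Suc (n + j)) - 0 ^ Suc (n + j) / real (Suc (n + j)))) {0..1}"
    proof (rule fundamental_theorem_of_calculus)
      show "((\<lambda>\<sigma>::real. \<sigma> ^ Suc (n + j) / real (Suc (n + j))) has_vector_derivative \<sigma> ^ (n + j)) (at \<sigma> within {0..1})" for \<sigma>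
        unfolding has_real_derivative_iff_has_vector_derivative[symmetric]
        by (rule DERIV_cong[OF DERIV_cdivide[OF DERIV_power[OF DERIV_ident]]]) (simp del: of_nat_Suc)
    qed simp
    thus ?thesis by simp
  qed
  have "pcoef u (Suc n) j z z = psrc u n j z z / real (n + j + 1)"
    unfolding pcoef_Suc using integral_unique[OF has_integral_mult_left[OF I, of "psrc u n j z z"]] by simp
  thus ?case by (simp add: psrc_def Suc.IH)
qed simp

text \<open>The left-hand side is the integral over [0, 1] of the derivative of \<sigma>^(n + 1)
  times the source at z + \<sigma> (x - z), so only the value at \<sigma> = 1 remains.\<close>

lemma pcoef_transport:
  "real (Suc n) * pcoef u (Suc n) 0 x z + (x - z) * pcoef u (Suc n) 1 x z = psrc u n 0 x z"
proof -
  have "((\<lambda>\<sigma>. real (Suc n) * (\<sigma> ^ n * psrc u n 0 (z + \<sigma> * (x - z)) z) + (x - z) * (\<sigma> ^ Suc n * psrc u n 1 (z + \<sigma> * (x - z)) z))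
     has_integral (1 ^ Suc n * psrc u n 0 (z + 1 * (x - z)) z - 0 ^ Suc n * psrc u n 0 (z + 0 * (x - z)) z)) {0..1}"
  proof (rule fundamental_theorem_of_calculus)
    fix \<sigma> :: real
    have d: "((\<lambda>\<sigma>. psrc u n 0 (z + \<sigma> * (x - z)) z) has_real_derivative psrc u n (Suc 0) (z + \<sigma> * (x - z)) z * (x - z)) (at \<sigma> within {0..1})"
      by (rule DERIV_chain2[OF psrc_DERIV]) (auto intro!: derivative_eq_intros)
    show "((\<lambda>\<sigma>. \<sigma> ^ Suc n * psrc u n 0 (z + \<sigma> * (x - z)) z) has_vector_derivative
       real (Suc n) * (\<sigma> ^ n * psrc u n 0 (z + \<sigma> * (x - z)) z) + (x - z) * (\<sigma> ^ Suc n * psrc u n 1 (z + \<sigma> * (x - z)) z)) (at \<sigma> within {0..1})"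
      unfolding has_real_derivative_iff_has_vector_derivative[symmetric]
      by (rule DERIV_cong[OF DERIV_mult'[OF DERIV_power[OF DERIV_ident] d]]) (simp add: algebra_simps)
  qed simp
  hence "integral {0..1} (\<lambda>\<sigma>. real (Suc n) * (\<sigma> ^ n * psrc u n 0 (z + \<sigma> * (x - z)) z) + (x - z) * (\<sigma> ^ Suc n * psrc u n 1 (z + \<sigma> * (x - z)) z))
     = psrc u n 0 x z" by (simp add: integral_unique)
  moreover have "integral {0..1} (\<lambda>\<sigma>. real (Suc n) * (\<sigma> ^ n * psrc u n 0 (z + \<sigma> * (x - z)) z) + (x - z) * (\<sigma> ^ Suc n * psrc u n 1 (z + \<sigma> * (x - z)) z))
    = real (Suc n) * integral {0..1} (\<lambda>\<sigma>. \<sigma> ^ n * psrc u n 0 (z + \<sigma> * (x - z)) z) + (x - z) * integral {0..1} (\<lambda>\<sigma>. \<sigma> ^ Suc n * psrc u n 1 (z + \<sigma> * (x - z)) z)"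
    by (subst Henstock_Kurzweil_Integration.integral_add)
      (intro integrable_continuous_real continuous_intros continuous_on_psrc,
       intro integrable_continuous_real continuous_intros continuous_on_psrc,
       simp only: Henstock_Kurzweil_Integration.integral_mult_right)
  ultimately show ?thesis unfolding pcoef_Suc by (simp only: add_0_right One_nat_def add_Suc_right)
qed

lemma pamp_DERIV_x: "((\<lambda>x. pamp u j N t x z) has_real_derivative pamp u (Suc j) N t x z) (at x)"
  unfolding pamp_def by (intro DERIV_sum DERIV_cmult pcoef_props(3))

lemma pamp_DERIV_t: "((\<lambda>t. pamp u 0 N t x z) has_real_derivative pamp_t u N t x z) (at t)"
  unfolding pamp_def pamp_t_def by (auto intro!: derivative_eq_intros sum.cong)

lemma continuous_on_pamp:
  assumes "continuous_on S f" "continuous_on S g" "continuous_on S h"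
  shows "continuous_on S (\<lambda>q. pamp u j N (f q) (g q) (h q))"
  unfolding pamp_def by (intro continuous_intros continuous_on_pcoef assms)

lemma continuous_on_pamp_t:
  assumes "continuous_on S f" "continuous_on S g" "continuous_on S h"
  shows "continuous_on S (\<lambda>q. pamp_t u N (f q) (g q) (h q))"
  unfolding pamp_t_def by (intro continuous_intros continuous_on_pcoef assms)

text \<open>Telescoping: the transport equation for a_(N+1) cancels the remainder t^N L a_N and
  leaves t^(N+1) L a_(N+1) in its place.\<close>

lemma pamp_pde:
  assumes t: "0 < t"
  shows "pamp_t u N t x z - pamp u 2 N t x z + (x - z) / t * pamp u 1 N t x z = u x * pamp u 0 N t x z - t ^ N * psrc u N 0 x z"
proof (induction N)
  case 0
  show ?case by (simp add: pamp_def pamp_t_def psrc_def jet_0)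
next
  case (Suc N)
  have s: "pamp u j (Suc N) t x z = pamp u j N t x z + t ^ Suc N * pcoef u (Suc N) j x z" for j
    by (simp add: pamp_def)
  have st: "pamp_t u (Suc N) t x z = pamp_t u N t x z + real (Suc N) * t ^ N * pcoef u (Suc N) 0 x z"
    by (simp add: pamp_t_def)
  have "real (Suc N) * t ^ N * pcoef u (Suc N) 0 x z + (x - z) / t * (t ^ Suc N * pcoef u (Suc N) 1 x z)
      = t ^ N * psrc u N 0 x z"
  proof -
    have 1: "(x - z) / t * (t ^ Suc N * p) = t ^ N * ((x - z) * p)" for p using t by simp
    show ?thesis unfolding pcoef_transport[symmetric] 1 by (simp only: distrib_left mult_ac)
  qed
  moreover have "psrc u (Suc N) 0 x z = pcoef u (Suc N) 2 x z + u x * pcoef u (Suc N) 0 x z"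
    by (simp add: psrc_def jet_0 numeral_2_eq_2)
  ultimately show ?case unfolding s st using Suc.IH by (simp only: distrib_left) (simp add: algebra_simps)
qed

lemma pamp_bounded: "\<exists>B\<ge>0. \<forall>t x z. 0 \<le> t \<longrightarrow> t \<le> 1 \<longrightarrow> \<bar>pamp u 0 N t x z\<bar> \<le> B \<and> \<bar>pamp u 0 N t x z - 1\<bar> \<le> t * B"
proof -
  obtain B where B: "\<And>n x z. \<bar>pcoef u n 0 x z\<bar> \<le> B n" using pcoef_props(2)[where j = 0] by metis
  have B0: "0 \<le> B n" for n using B[of n 0 0] by linarith
  define S where "S = (\<Sum>n\<le>N. B n)"
  show ?thesis
  proof (intro exI[of _ "1 + S"] conjI allI impI)
    show "0 \<le> 1 + S" using B0 by (simp add: S_def sum_nonneg add_nonneg_nonneg)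
    fix t x z :: real assume t: "0 \<le> t" "t \<le> 1"
    have eq: "pamp u 0 N t x z - 1 = (\<Sum>n\<in>{..N} - {0}. t ^ n * pcoef u n 0 x z)"
      unfolding pamp_def by (subst sum.remove[of _ 0]) auto
    have "\<bar>\<Sum>n\<in>{..N} - {0}. t ^ n * pcoef u n 0 x z\<bar> \<le> (\<Sum>n\<in>{..N} - {0}. t * B n)"
    proof (rule order_trans[OF sum_abs sum_mono])
      fix n assume n: "n \<in> {..N} - {0}"
      have "t ^ n \<le> t ^ 1" using n t by (intro power_decreasing) auto
      hence "\<bar>t ^ n\<bar> * \<bar>pcoef u n 0 x z\<bar> \<le> t * B n" using t B by (intro mult_mono) auto
      thus "\<bar>t ^ n * pcoef u n 0 x z\<bar> \<le> t * B n" by (simp add: abs_mult)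
    qed
    also have "\<dots> = t * (\<Sum>n\<in>{..N} - {0}. B n)" by (simp add: sum_distrib_left)
    also have "\<dots> \<le> t * S" unfolding S_def using t B0 by (intro mult_left_mono sum_mono2) auto
    finally have 1: "\<bar>pamp u 0 N t x z - 1\<bar> \<le> t * S" unfolding eq .
    show "\<bar>pamp u 0 N t x z - 1\<bar> \<le> t * (1 + S)" using 1 t by (simp add: algebra_simps)
    have "t * S \<le> 1 * S" using t B0 by (intro mult_right_mono) (auto simp: S_def sum_nonneg)
    thus "\<bar>pamp u 0 N t x z\<bar> \<le> 1 + S" using 1 by linarith
  qed
qed

end

section \<open>Comparison of a heat kernel with the parametrix\<close>

text \<open>Both Gaussians have mass one. The two-term majorant allows one to choose at each point
  \<open>z\<close> which factor is estimated by its supremum and which by its mass.\<close>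

lemma heat_integral_bound:
  fixes P Q :: real and g :: "real \<Rightarrow> real"
  assumes \<tau>: "0 < \<tau>" and s: "0 < s" and g: "continuous_on {a..b} g" and PQ: "0 \<le> P" "0 \<le> Q"
    and b: "\<And>z. z \<in> {a..b} \<Longrightarrow> heatG \<tau> (x - z) * \<bar>g z\<bar> \<le> P * heatG \<tau> (x - z) + Q * heatG s (z - y)"
  shows "\<bar>integral {a..b} (\<lambda>z. heatG \<tau> (x - z) * g z)\<bar> \<le> P + Q"
proof -
  let ?g = "\<lambda>z. indicator {a..b} z * g z"
  let ?M = "\<lambda>z. P * heatG \<tau> (x - z) + Q * heatG s (y - z)"
  have iM: "integrable lborel ?M" using integrable_heatG[OF \<tau>] integrable_heatG[OF s] by simp
  have M: "(LINT z|lborel. ?M z) = P + Q"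
    using integrable_heatG[OF \<tau>] integrable_heatG[OF s] by (simp add: integral_heatG \<tau> s)
  have le: "norm (heatG \<tau> (x - z) * ?g z) \<le> ?M z" for z
  proof (cases "z \<in> {a..b}")
    case True
    thus ?thesis using b[OF True] heatG_nonneg[OF \<tau>, of "x - z"] by (simp add: abs_mult heatG_minus[of s z y])
  next
    case False
    have "0 \<le> ?M z" using PQ \<tau> s by (intro add_nonneg_nonneg mult_nonneg_nonneg heatG_nonneg)
    thus ?thesis using False by simp
  qed
  have m: "(\<lambda>z. heatG \<tau> (x - z)) \<in> borel_measurable borel" using \<tau> by (simp add: heatG_normal_density)
  have le': "norm (heatG \<tau> (x - z) * ?g z) \<le> norm (?M z)" for z
    using le[of z] unfolding real_norm_def by linarith
  have i: "integrable lborel (\<lambda>z. heatG \<tau> (x - z) * ?g z)"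
    by (rule Bochner_Integration.integrable_bound[OF iM])
      (use m borel_measurable_indicator_Icc[OF g] le' in auto)
  show ?thesis
    unfolding integral_heatG_eq_LINT[OF \<tau> g]
    using Bochner_Integration.integral_norm_bound_integral[OF i iM le] unfolding M real_norm_def .
qed

text \<open>\<open>f t x\<close> stands for \<open>H(t, x, y)\<close> with \<open>y\<close> fixed.\<close>
locale heat_column =
  fixes u :: "real \<Rightarrow> real" and f ft fx fxx :: "real \<Rightarrow> real \<Rightarrow> real" and Cg c y :: real
  assumes u: "smooth_bdd u"
    and dt: "\<And>t x. 0 < t \<Longrightarrow> ((\<lambda>s. f s x) has_real_derivative ft t x) (at t)"
    and dx: "\<And>t x. 0 < t \<Longrightarrow> (f t has_real_derivative fx t x) (at x)"
    and dxx: "\<And>t x. 0 < t \<Longrightarrow> (fx t has_real_derivative fxx t x) (at x)"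
    and pde: "\<And>t x. 0 < t \<Longrightarrow> ft t x = fxx t x + u x * f t x"
    and bound: "\<And>t x. 0 < t \<Longrightarrow> t \<le> 1 \<Longrightarrow> \<bar>f t x\<bar> \<le> Cg * heatG (c * t / 4) (x - y)"
    and c: "0 < c" and Cg: "0 \<le> Cg"
begin

lemma bound_t: "\<bar>f t x\<bar> \<le> Cg / sqrt (pi * c * t)" if "0 < t" "t \<le> 1"
proof -
  have "\<bar>f t x\<bar> \<le> Cg * heatG (c * t / 4) (x - y)" using bound that .
  also have "\<dots> \<le> Cg * (1 / sqrt (4 * pi * (c * t / 4)))"
    using that c Cg by (intro mult_left_mono heatG_le) auto
  finally show ?thesis by (simp add: mult.assoc)
qed

lemma bound_x: "\<bar>f t x\<bar> \<le> Cg / \<bar>x - y\<bar>" if "0 < t" "t \<le> 1" "x \<noteq> y"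
proof -
  have "\<bar>f t x\<bar> \<le> Cg * heatG (c * t / 4) (x - y)" using bound that by blast
  also have "\<dots> \<le> Cg * (1 / \<bar>x - y\<bar>)"
    using that c Cg by (intro mult_left_mono heatG_le_inverse) auto
  finally show ?thesis by simp
qed

lemma continuous_f: "0 < t \<Longrightarrow> continuous_on S (f t)"
  by (intro continuous_at_imp_continuous_on ballI DERIV_isCont[OF dx])

lemma u_bounded: "\<exists>U\<ge>0. \<forall>x. \<bar>u x\<bar> \<le> U"
proof -
  obtain B where B: "\<And>x. \<bar>jet u x 0\<bar> \<le> B" using jet_bounded[OF u] by blast
  have "\<bar>jet u 0 0\<bar> \<le> B" by (rule B)
  hence "0 \<le> B" by linarith
  thus ?thesis using B by (auto simp: jet_def)
qed

lemma forward_usc_f: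
  assumes t: "0 < t" "t < 1" and sg: "\<bar>sg\<bar> = 1"
  shows "forward_usc (\<lambda>t x. sg * f t x) t x"
proof -
  obtain U where U: "0 \<le> U" "\<And>x. \<bar>u x\<bar> \<le> U" using u_bounded by blast
  define K where "K = Cg / sqrt (pi * c * (t / 2))"
  have bK: "\<bar>f s z\<bar> \<le> K" if "t / 2 < s" "s < 1" for s z
  proof -
    have "\<bar>f s z\<bar> \<le> Cg / sqrt (pi * c * s)" using that t by (intro bound_t) auto
    also have "\<dots> \<le> K" unfolding K_def
    proof (rule divide_left_mono[OF _ Cg])
      show "sqrt (pi * c * (t / 2)) \<le> sqrt (pi * c * s)"
        using that c t by (intro real_sqrt_le_mono mult_left_mono) auto
      show "0 < sqrt (pi * c * s) * sqrt (pi * c * (t / 2))" using that c t by simp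
    qed
    finally show ?thesis .
  qed
  have K0: "0 \<le> K" using Cg c t by (simp add: K_def)
  \<comment> \<open>The window starts at t/2 because the bound on \<open>f\<close> blows up at time
    0. On it |u f| <= U K, which becomes the constant of the subsolution.\<close>
  interpret subsolution "\<lambda>t x. sg * f t x" "\<lambda>t x. sg * ft t x" "\<lambda>t x. sg * fx t x" "\<lambda>t x. sg * fxx t x"
    "t / 2" 1 "x - 1" "x + 1" K "U * K"
  proof
    fix s z assume s: "t / 2 < s" "s < 1"
    hence s0: "0 < s" using t by simp
    show "\<bar>sg * f s z\<bar> \<le> K" using bK[OF s] sg by (simp add: abs_mult)
    show "((\<lambda>s. sg * f s z) has_real_derivative sg * ft s z) (at s)" by (rule DERIV_cmult[OF dt[OF s0]])
    show "((\<lambda>z. sg * f s z) has_real_derivative sg * fx s z) (at z)" by (rule DERIV_cmult[OF dx[OF s0]])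
    show "((\<lambda>z. sg * fx s z) has_real_derivative sg * fxx s z) (at z)" by (rule DERIV_cmult[OF dxx[OF s0]])
    have "\<bar>sg * (u z * f s z)\<bar> \<le> U * K" using sg by (simp add: abs_mult mult_mono U bK[OF s])
    thus "sg * ft s z \<le> sg * fxx s z + U * K" using pde[OF s0] by (simp add: distrib_left)
  qed (use U K0 in auto)
  show ?thesis by (rule subsolution_forward_usc) (use t in auto)
qed

text \<open>The integral of K_N(\<tau>, x, z) against the datum \<open>f \<epsilon>\<close>, cut to
  a compact interval so that differentiation under the integral raises no question of decay.\<close>

definition V :: "nat \<Rightarrow> real \<Rightarrow> real \<Rightarrow> real \<Rightarrow> real \<Rightarrow> real" where
  "V N \<epsilon> R = heat_conv (\<lambda>t x z. pamp u 0 N t x z * f \<epsilon> z) (y - R) (y + R)"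

lemma V_eq: "V N \<epsilon> R \<tau> x = integral {y - R..y + R} (\<lambda>z. heatG \<tau> (x - z) * (pamp u 0 N \<tau> x z * f \<epsilon> z))"
  by (simp add: V_def heat_conv_def)

lemma V_props:
  assumes \<epsilon>: "0 < \<epsilon>"
  shows "continuous_on ({0<..} \<times> UNIV) (\<lambda>(\<tau>, x). V N \<epsilon> R \<tau> x)"
    and "0 < \<tau> \<Longrightarrow> \<exists>p q Vx. ((\<lambda>s. V N \<epsilon> R s x) has_real_derivative p) (at \<tau>) \<and>
      (\<forall>z. (V N \<epsilon> R \<tau> has_real_derivative Vx z) (at z)) \<and> (Vx has_real_derivative q) (at x) \<and>
      p = q + u x * V N \<epsilon> R \<tau> x - \<tau> ^ N * integral {y - R..y + R} (\<lambda>z. heatG \<tau> (x - z) * (psrc u N 0 x z * f \<epsilon> z))"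
proof -
  let ?B = "\<lambda>j t x z. pamp u j N t x z * f \<epsilon> z" and ?Bt = "\<lambda>t x z. pamp_t u N t x z * f \<epsilon> z"
  let ?S = "{0<..} \<times> UNIV \<times> {y - R..y + R} :: (real \<times> real \<times> real) set"
  have cf: "continuous_on ?S (\<lambda>p. f \<epsilon> (snd (snd p)))"
    by (intro continuous_on_compose2[OF continuous_f[OF \<epsilon>, of UNIV]] continuous_intros) auto
  have cB: "continuous_on ?S (\<lambda>(t, x, z). ?B j t x z)" for j
    unfolding case_prod_beta by (intro continuous_intros cf continuous_on_pamp[OF u])
  have cBt: "continuous_on ?S (\<lambda>(t, x, z). ?Bt t x z)"
    unfolding case_prod_beta by (intro continuous_intros cf continuous_on_pamp_t[OF u])
  have dBt: "((\<lambda>t. ?B 0 t x z) has_real_derivative ?Bt t x z) (at t)" for t x z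
    by (rule DERIV_cmult_right[OF pamp_DERIV_t[OF u]])
  have dBx: "((\<lambda>x. ?B j t x z) has_real_derivative ?B (Suc j) t x z) (at x)" for j t x z
    by (rule DERIV_cmult_right[OF pamp_DERIV_x[OF u]])
  show "continuous_on ({0<..} \<times> UNIV) (\<lambda>(\<tau>, x). V N \<epsilon> R \<tau> x)"
    unfolding V_def by (rule continuous_on_heat_conv[OF cB cBt cB cB dBt dBx dBx])
  assume \<tau>: "0 < \<tau>"
  let ?I = "{y - R..y + R}"
  have i1: "(\<lambda>z. u x * (heatG \<tau> (x - z) * (pamp u 0 N \<tau> x z * f \<epsilon> z))) integrable_on ?I"
    using \<tau> by (intro integrable_continuous_real continuous_intros continuous_on_heatG continuous_on_pamp[OF u] continuous_f[OF \<epsilon>]) auto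
  have i2: "(\<lambda>z. \<tau> ^ N * (heatG \<tau> (x - z) * (psrc u N 0 x z * f \<epsilon> z))) integrable_on ?I"
    using \<tau> by (intro integrable_continuous_real continuous_intros continuous_on_heatG continuous_on_psrc[OF u] continuous_f[OF \<epsilon>]) auto
  have "integral ?I (\<lambda>z. heatG \<tau> (x - z) * (?Bt \<tau> x z - ?B (Suc (Suc 0)) \<tau> x z + (x - z) / \<tau> * ?B (Suc 0) \<tau> x z)) =
    integral ?I (\<lambda>z. u x * (heatG \<tau> (x - z) * (pamp u 0 N \<tau> x z * f \<epsilon> z)) - \<tau> ^ N * (heatG \<tau> (x - z) * (psrc u N 0 x z * f \<epsilon> z)))"
  proof (rule arg_cong[where f = "integral ?I"], rule ext)
    fix z
    have "?Bt \<tau> x z - ?B (Suc (Suc 0)) \<tau> x z + (x - z) / \<tau> * ?B (Suc 0) \<tau> x z =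
      (pamp_t u N \<tau> x z - pamp u 2 N \<tau> x z + (x - z) / \<tau> * pamp u 1 N \<tau> x z) * f \<epsilon> z"
      by (simp add: algebra_simps numeral_2_eq_2)
    also have "\<dots> = (u x * pamp u 0 N \<tau> x z - \<tau> ^ N * psrc u N 0 x z) * f \<epsilon> z"
      unfolding pamp_pde[OF u \<tau>] ..
    finally show "heatG \<tau> (x - z) * (?Bt \<tau> x z - ?B (Suc (Suc 0)) \<tau> x z + (x - z) / \<tau> * ?B (Suc 0) \<tau> x z) =
      u x * (heatG \<tau> (x - z) * (pamp u 0 N \<tau> x z * f \<epsilon> z)) - \<tau> ^ N * (heatG \<tau> (x - z) * (psrc u N 0 x z * f \<epsilon> z))"
      by (simp only: left_diff_distrib right_diff_distrib mult_ac)
  qed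
  also have "\<dots> = u x * V N \<epsilon> R \<tau> x - \<tau> ^ N * integral ?I (\<lambda>z. heatG \<tau> (x - z) * (psrc u N 0 x z * f \<epsilon> z))"
    unfolding V_eq Henstock_Kurzweil_Integration.integral_diff[OF i1 i2]
    by (simp only: Henstock_Kurzweil_Integration.integral_mult_right)
  finally have eq: "integral ?I (\<lambda>z. heatG \<tau> (x - z) * (?Bt \<tau> x z - ?B (Suc (Suc 0)) \<tau> x z + (x - z) / \<tau> * ?B (Suc 0) \<tau> x z))
    = u x * V N \<epsilon> R \<tau> x - \<tau> ^ N * integral ?I (\<lambda>z. heatG \<tau> (x - z) * (psrc u N 0 x z * f \<epsilon> z))" .
  show "\<exists>p q Vx. ((\<lambda>s. V N \<epsilon> R s x) has_real_derivative p) (at \<tau>) \<and>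
      (\<forall>z. (V N \<epsilon> R \<tau> has_real_derivative Vx z) (at z)) \<and> (Vx has_real_derivative q) (at x) \<and>
      p = q + u x * V N \<epsilon> R \<tau> x - \<tau> ^ N * integral ?I (\<lambda>z. heatG \<tau> (x - z) * (psrc u N 0 x z * f \<epsilon> z))"
    using heat_conv_pde[OF cB cBt cB cB dBt dBx dBx \<tau>, of x] unfolding eq V_def[symmetric] add_diff_eq .
qed

text \<open>The bound depends on \<epsilon> and \<tau> only through their sum t. If \<epsilon> >=
  t/2, the supremum of \<open>f \<epsilon>\<close> is of order 1/sqrt t and the Gaussian has mass
  one; otherwise \<tau> >= t/2 and the two factors exchange roles.\<close>

lemma V_source_bound:
  assumes \<epsilon>: "0 < \<epsilon>" and \<tau>: "0 < \<tau>" and t: "\<epsilon> + \<tau> \<le> 1" and S: "\<And>x z. \<bar>psrc u N 0 x z\<bar> \<le> S"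
  shows "\<bar>integral {y - R..y + R} (\<lambda>z. heatG \<tau> (x - z) * (psrc u N 0 x z * f \<epsilon> z))\<bar>
    \<le> S * (Cg / sqrt (pi * c / 2) + Cg / sqrt (2 * pi)) / sqrt (\<epsilon> + \<tau>)"
proof -
  define t where "t = \<epsilon> + \<tau>"
  have t0: "0 < t" "\<epsilon> < t" "\<tau> < t" using \<epsilon> \<tau> by (auto simp: t_def)
  have \<epsilon>1: "\<epsilon> \<le> 1" using t \<tau> by simp
  define k1 k2 where "k1 = Cg / sqrt (pi * c / 2) / sqrt t" and "k2 = Cg / sqrt (2 * pi) / sqrt t"
  have k: "0 \<le> k1" "0 \<le> k2" using Cg c t0 by (auto simp: k1_def k2_def)
  have S0: "0 \<le> S" using S[of 0 0] by linarith
  have G0: "0 \<le> heatG \<tau> w" for w by (rule heatG_nonneg[OF \<tau>])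
  have Gs0: "0 \<le> heatG (c * \<epsilon> / 4) w" for w using c \<epsilon> by (intro heatG_nonneg) simp
  have pt: "heatG \<tau> (x - z) * \<bar>f \<epsilon> z\<bar> \<le> k1 * heatG \<tau> (x - z) + k2 * heatG (c * \<epsilon> / 4) (z - y)" for z
  proof (cases "t / 2 \<le> \<epsilon>")
    case True
    have "\<bar>f \<epsilon> z\<bar> \<le> Cg / sqrt (pi * c * \<epsilon>)" by (rule bound_t[OF \<epsilon> \<epsilon>1])
    also have "\<dots> \<le> Cg / sqrt (pi * c / 2 * t)"
    proof (rule divide_left_mono[OF _ Cg])
      show "sqrt (pi * c / 2 * t) \<le> sqrt (pi * c * \<epsilon>)"
        using True c mult_left_mono[OF True, of "pi * c"] by (intro real_sqrt_le_mono) simp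
      show "0 < sqrt (pi * c * \<epsilon>) * sqrt (pi * c / 2 * t)" using c \<epsilon> t0 by simp
    qed
    also have "\<dots> = k1" unfolding k1_def real_sqrt_mult[of _ t] by (simp only: divide_divide_eq_left)
    finally have "heatG \<tau> (x - z) * \<bar>f \<epsilon> z\<bar> \<le> heatG \<tau> (x - z) * k1" using G0 by (intro mult_left_mono)
    moreover have "0 \<le> k2 * heatG (c * \<epsilon> / 4) (z - y)" using k Gs0 by simp
    ultimately show ?thesis by (simp add: mult.commute)
  next
    case False
    hence \<tau>2: "t / 2 \<le> \<tau>" by (simp add: t_def field_simps)
    have "heatG \<tau> (x - z) \<le> 1 / sqrt (4 * pi * \<tau>)" by (rule heatG_le[OF \<tau>])
    also have "\<dots> \<le> 1 / sqrt (2 * pi * t)"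
    proof (rule divide_left_mono)
      show "sqrt (2 * pi * t) \<le> sqrt (4 * pi * \<tau>)"
        using mult_left_mono[OF \<tau>2, of "4 * pi"] by (intro real_sqrt_le_mono) simp
      show "0 < sqrt (4 * pi * \<tau>) * sqrt (2 * pi * t)" using \<tau> t0 by simp
    qed simp
    finally have "heatG \<tau> (x - z) * \<bar>f \<epsilon> z\<bar> \<le> 1 / sqrt (2 * pi * t) * (Cg * heatG (c * \<epsilon> / 4) (z - y))"
      using bound[OF \<epsilon> \<epsilon>1, of z] G0 t0 by (intro mult_mono) auto
    also have "\<dots> = k2 * heatG (c * \<epsilon> / 4) (z - y)"
      unfolding k2_def real_sqrt_mult[of _ t] by simp
    finally show ?thesis using k G0[of "x - z"] by (smt (verit) mult_nonneg_nonneg)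
  qed
  have "\<bar>integral {y - R..y + R} (\<lambda>z. heatG \<tau> (x - z) * (psrc u N 0 x z * f \<epsilon> z))\<bar> \<le> S * k1 + S * k2"
  proof (rule heat_integral_bound[OF \<tau>, where s = "c * \<epsilon> / 4" and y = y])
    show "continuous_on {y - R..y + R} (\<lambda>z. psrc u N 0 x z * f \<epsilon> z)"
      by (intro continuous_intros continuous_on_psrc[OF u] continuous_f[OF \<epsilon>])
    fix z
    have "heatG \<tau> (x - z) * \<bar>psrc u N 0 x z * f \<epsilon> z\<bar> = \<bar>psrc u N 0 x z\<bar> * (heatG \<tau> (x - z) * \<bar>f \<epsilon> z\<bar>)"
      by (simp add: abs_mult)
    also have "\<dots> \<le> S * (k1 * heatG \<tau> (x - z) + k2 * heatG (c * \<epsilon> / 4) (z - y))"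
      using S0 G0 by (intro mult_mono S pt) auto
    finally show "heatG \<tau> (x - z) * \<bar>psrc u N 0 x z * f \<epsilon> z\<bar> \<le> S * k1 * heatG \<tau> (x - z) + S * k2 * heatG (c * \<epsilon> / 4) (z - y)"
      by (simp only: distrib_left mult.assoc)
  qed (use S0 k c \<epsilon> in auto)
  thus ?thesis unfolding k1_def k2_def t_def[symmetric] by (simp add: distrib_left add_divide_distrib)
qed

text \<open>If |x - y| >= 3R/4, then either |z - y| >= R/2 and the datum is small, or |x - z| >= R/4
  and the Gaussian is small. The two cases contribute the constants 2 and 4.\<close>

lemma V_far_bound:
  assumes \<epsilon>: "0 < \<epsilon>" "\<epsilon> \<le> 1" and \<tau>: "0 < \<tau>" "\<tau> \<le> 1" and R: "0 < R" and x: "3 * R / 4 \<le> \<bar>x - y\<bar>"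
    and A: "0 \<le> A" "\<And>t x z. 0 \<le> t \<Longrightarrow> t \<le> 1 \<Longrightarrow> \<bar>pamp u 0 N t x z\<bar> \<le> A"
  shows "\<bar>V N \<epsilon> R \<tau> x\<bar> \<le> 6 * A * Cg / R"
proof -
  have G0: "0 \<le> heatG \<tau> w" for w by (rule heatG_nonneg[OF \<tau>(1)])
  have Gs0: "0 \<le> heatG (c * \<epsilon> / 4) w" for w using c \<epsilon> by (intro heatG_nonneg) simp
  have pt: "heatG \<tau> (x - z) * \<bar>f \<epsilon> z\<bar> \<le> 2 * Cg / R * heatG \<tau> (x - z) + 4 * Cg / R * heatG (c * \<epsilon> / 4) (z - y)" for z
  proof (cases "R / 2 \<le> \<bar>z - y\<bar>")
    case True
    hence zy: "z \<noteq> y" using R by auto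
    have "\<bar>f \<epsilon> z\<bar> \<le> Cg / \<bar>z - y\<bar>" by (rule bound_x[OF \<epsilon> zy])
    also have "\<dots> \<le> Cg / (R / 2)" using True R Cg zy by (intro divide_left_mono) auto
    finally have "heatG \<tau> (x - z) * \<bar>f \<epsilon> z\<bar> \<le> heatG \<tau> (x - z) * (2 * Cg / R)" using G0 by (intro mult_left_mono) (auto simp: mult.commute)
    moreover have "0 \<le> 4 * Cg / R * heatG (c * \<epsilon> / 4) (z - y)" using Cg R Gs0 by simp
    ultimately show ?thesis by (simp add: mult.commute)
  next
    case False
    hence d: "R / 4 \<le> \<bar>x - z\<bar>" using x by linarith
    hence "heatG \<tau> (x - z) \<le> 1 / \<bar>x - z\<bar>" using R by (intro heatG_le_inverse[OF \<tau>(1)]) auto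
    also have "\<dots> \<le> 1 / (R / 4)" using d R by (intro divide_left_mono mult_pos_pos) auto
    finally have "heatG \<tau> (x - z) * \<bar>f \<epsilon> z\<bar> \<le> 1 / (R / 4) * (Cg * heatG (c * \<epsilon> / 4) (z - y))"
      using bound[OF \<epsilon>, of z] G0 R by (intro mult_mono) auto
    also have "\<dots> = 4 * Cg / R * heatG (c * \<epsilon> / 4) (z - y)" by simp
    finally have "heatG \<tau> (x - z) * \<bar>f \<epsilon> z\<bar> \<le> 4 * Cg / R * heatG (c * \<epsilon> / 4) (z - y)" .
    moreover have "0 \<le> 2 * Cg / R * heatG \<tau> (x - z)" using Cg R G0 by simp
    ultimately show ?thesis by linarith
  qed
  have "\<bar>integral {y - R..y + R} (\<lambda>z. heatG \<tau> (x - z) * (pamp u 0 N \<tau> x z * f \<epsilon> z))\<bar> \<le> A * (2 * Cg / R) + A * (4 * Cg / R)"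
  proof (rule heat_integral_bound[OF \<tau>(1), where s = "c * \<epsilon> / 4" and y = y])
    show "continuous_on {y - R..y + R} (\<lambda>z. pamp u 0 N \<tau> x z * f \<epsilon> z)"
      by (intro continuous_intros continuous_on_pamp[OF u] continuous_f[OF \<epsilon>(1)])
    fix z
    have "heatG \<tau> (x - z) * \<bar>pamp u 0 N \<tau> x z * f \<epsilon> z\<bar> = \<bar>pamp u 0 N \<tau> x z\<bar> * (heatG \<tau> (x - z) * \<bar>f \<epsilon> z\<bar>)"
      by (simp add: abs_mult)
    also have "\<dots> \<le> A * (2 * Cg / R * heatG \<tau> (x - z) + 4 * Cg / R * heatG (c * \<epsilon> / 4) (z - y))"
      using A \<tau> G0 by (intro mult_mono pt) auto
    finally show "heatG \<tau> (x - z) * \<bar>pamp u 0 N \<tau> x z * f \<epsilon> z\<bar> \<le> A * (2 * Cg / R) * heatG \<tau> (x - z) + A * (4 * Cg / R) * heatG (c * \<epsilon> / 4) (z - y)"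
      by (simp only: distrib_left mult.assoc)
  qed (use A c \<epsilon> Cg R in auto)
  also have "A * (2 * Cg / R) + A * (4 * Cg / R) = 6 * A * Cg / R" by (simp add: field_simps)
  finally show ?thesis unfolding V_eq .
qed

end

context heat_column
begin

text \<open>The amplitude is 1 + O(s), so for small \<open>s\<close> the value is close to a
  Gaussian average of \<open>f \<epsilon>\<close>, which tends to \<open>f \<epsilon> x\<close> at
  interior points.\<close>

lemma V_initial:
  assumes \<epsilon>: "0 < \<epsilon>" "\<epsilon> \<le> 1" and A: "0 \<le> A" "\<And>t x z. 0 \<le> t \<Longrightarrow> t \<le> 1 \<Longrightarrow> \<bar>pamp u 0 N t x z - 1\<bar> \<le> t * A"
    and x: "\<bar>x - y\<bar> < R" and e: "0 < e"
  shows "\<exists>d>0. \<forall>s z. 0 < s \<longrightarrow> s < d \<longrightarrow> \<bar>z - x\<bar> < d \<longrightarrow> \<bar>V N \<epsilon> R s z - f \<epsilon> x\<bar> < e"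
proof -
  have cf: "continuous_on S (f \<epsilon>)" for S by (rule continuous_f[OF \<epsilon>(1)])
  obtain d1 where d1: "0 < d1" "\<And>s z. 0 < s \<Longrightarrow> s < d1 \<Longrightarrow> \<bar>z - x\<bar> < d1 \<Longrightarrow>
    \<bar>integral {y - R..y + R} (\<lambda>w. heatG s (z - w) * f \<epsilon> w) - f \<epsilon> x\<bar> < e / 2"
    using heat_integral_initial[OF cf, of "y - R" x "y + R" "e / 2"] x e by (auto simp: abs_less_iff)
  define M where "M = Cg / sqrt (pi * c * \<epsilon>)"
  have M0: "0 \<le> M" using Cg c \<epsilon> by (simp add: M_def)
  define d2 where "d2 = e / 2 / (A * M + 1)"
  have AM: "0 < A * M + 1" using A M0 by (simp add: add_nonneg_pos)
  have d2: "0 < d2" using e AM by (simp add: d2_def)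
  show ?thesis
  proof (intro exI[of _ "min d1 (min d2 1)"] conjI allI impI)
    show "0 < min d1 (min d2 1)" using d1(1) d2 by simp
    fix s z assume s: "0 < s" "s < min d1 (min d2 1)" and z: "\<bar>z - x\<bar> < min d1 (min d2 1)"
    let ?I = "{y - R..y + R}"
    have 1: "\<bar>integral ?I (\<lambda>w. heatG s (z - w) * f \<epsilon> w) - f \<epsilon> x\<bar> < e / 2" using s z by (intro d1(2)) auto
    have i1: "(\<lambda>w. heatG s (z - w) * (pamp u 0 N s z w * f \<epsilon> w)) integrable_on ?I"
      using s by (intro integrable_continuous_real continuous_intros continuous_on_heatG continuous_on_pamp[OF u] cf) auto
    have i2: "(\<lambda>w. heatG s (z - w) * f \<epsilon> w) integrable_on ?I"
      using s by (intro integrable_continuous_real continuous_intros continuous_on_heatG cf) auto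
    have "V N \<epsilon> R s z - integral ?I (\<lambda>w. heatG s (z - w) * f \<epsilon> w) =
      integral ?I (\<lambda>w. heatG s (z - w) * ((pamp u 0 N s z w - 1) * f \<epsilon> w))"
      unfolding V_eq Henstock_Kurzweil_Integration.integral_diff[OF i1 i2, symmetric]
      by (simp add: algebra_simps)
    also have "\<bar>\<dots>\<bar> \<le> s * (A * M) + 0"
    proof (rule heat_integral_bound[where s = 1 and y = y])
      show "continuous_on ?I (\<lambda>w. (pamp u 0 N s z w - 1) * f \<epsilon> w)"
        by (intro continuous_intros continuous_on_pamp[OF u] cf)
      fix w
      have "\<bar>(pamp u 0 N s z w - 1) * f \<epsilon> w\<bar> \<le> (s * A) * M"
        unfolding abs_mult using s A M0 bound_t[OF \<epsilon>, of w] by (intro mult_mono) (auto simp: M_def)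
      from mult_left_mono[OF this heatG_nonneg[OF s(1), of "z - w"]]
      show "heatG s (z - w) * \<bar>(pamp u 0 N s z w - 1) * f \<epsilon> w\<bar> \<le> s * (A * M) * heatG s (z - w) + 0 * heatG 1 (w - y)"
        by (simp add: mult_ac)
    qed (use s A M0 in auto)
    finally have 2: "\<bar>V N \<epsilon> R s z - integral ?I (\<lambda>w. heatG s (z - w) * f \<epsilon> w)\<bar> \<le> s * (A * M)" by simp
    have "s * (A * M + 1) \<le> d2 * (A * M + 1)" using s AM by (intro mult_right_mono) auto
    also have "\<dots> = e / 2"
    proof -
      have "a / b * b = a" if "0 < b" for a b :: real using that by simp
      from this[OF AM] show ?thesis unfolding d2_def .
    qed
    finally have "s * (A * M) < e / 2" using s by (simp add: distrib_left)
    thus "\<bar>V N \<epsilon> R s z - f \<epsilon> x\<bar> < e" using 1 2 by linarith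
  qed
qed

text \<open>The sign \<open>sg\<close> yields the upper and the lower estimate from one application
  of the maximum principle to the signed difference minus a barrier depending on time only.\<close>

lemma comparison_aux:
  assumes \<epsilon>: "0 < \<epsilon>" and \<tau>0: "0 < \<tau>0" "\<epsilon> + \<tau>0 < 1" and R: "0 < R" and sg: "\<bar>sg\<bar> = 1"
    and U: "0 \<le> U" "\<And>x. \<bar>u x\<bar> \<le> U" and S: "\<And>x z. \<bar>psrc u N 0 x z\<bar> \<le> S"
    and A: "0 \<le> A" "\<And>t x z. 0 \<le> t \<Longrightarrow> t \<le> 1 \<Longrightarrow> \<bar>pamp u 0 N t x z\<bar> \<le> A"
      "\<And>t x z. 0 \<le> t \<Longrightarrow> t \<le> 1 \<Longrightarrow> \<bar>pamp u 0 N t x z - 1\<bar> \<le> t * A"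
    and k: "k = S * (Cg / sqrt (pi * c / 2) + Cg / sqrt (2 * pi))"
  shows "sg * (f (\<epsilon> + \<tau>0) y - V N \<epsilon> R \<tau>0 y) \<le>
    exp (U * (\<epsilon> + \<tau>0)) * (2 * k * ((\<epsilon> + \<tau>0) ^ N * sqrt (\<epsilon> + \<tau>0)) + (2 + 6 * A) * Cg / R)"
proof -
  define \<eta> where "\<eta> = (2 + 6 * A) * Cg / R"
  have \<eta>: "0 \<le> \<eta>" using A Cg R by (simp add: \<eta>_def)
  have S0: "0 \<le> S" using S[of 0 0] by linarith
  have k0: "0 \<le> k" unfolding k using S0 Cg c by simp
  \<comment> \<open>The derivative of 2 k t^N sqrt t is at least k t^N / sqrt t and pays for the
    source; the factor exp(U t) pays for the potential; \<eta> dominates both functions at the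
    lateral sides.\<close>
  define Bar where "Bar = (\<lambda>t. exp (U * t) * (2 * k * (t ^ N * sqrt t) + \<eta>))"
  have Bar\<eta>: "\<eta> \<le> Bar t" if "0 \<le> t" for t
  proof -
    have "1 * \<eta> \<le> exp (U * t) * (2 * k * (t ^ N * sqrt t) + \<eta>)"
      using that U \<eta> k0 by (intro mult_mono) auto
    thus ?thesis by (simp add: Bar_def)
  qed
  define Bar' where "Bar' = (\<lambda>t. U * Bar t + exp (U * t) * (2 * k * (real N * t ^ (N - 1) * sqrt t + t ^ N * (inverse (sqrt t) / 2))))"
  have BarD: "(Bar has_real_derivative Bar' t) (at t)" if "0 < t" for t
  proof -
    have e: "((\<lambda>t. exp (U * t)) has_real_derivative exp (U * t) * U) (at t)"
      by (auto intro!: derivative_eq_intros)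
    have "((\<lambda>t. t ^ N * sqrt t) has_real_derivative t ^ N * (inverse (sqrt t) / 2) + real N * (1 * t ^ (N - Suc 0)) * sqrt t) (at t)"
      by (rule DERIV_mult'[OF DERIV_power[OF DERIV_ident] DERIV_real_sqrt[OF that]])
    from DERIV_mult'[OF e DERIV_add[OF DERIV_cmult[OF this, of "2 * k"] DERIV_const[of \<eta>]]]
    show ?thesis unfolding Bar_def Bar'_def by (rule DERIV_cong) (simp add: algebra_simps)
  qed
  have Bar'ge: "U * Bar t + t ^ N * (k / sqrt t) \<le> Bar' t" if "0 < t" for t
  proof -
    have "1 * (2 * k * (t ^ N * (inverse (sqrt t) / 2))) \<le> exp (U * t) * (2 * k * (real N * t ^ (N - 1) * sqrt t + t ^ N * (inverse (sqrt t) / 2)))"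
    proof (rule mult_mono)
      show "1 \<le> exp (U * t)" using that U by simp
      have "0 \<le> real N * t ^ (N - 1) * sqrt t" using that by simp
      thus "2 * k * (t ^ N * (inverse (sqrt t) / 2)) \<le> 2 * k * (real N * t ^ (N - 1) * sqrt t + t ^ N * (inverse (sqrt t) / 2))"
        using k0 by (intro mult_left_mono) auto
      show "0 \<le> 2 * k * (t ^ N * (inverse (sqrt t) / 2))" using k0 that by simp
    qed simp
    moreover have "1 * (2 * k * (t ^ N * (inverse (sqrt t) / 2))) = t ^ N * (k / sqrt t)"
    proof -
      have "1 * (2 * k * (a * (inverse b / 2))) = a * (k / b)" for a b :: real by (simp add: field_simps)
      thus ?thesis .
    qed
    ultimately show ?thesis unfolding Bar'_def by (simp only: add_le_cancel_left)
  qed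
  define w where "w = (\<lambda>t x. sg * f t x + - (sg * V N \<epsilon> R (t - \<epsilon>) x + Bar t))"
  have cV: "continuous_on ({\<epsilon><..} \<times> UNIV) (\<lambda>p. V N \<epsilon> R (fst p - \<epsilon>) (snd p))"
    by (rule continuous_on_compose2[OF V_props(1)[OF \<epsilon>], of _ "\<lambda>p. (fst p - \<epsilon>, snd p)", unfolded case_prod_beta fst_conv snd_conv])
      (auto intro!: continuous_intros)
  have isC: "isCont (\<lambda>(t, x). - (sg * V N \<epsilon> R (t - \<epsilon>) x + Bar t)) (t, x)" if "\<epsilon> < t" for t x
  proof -
    have "continuous_on ({\<epsilon><..} \<times> UNIV) (\<lambda>(t, x). - (sg * V N \<epsilon> R (t - \<epsilon>) x + Bar t))"
      unfolding case_prod_beta Bar_def by (intro continuous_intros cV)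
    moreover have "open ({\<epsilon><..} \<times> (UNIV :: real set))" by (intro open_Times) auto
    ultimately show ?thesis using that by (simp add: continuous_on_eq_continuous_at)
  qed
  \<comment> \<open>Starting at 3R/4 instead of R covers a neighbourhood of the bottom corners as
    well, where \<open>V_initial\<close> does not apply.\<close>
  have far: "w t x \<le> 0" if t: "\<epsilon> < t" "t \<le> \<epsilon> + \<tau>0" and x: "3 * R / 4 \<le> \<bar>x - y\<bar>" for t x
  proof -
    have xy: "x \<noteq> y" using x R by auto
    have "\<bar>f t x\<bar> \<le> Cg / \<bar>x - y\<bar>" using t \<epsilon> \<tau>0 xy by (intro bound_x) auto
    also have "\<dots> \<le> Cg / (R / 2)" using x R Cg xy by (intro divide_left_mono mult_pos_pos) auto
    finally have "\<bar>f t x\<bar> \<le> 2 * Cg / R" by (simp add: mult.commute)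
    moreover have "\<bar>V N \<epsilon> R (t - \<epsilon>) x\<bar> \<le> 6 * A * Cg / R"
      using t \<epsilon> \<tau>0 R x A by (intro V_far_bound) auto
    moreover have "sg * a \<le> \<bar>a\<bar>" "- (sg * a) \<le> \<bar>a\<bar>" for a
    proof -
      have "\<bar>sg * a\<bar> = \<bar>a\<bar>" using sg by (simp add: abs_mult)
      thus "sg * a \<le> \<bar>a\<bar>" "- (sg * a) \<le> \<bar>a\<bar>" by linarith+
    qed
    moreover have "\<eta> = 2 * Cg / R + 6 * A * Cg / R" unfolding \<eta>_def by (simp only: distrib_right add_divide_distrib)
    moreover have "\<eta> \<le> Bar t" using t \<epsilon> by (intro Bar\<eta>) simp
    ultimately have "sg * f t x - sg * V N \<epsilon> R (t - \<epsilon>) x \<le> Bar t" by (smt (verit))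
    thus ?thesis unfolding w_def by linarith
  qed
  have "w (\<epsilon> + \<tau>0) y \<le> 0"
  proof (rule max_principle[where w = w and a = "y - R" and b = "y + R" and ?t0.0 = \<epsilon> and ?t1.0 = "\<epsilon> + \<tau>0" and C = U])
    fix t assume t: "\<epsilon> < t" "t \<le> \<epsilon> + \<tau>0"
    have t0: "0 < t" "t < 1" using t \<epsilon> \<tau>0 by auto
    show "continuous_on {y - R..y + R} (w t)"
    proof -
      have "continuous_on {y - R..y + R} (\<lambda>x. V N \<epsilon> R (t - \<epsilon>) x)"
        by (rule continuous_on_compose2[OF cV, of _ "\<lambda>x. (t, x)", unfolded fst_conv snd_conv])
          (use t in \<open>auto intro!: continuous_intros\<close>)
      thus ?thesis unfolding w_def by (intro continuous_intros continuous_f[OF t0(1)])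
    qed
    show "w t (y - R) \<le> 0 \<and> w t (y + R) \<le> 0" using far[OF t] R by auto
    fix x assume x: "y - R < x" "x < y + R" and wpos: "0 < w t x"
    obtain p q Vx where p: "((\<lambda>s. V N \<epsilon> R s x) has_real_derivative p) (at (t - \<epsilon>))"
      and Vx: "\<And>z. (V N \<epsilon> R (t - \<epsilon>) has_real_derivative Vx z) (at z)" and q: "(Vx has_real_derivative q) (at x)"
      and pq: "p = q + u x * V N \<epsilon> R (t - \<epsilon>) x - (t - \<epsilon>) ^ N * integral {y - R..y + R} (\<lambda>z. heatG (t - \<epsilon>) (x - z) * (psrc u N 0 x z * f \<epsilon> z))"
      using V_props(2)[OF \<epsilon>, of "t - \<epsilon>" N R x] t by auto
    define I where "I = integral {y - R..y + R} (\<lambda>z. heatG (t - \<epsilon>) (x - z) * (psrc u N 0 x z * f \<epsilon> z))"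
    have p': "((\<lambda>s. V N \<epsilon> R (s - \<epsilon>) x) has_real_derivative p) (at t)"
      using DERIV_shift[of "\<lambda>s. V N \<epsilon> R s x" p t "- \<epsilon>"] p by simp
    have "\<bar>I\<bar> \<le> S * (Cg / sqrt (pi * c / 2) + Cg / sqrt (2 * pi)) / sqrt (\<epsilon> + (t - \<epsilon>))"
      unfolding I_def using t t0 S \<epsilon> by (intro V_source_bound) auto
    hence I: "\<bar>I\<bar> \<le> k / sqrt t" by (simp add: k)
    have "sg * ((t - \<epsilon>) ^ N * I) \<le> \<bar>(t - \<epsilon>) ^ N * I\<bar>"
      using sg by (metis abs_ge_self abs_mult mult_1)
    also have "\<dots> \<le> t ^ N * (k / sqrt t)"
      unfolding abs_mult using t \<epsilon> t0 I by (intro mult_mono) (auto intro!: power_mono)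
    finally have src: "sg * ((t - \<epsilon>) ^ N * I) \<le> t ^ N * (k / sqrt t)" .
    show "\<exists>p q wx d. ((\<lambda>s. w s x) has_real_derivative p) (at t) \<and> 0 < d \<and>
        (\<forall>z. \<bar>z - x\<bar> < d \<longrightarrow> (w t has_real_derivative wx z) (at z)) \<and>
        (wx has_real_derivative q) (at x) \<and> p \<le> q + U * w t x"
    proof (intro exI conjI allI impI)
      show "((\<lambda>s. w s x) has_real_derivative (sg * ft t x - (sg * p + Bar' t))) (at t)"
        unfolding w_def by (auto intro!: derivative_eq_intros dt[OF t0(1)] p' BarD[OF t0(1)])
      show "(w t has_real_derivative (\<lambda>z. sg * fx t z - sg * Vx z) z) (at z)" for z
        unfolding w_def by (auto intro!: derivative_eq_intros dx[OF t0(1)] Vx)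
      show "((\<lambda>z. sg * fx t z - sg * Vx z) has_real_derivative (sg * fxx t x - sg * q)) (at x)"
        by (auto intro!: derivative_eq_intros dxx[OF t0(1)] q)
      show "0 < (1::real)" by simp
      have B: "u x * Bar t \<le> U * Bar t" "u x * w t x \<le> U * w t x"
        using U(2)[of x] Bar\<eta>[of t] \<eta> t0 wpos by (auto intro!: mult_right_mono)
      have "sg * ft t x - (sg * p + Bar' t) = (sg * fxx t x - sg * q) + (u x * w t x + u x * Bar t) + sg * ((t - \<epsilon>) ^ N * I) - Bar' t"
        unfolding pde[OF t0(1)] pq I_def[symmetric] w_def by (simp add: algebra_simps)
      thus "sg * ft t x - (sg * p + Bar' t) \<le> sg * fxx t x - sg * q + U * w t x"
        using B src Bar'ge[OF t0(1)] by linarith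
    qed
  next
    fix t x assume t: "\<epsilon> < t" "t < \<epsilon> + \<tau>0"
    have "forward_usc (\<lambda>t x. sg * f t x) t x" using t \<epsilon> \<tau>0 sg by (intro forward_usc_f) auto
    thus "forward_usc w t x" unfolding w_def by (rule forward_usc_add[OF _ isC[OF t(1)]])
  next
    fix x e :: real assume x: "y - R \<le> x" "x \<le> y + R" and e: "0 < e"
    show "\<exists>d>0. \<forall>s z. \<epsilon> < s \<longrightarrow> s < \<epsilon> + d \<longrightarrow> \<bar>z - x\<bar> < d \<longrightarrow> y - R \<le> z \<longrightarrow> z \<le> y + R \<longrightarrow> w s z < e"
    proof (cases "\<bar>x - y\<bar> < R")
      case True
      have "forward_usc (\<lambda>t x. sg * f t x) \<epsilon> x" using \<epsilon> \<tau>0 sg by (intro forward_usc_f) auto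
      then obtain d1 where d1: "0 < d1" "\<And>s z. \<epsilon> < s \<Longrightarrow> s < \<epsilon> + d1 \<Longrightarrow> \<bar>z - x\<bar> < d1 \<Longrightarrow> sg * f s z < sg * f \<epsilon> x + e / 2"
        using e unfolding forward_usc_def by (meson half_gt_zero)
      have "\<exists>d>0. \<forall>s z. 0 < s \<longrightarrow> s < d \<longrightarrow> \<bar>z - x\<bar> < d \<longrightarrow> \<bar>V N \<epsilon> R s z - f \<epsilon> x\<bar> < e / 2"
        using \<epsilon> \<tau>0 A True e by (intro V_initial) auto
      then obtain d2 where d2: "0 < d2" "\<And>s z. 0 < s \<Longrightarrow> s < d2 \<Longrightarrow> \<bar>z - x\<bar> < d2 \<Longrightarrow> \<bar>V N \<epsilon> R s z - f \<epsilon> x\<bar> < e / 2"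
        by blast
      show ?thesis
      proof (intro exI[of _ "min d1 d2"] conjI allI impI)
        show "0 < min d1 d2" using d1(1) d2(1) by simp
        fix s z assume s: "\<epsilon> < s" "s < \<epsilon> + min d1 d2" and z: "\<bar>z - x\<bar> < min d1 d2"
        have "sg * f s z < sg * f \<epsilon> x + e / 2" using s z by (intro d1(2)) auto
        moreover have "\<bar>V N \<epsilon> R (s - \<epsilon>) z - f \<epsilon> x\<bar> < e / 2" using s z by (intro d2(2)) auto
        hence "\<bar>sg * (V N \<epsilon> R (s - \<epsilon>) z - f \<epsilon> x)\<bar> < e / 2" using sg by (simp add: abs_mult)
        hence "\<bar>sg * V N \<epsilon> R (s - \<epsilon>) z - sg * f \<epsilon> x\<bar> < e / 2" by (simp add: right_diff_distrib)
        moreover have "0 \<le> Bar s" using Bar\<eta>[of s] \<eta> s \<epsilon> by linarith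
        ultimately show "w s z < e" unfolding w_def by linarith
      qed
    next
      case False
      hence xR: "\<bar>x - y\<bar> = R" using x by linarith
      show ?thesis
      proof (intro exI[of _ "min (R / 4) \<tau>0"] conjI allI impI)
        show "0 < min (R / 4) \<tau>0" using R \<tau>0 by simp
        fix s z assume s: "\<epsilon> < s" "s < \<epsilon> + min (R / 4) \<tau>0" and z: "\<bar>z - x\<bar> < min (R / 4) \<tau>0"
        have "w s z \<le> 0" by (rule far) (use s z xR in linarith)+
        thus "w s z < e" using e by simp
      qed
    qed
  qed (use R \<tau>0 in auto)
  thus ?thesis unfolding w_def Bar_def \<eta>_def by (simp add: right_diff_distrib)
qed

end

context heat_column
begin

text \<open>As R tends to infinity the lateral error vanishes and dominated convergence restores the
  full integral. The constant \<open>E\<close> depends on neither \<epsilon> nor \<tau>, which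
  permits the later limit in \<epsilon>.\<close>

lemma comparison:
  "\<exists>E. \<forall>\<epsilon> \<tau>. 0 < \<epsilon> \<longrightarrow> 0 < \<tau> \<longrightarrow> \<epsilon> + \<tau> < 1 \<longrightarrow>
    \<bar>f (\<epsilon> + \<tau>) y - (LINT z|lborel. f \<epsilon> z * (heatG \<tau> (y - z) * pamp u 0 N \<tau> y z))\<bar> \<le> E * ((\<epsilon> + \<tau>) ^ N * sqrt (\<epsilon> + \<tau>))"
proof -
  obtain U where U: "0 \<le> U" "\<And>x. \<bar>u x\<bar> \<le> U" using u_bounded by blast
  obtain S where S: "\<And>x z. \<bar>psrc u N 0 x z\<bar> \<le> S" using psrc_bounded[OF u] by blast
  obtain A where A: "0 \<le> A" "\<And>t x z. 0 \<le> t \<Longrightarrow> t \<le> 1 \<Longrightarrow> \<bar>pamp u 0 N t x z\<bar> \<le> A"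
      "\<And>t x z. 0 \<le> t \<Longrightarrow> t \<le> 1 \<Longrightarrow> \<bar>pamp u 0 N t x z - 1\<bar> \<le> t * A"
    using pamp_bounded[OF u, of N] by blast
  define k where "k = S * (Cg / sqrt (pi * c / 2) + Cg / sqrt (2 * pi))"
  show ?thesis
  proof (intro exI[of _ "exp U * (2 * k)"] allI impI)
    fix \<epsilon> \<tau> :: real assume \<epsilon>: "0 < \<epsilon>" and \<tau>: "0 < \<tau>" and t1: "\<epsilon> + \<tau> < 1"
    define t where "t = \<epsilon> + \<tau>"
    have t: "0 < t" "t < 1" using \<epsilon> \<tau> t1 by (auto simp: t_def)
    define L where "L = (LINT z|lborel. f \<epsilon> z * (heatG \<tau> (y - z) * pamp u 0 N \<tau> y z))"
    define h where "h = (\<lambda>z. heatG \<tau> (y - z) * (pamp u 0 N \<tau> y z * f \<epsilon> z))"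
    define M where "M = Cg / sqrt (pi * c * \<epsilon>)"
    have M: "\<bar>f \<epsilon> z\<bar> \<le> M" for z unfolding M_def using \<epsilon> t1 \<tau> by (intro bound_t) auto
    have hb: "norm (indicator I z * h z) \<le> heatG \<tau> (y - z) * (A * M)" for I z
    proof -
      have "\<bar>pamp u 0 N \<tau> y z * f \<epsilon> z\<bar> \<le> A * M"
        unfolding abs_mult using A \<tau> \<epsilon> t1 M by (intro mult_mono) auto
      from mult_left_mono[OF this heatG_nonneg[OF \<tau>, of "y - z"]]
      have "\<bar>h z\<bar> \<le> heatG \<tau> (y - z) * (A * M)"
        using heatG_nonneg[OF \<tau>, of "y - z"] by (simp add: h_def abs_mult)
      moreover have "norm (indicator I z * h z) \<le> \<bar>h z\<bar>" by (simp add: indicator_def)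
      ultimately show ?thesis by linarith
    qed
    have ch: "continuous_on UNIV h"
      unfolding h_def by (intro continuous_intros continuous_on_heatG continuous_on_pamp[OF u] continuous_f[OF \<epsilon>] \<tau>)
    have mh: "h \<in> borel_measurable borel" by (rule borel_measurable_continuous_onI[OF ch])
    have Vh: "V N \<epsilon> R \<tau> y = (LINT z|lborel. indicator {y - R..y + R} z * h z)" for R
    proof -
      have "continuous_on {y - R..y + R} (\<lambda>z. pamp u 0 N \<tau> y z * f \<epsilon> z)"
        by (intro continuous_intros continuous_on_pamp[OF u] continuous_f[OF \<epsilon>])
      from integral_heatG_eq_LINT[OF \<tau> this, of y] show ?thesis
        unfolding V_eq by (simp add: h_def mult_ac)
    qed
    have lim: "(\<lambda>n. V N \<epsilon> (real (Suc n)) \<tau> y) \<longlonglongrightarrow> (LINT z|lborel. h z)"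
      unfolding Vh
    proof (rule integral_dominated_convergence[where w = "\<lambda>z. heatG \<tau> (y - z) * (A * M)"])
      show "integrable lborel (\<lambda>z. heatG \<tau> (y - z) * (A * M))" using integrable_heatG[OF \<tau>] by simp
      show "AE z in lborel. norm (indicator {y - real (Suc n)..y + real (Suc n)} z * h z) \<le> heatG \<tau> (y - z) * (A * M)" for n
        using hb by auto
      show "AE z in lborel. (\<lambda>n. indicator {y - real (Suc n)..y + real (Suc n)} z * h z) \<longlonglongrightarrow> h z"
      proof (rule AE_I2)
        fix z
        obtain n0 :: nat where n0: "\<bar>z - y\<bar> \<le> real n0" using real_arch_simple by blast
        have "eventually (\<lambda>n. indicator {y - real (Suc n)..y + real (Suc n)} z * h z = h z) sequentially"
          using eventually_ge_at_top[of n0]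
        proof eventually_elim
          case (elim n)
          hence "real n0 \<le> real n" by simp
          hence "z \<in> {y - real (Suc n)..y + real (Suc n)}" using n0 by (auto simp: abs_le_iff)
          thus ?case by simp
        qed
        thus "(\<lambda>n. indicator {y - real (Suc n)..y + real (Suc n)} z * h z) \<longlonglongrightarrow> h z"
          by (rule tendsto_eventually)
      qed
    qed (use mh in auto)
    have hL: "(LINT z|lborel. h z) = L" by (simp add: h_def L_def mult_ac)
    have Rlim: "(\<lambda>n. exp U * (2 * k * (t ^ N * sqrt t) + (2 + 6 * A) * Cg * inverse (real (Suc n)))) \<longlonglongrightarrow>
      exp U * (2 * k * (t ^ N * sqrt t) + (2 + 6 * A) * Cg * 0)"
      by (intro tendsto_intros LIMSEQ_inverse_real_of_nat)
    have est: "\<bar>f t y - V N \<epsilon> (real (Suc n)) \<tau> y\<bar> \<le> exp U * (2 * k * (t ^ N * sqrt t) + (2 + 6 * A) * Cg * inverse (real (Suc n)))" for n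
    proof -
      let ?r = "2 * k * (t ^ N * sqrt t) + (2 + 6 * A) * Cg / real (Suc n)"
      have S0: "0 \<le> S" using S[of 0 0] by linarith
      have k0: "0 \<le> k" unfolding k_def using S0 Cg c by simp
      have r0: "0 \<le> ?r" using k0 t A Cg by simp
      have *: "sg * (f t y - V N \<epsilon> (real (Suc n)) \<tau> y) \<le> exp (U * t) * ?r" if "\<bar>sg\<bar> = 1" for sg
        unfolding t_def using comparison_aux[OF \<epsilon> \<tau> t1 _ that U S A k_def, of "real (Suc n)"] by simp
      have "exp (U * t) * ?r \<le> exp U * ?r"
        using U t r0 by (intro mult_right_mono) (auto simp: mult_left_le)
      thus ?thesis using *[of 1] *[of "-1"] by (simp add: divide_inverse abs_le_iff)
    qed
    have "\<bar>f t y - L\<bar> \<le> exp U * (2 * k * (t ^ N * sqrt t) + (2 + 6 * A) * Cg * 0)"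
      by (rule LIMSEQ_le[OF tendsto_rabs[OF tendsto_diff[OF tendsto_const lim[unfolded hL]]] Rlim]) (use est in auto)
    thus "\<bar>f (\<epsilon> + \<tau>) y - (LINT z|lborel. f \<epsilon> z * (heatG \<tau> (y - z) * pamp u 0 N \<tau> y z))\<bar> \<le> exp U * (2 * k) * ((\<epsilon> + \<tau>) ^ N * sqrt (\<epsilon> + \<tau>))"
      by (simp add: L_def t_def mult_ac)
  qed
qed

end

section \<open>The diagonal expansion of an arbitrary heat kernel\<close>

lemma heat_kernel_column:
  assumes u: "smooth_bdd u" and H: "heat_kernel u H"
  shows "\<exists>Cg c. heat_column u (\<lambda>t x. H t x y) (\<lambda>t x. deriv (\<lambda>s. H s x y) t) (\<lambda>t. deriv (\<lambda>w. H t w y))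
    (\<lambda>t x. deriv (\<lambda>z. deriv (\<lambda>w. H t w y) z) x) Cg c y"
proof -
  from H obtain C c where c: "c > 0" and b: "\<forall>t\<in>{0<..1}. \<forall>x y. \<bar>H t x y\<bar> \<le> C / sqrt t * exp (- ((x - y)\<^sup>2) / (c * t))"
    unfolding heat_kernel_def by blast
  have d: "\<forall>t>0. \<forall>x y.
        (\<lambda>s. H s x y) differentiable (at t) \<and>
        (\<lambda>z. H t z y) differentiable (at x) \<and>
        (\<lambda>z. deriv (\<lambda>w. H t w y) z) differentiable (at x) \<and>
        deriv (\<lambda>s. H s x y) t = deriv (\<lambda>z. deriv (\<lambda>w. H t w y) z) x + u x * H t x y"
    using H unfolding heat_kernel_def by blast
  \<comment> \<open>At time c t / 4 the Gaussian has the exponent -(x - y)^2 / (c t) of the assumed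
    bound, and |C| sqrt(pi c) undoes its normalisation.\<close>
  have "heat_column u (\<lambda>t x. H t x y) (\<lambda>t x. deriv (\<lambda>s. H s x y) t) (\<lambda>t. deriv (\<lambda>w. H t w y))
    (\<lambda>t x. deriv (\<lambda>z. deriv (\<lambda>w. H t w y) z) x) (\<bar>C\<bar> * sqrt (pi * c)) c y"
  proof
    show "smooth_bdd u" by (rule u)
    fix t x :: real assume t: "0 < t"
    show "((\<lambda>s. H s x y) has_real_derivative deriv (\<lambda>s. H s x y) t) (at t)"
      "((\<lambda>x. H t x y) has_real_derivative deriv (\<lambda>w. H t w y) x) (at x)"
      "(deriv (\<lambda>w. H t w y) has_real_derivative deriv (deriv (\<lambda>w. H t w y)) x) (at x)"
      "deriv (\<lambda>s. H s x y) t = deriv (deriv (\<lambda>w. H t w y)) x + u x * H t x y"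
      using d t unfolding DERIV_deriv_iff_real_differentiable by blast+
    assume t1: "t \<le> 1"
    have "\<bar>H t x y\<bar> \<le> C / sqrt t * exp (- ((x - y)\<^sup>2) / (c * t))" using b t t1 by auto
    also have "\<dots> \<le> \<bar>C\<bar> / sqrt t * exp (- ((x - y)\<^sup>2) / (c * t))"
      using t by (intro mult_right_mono divide_right_mono) auto
    also have "\<dots> = \<bar>C\<bar> * sqrt (pi * c) * heatG (c * t / 4) (x - y)"
      using c t by (simp add: heatG_def real_sqrt_mult)
    finally show "\<bar>H t x y\<bar> \<le> \<bar>C\<bar> * sqrt (pi * c) * heatG (c * t / 4) (x - y)" .
  qed (use c in auto)
  thus ?thesis by blast
qed

text \<open>In \<open>comparison\<close>, \<tau> is fixed and \<epsilon> tends to 0. The test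
  function \<open>g\<close> turns the integral into the parametrix at (y, y), and continuity in time
  alone handles H(\<epsilon> + \<tau>, y, y).\<close>

theorem heat_kernel_diagonal_expansion:
  assumes u: "smooth_bdd u" and H: "heat_kernel u H"
  shows "\<exists>E. \<forall>t. 0 < t \<longrightarrow> t < 1 \<longrightarrow>
    \<bar>H t y y - 1 / sqrt (4 * pi * t) * (\<Sum>n\<le>N. heat_poly n 0 (jet u y) * t ^ n)\<bar> \<le> E * (t ^ N * sqrt t)"
proof -
  obtain Cg c where col: "heat_column u (\<lambda>t x. H t x y) (\<lambda>t x. deriv (\<lambda>s. H s x y) t) (\<lambda>t. deriv (\<lambda>w. H t w y))
    (\<lambda>t x. deriv (\<lambda>z. deriv (\<lambda>w. H t w y) z) x) Cg c y" using heat_kernel_column[OF u H] by blast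
  obtain E where E: "\<And>\<epsilon> \<tau>. 0 < \<epsilon> \<Longrightarrow> 0 < \<tau> \<Longrightarrow> \<epsilon> + \<tau> < 1 \<Longrightarrow>
    \<bar>H (\<epsilon> + \<tau>) y y - (LINT z|lborel. H \<epsilon> z y * (heatG \<tau> (y - z) * pamp u 0 N \<tau> y z))\<bar> \<le> E * ((\<epsilon> + \<tau>) ^ N * sqrt (\<epsilon> + \<tau>))"
    using heat_column.comparison[OF col, of N] by blast
  have init: "\<And>f y. continuous_on UNIV f \<Longrightarrow> bounded (range f) \<Longrightarrow> ((\<lambda>t. LINT x|lborel. H t x y * f x) \<longlongrightarrow> f y) (at_right 0)"
    using H unfolding heat_kernel_def by blast
  obtain A where A: "0 \<le> A" "\<And>t x z. 0 \<le> t \<Longrightarrow> t \<le> 1 \<Longrightarrow> \<bar>pamp u 0 N t x z\<bar> \<le> A"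
    using pamp_bounded[OF u, of N] by blast
  show ?thesis
  proof (intro exI[of _ E] allI impI)
    fix \<tau> :: real assume \<tau>: "0 < \<tau>" "\<tau> < 1"
    define g where "g = (\<lambda>z. heatG \<tau> (y - z) * pamp u 0 N \<tau> y z)"
    have cg: "continuous_on UNIV g"
      unfolding g_def by (intro continuous_intros continuous_on_heatG continuous_on_pamp[OF u] \<tau>)
    have bg: "bounded (range g)"
      unfolding bounded_iff
    proof (intro exI ballI)
      fix v assume "v \<in> range g"
      then obtain z where v: "v = g z" by blast
      have "\<bar>heatG \<tau> (y - z)\<bar> * \<bar>pamp u 0 N \<tau> y z\<bar> \<le> 1 / sqrt (4 * pi * \<tau>) * A"
        using \<tau> A heatG_le[OF \<tau>(1)] heatG_nonneg[OF \<tau>(1)] by (intro mult_mono) auto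
      thus "norm v \<le> 1 / sqrt (4 * pi * \<tau>) * A" by (simp add: v g_def abs_mult)
    qed
    have 1: "((\<lambda>\<epsilon>. LINT z|lborel. H \<epsilon> z y * g z) \<longlongrightarrow> g y) (at_right 0)" by (rule init[OF cg bg])
    have id: "((\<lambda>\<epsilon>. \<epsilon> + \<tau>) \<longlongrightarrow> \<tau>) (at_right 0)"
      by (auto intro!: tendsto_eq_intros)
    have "isCont (\<lambda>s. H s y y) \<tau>" by (rule DERIV_isCont[OF heat_column.dt[OF col \<tau>(1)]])
    from isCont_tendsto_compose[OF this id] have 2: "((\<lambda>\<epsilon>. H (\<epsilon> + \<tau>) y y) \<longlongrightarrow> H \<tau> y y) (at_right 0)" .
    have 3: "((\<lambda>\<epsilon>. E * ((\<epsilon> + \<tau>) ^ N * sqrt (\<epsilon> + \<tau>))) \<longlongrightarrow> E * (\<tau> ^ N * sqrt \<tau>)) (at_right 0)"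
      by (intro tendsto_intros id)
    have "\<bar>H \<tau> y y - g y\<bar> \<le> E * (\<tau> ^ N * sqrt \<tau>)"
    proof (rule tendsto_le[OF _ 3 tendsto_rabs[OF tendsto_diff[OF 2 1]]])
      show "eventually (\<lambda>\<epsilon>. \<bar>H (\<epsilon> + \<tau>) y y - (LINT z|lborel. H \<epsilon> z y * g z)\<bar> \<le> E * ((\<epsilon> + \<tau>) ^ N * sqrt (\<epsilon> + \<tau>))) (at_right 0)"
        unfolding eventually_at_right_field
      proof (intro exI[of _ "1 - \<tau>"] conjI allI impI)
        fix \<epsilon> assume "0 < \<epsilon>" "\<epsilon> < 1 - \<tau>"
        thus "\<bar>H (\<epsilon> + \<tau>) y y - (LINT z|lborel. H \<epsilon> z y * g z)\<bar> \<le> E * ((\<epsilon> + \<tau>) ^ N * sqrt (\<epsilon> + \<tau>))"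
          unfolding g_def using \<tau> by (intro E) auto
      qed (use \<tau> in auto)
    qed simp
    moreover have "g y = 1 / sqrt (4 * pi * \<tau>) * (\<Sum>n\<le>N. heat_poly n 0 (jet u y) * \<tau> ^ n)"
      unfolding g_def pamp_def pcoef_diagonal[OF u] by (simp add: heatG_def mult.commute)
    ultimately show "\<bar>H \<tau> y y - 1 / sqrt (4 * pi * \<tau>) * (\<Sum>n\<le>N. heat_poly n 0 (jet u y) * \<tau> ^ n)\<bar> \<le> E * (\<tau> ^ N * sqrt \<tau>)"
      by simp
  qed
qed

section \<open>Powers of the operator on polynomials\<close>

unbundle no vec_syntax
unbundle fps_syntax

text \<open>The Taylor series at x = 0 of a_n(x, 0) for a potential whose jet at 0 is
  \<open>s\<close>.\<close>

definition heat_fps :: "(nat \<Rightarrow> real) \<Rightarrow> nat \<Rightarrow> real fps" where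
  "heat_fps s n = Abs_fps (\<lambda>i. heat_poly n i s / fact i)"

definition jet_fps :: "(nat \<Rightarrow> real) \<Rightarrow> real fps" where
  "jet_fps s = Abs_fps (\<lambda>i. s i / fact i)"

definition Lfps :: "(nat \<Rightarrow> real) \<Rightarrow> real fps \<Rightarrow> real fps" where
  "Lfps s F = fps_deriv (fps_deriv F) + jet_fps s * F"

definition gauss_moment :: "nat \<Rightarrow> real" where
  "gauss_moment r = fact (2 * r) / fact r"

lemma gauss_moment_Suc: "gauss_moment (Suc r) = 2 * (2 * real r + 1) * gauss_moment r"
proof -
  have "fact (2 * Suc r) = (2 * (real r + 1)) * ((2 * real r + 1) * fact (2 * r))"
    by (simp add: algebra_simps)
  moreover have "fact (Suc r) = (real r + 1) * fact r" by simp
  ultimately have "gauss_moment (Suc r) = (2 * (real r + 1)) * ((2 * real r + 1) * fact (2 * r)) / ((real r + 1) * fact r)"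
    by (simp only: gauss_moment_def)
  also have "\<dots> = 2 * (2 * real r + 1) * (fact (2 * r) / fact r)"
  proof -
    have "2 * a * (b * x) / (a * y) = 2 * b * (x / y)" if "a \<noteq> 0" for a b x y :: real
      using that by (simp add: field_simps)
    from this[of "real r + 1"] show ?thesis by simp
  qed
  finally show ?thesis by (simp only: gauss_moment_def)
qed

lemma fps_X_mult_deriv_nth: "(fps_X * fps_deriv G) $ i = real i * G $ i"
  by (cases i) simp_all

text \<open>The transport equation based at 0, read off coefficientwise: the factor n + i + 1 clears
  the divisor in the recursion of \<open>heat_poly\<close>.\<close>

lemma heat_fps_Suc:
  "of_nat (Suc n) * heat_fps s (Suc n) + fps_X * fps_deriv (heat_fps s (Suc n)) = Lfps s (heat_fps s n)"
proof (rule fps_ext)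
  fix i
  have f: "fact (i + 2) = (real i + 2) * ((real i + 1) * fact i)" by (simp add: algebra_simps)
  have "(of_nat (Suc n) * heat_fps s (Suc n) + fps_X * fps_deriv (heat_fps s (Suc n))) $ i =
    real (n + i + 1) * (heat_poly (Suc n) i s / fact i)"
  proof -
    have "heat_fps s (Suc n) $ i = heat_poly (Suc n) i s / fact i" by (simp add: heat_fps_def)
    moreover have "real (Suc n) * g + real i * g = real (n + i + 1) * g" for g by (simp add: distrib_right)
    ultimately show ?thesis by (simp only: fps_add_nth fps_mult_of_nat_nth fps_X_mult_deriv_nth)
  qed
  also have "real (n + i + 1) * (heat_poly (Suc n) i s / fact i) =
    (heat_poly n (i + 2) s + (\<Sum>j\<le>i. real (i choose j) * (s j * heat_poly n (i - j) s))) / fact i"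
    by simp
  also have "\<dots> = heat_poly n (i + 2) s / fact i + (\<Sum>j\<le>i. (s j / fact j) * (heat_poly n (i - j) s / fact (i - j)))"
    unfolding add_divide_distrib sum_divide_distrib
    by (intro arg_cong2[where f = "(+)"] refl sum.cong) (simp add: binomial_fact)
  also have "heat_poly n (i + 2) s / fact i = (real i + 1) * ((real i + 2) * (heat_poly n (i + 2) s / fact (i + 2)))"
  proof -
    have "h / c = a * (b * (h / (b * (a * c))))" if "a \<noteq> 0" "b \<noteq> 0" for a b c h :: real
      using that by (cases "c = 0") (auto simp: divide_simps)
    thus ?thesis unfolding f by simp
  qed
  finally show "(of_nat (Suc n) * heat_fps s (Suc n) + fps_X * fps_deriv (heat_fps s (Suc n))) $ i = Lfps s (heat_fps s n) $ i"
    by (simp add: Lfps_def heat_fps_def jet_fps_def fps_mult_nth atLeast0AtMost algebra_simps del: fact_Suc)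
qed

text \<open>The coefficient of \<open>t\<^sup>k\<close> in \<open>\<integral> G(t, x) \<Sum>\<^sub>n a\<^sub>n(x, 0) t\<^sup>n F(x) dx\<close>, since \<open>\<integral> G(t, x) x\<^sup>2\<^sup>r dx = gauss_moment r \<cdot> t\<^sup>r\<close>.\<close>
definition pairing :: "(nat \<Rightarrow> real) \<Rightarrow> nat \<Rightarrow> real fps \<Rightarrow> real" where
  "pairing s k F = (\<Sum>n\<le>k. gauss_moment (k - n) * (heat_fps s n * F) $ (2 * (k - n)))"

text \<open>B F'' - B'' F is the derivative of W = B F' - B' F. The factor 2 q + 1 gained from that
  derivative matches the ratio 2 (2 q + 1) of successive Gaussian moments.\<close>

lemma gauss_integration_by_parts:
  fixes B F :: "real fps"
  shows "gauss_moment (Suc q) * ((of_nat (Suc q) * B - fps_X * fps_deriv B) * F) $ (2 * Suc q) =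
    gauss_moment q * (B * fps_deriv (fps_deriv F) - fps_deriv (fps_deriv B) * F) $ (2 * q)"
proof -
  define W where "W = B * fps_deriv F - fps_deriv B * F"
  have "B * fps_deriv (fps_deriv F) - fps_deriv (fps_deriv B) * F = fps_deriv W"
    by (simp add: W_def algebra_simps)
  hence 1: "(B * fps_deriv (fps_deriv F) - fps_deriv (fps_deriv B) * F) $ (2 * q) = (2 * real q + 1) * W $ (2 * q + 1)"
    by simp
  have a: "2 * (of_nat (Suc q) * (B * F)) $ (2 * Suc q) = (fps_X * fps_deriv (B * F)) $ (2 * Suc q)"
    by (simp only: fps_mult_of_nat_nth fps_X_mult_deriv_nth)
  have b: "(of_nat (Suc q) * B - fps_X * fps_deriv B) * F = of_nat (Suc q) * (B * F) - fps_X * (fps_deriv B * F)"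
    by (simp only: left_diff_distrib mult.assoc)
  have c: "fps_X * fps_deriv (B * F) = fps_X * W + (fps_X * (fps_deriv B * F) + fps_X * (fps_deriv B * F))"
    unfolding W_def fps_deriv_mult by (simp only: distrib_left right_diff_distrib) simp
  have "2 * ((of_nat (Suc q) * B - fps_X * fps_deriv B) * F) $ (2 * Suc q) = (fps_X * W) $ (2 * Suc q)"
  proof -
    have "2 * m = w + (y + y) \<Longrightarrow> 2 * (m - y) = w" for m w y :: real by simp
    thus ?thesis using a unfolding b c fps_add_nth fps_sub_nth by blast
  qed
  also have "\<dots> = W $ (2 * q + 1)" by simp
  finally have 2: "2 * ((of_nat (Suc q) * B - fps_X * fps_deriv B) * F) $ (2 * Suc q) = W $ (2 * q + 1)" .
  have "2 * m * g * a = g * (m * w)" if "2 * a = w" for m g a w :: real using that by auto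
  from this[OF 2] show ?thesis unfolding 1 gauss_moment_Suc .
qed

text \<open>The formal counterpart of d/dt \<integral> K F = \<integral> K (L F). The factor k + 1
  is split as n + (k + 1 - n): the transport recursion turns the first part into L a_(n-1), and
  integration by parts in the second moves the derivatives over to F.\<close>

lemma pairing_Suc: "real (Suc k) * pairing s (Suc k) F = pairing s k (Lfps s F)"
proof -
  let ?B = "heat_fps s"
  let ?c = "\<lambda>n (G :: real fps). G $ (2 * (Suc k - n))"
  have split_term: "real (Suc k) * (gauss_moment (Suc k - n) * ?c n (?B n * F)) =
      gauss_moment (Suc k - n) * ?c n ((of_nat n * ?B n + fps_X * fps_deriv (?B n)) * F) +
      gauss_moment (Suc k - n) * ?c n ((of_nat (Suc k - n) * ?B n - fps_X * fps_deriv (?B n)) * F)" if "n \<le> Suc k" for n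
  proof -
    have "(of_nat n * ?B n + fps_X * fps_deriv (?B n)) * F + (of_nat (Suc k - n) * ?B n - fps_X * fps_deriv (?B n)) * F
      = (of_nat n + of_nat (Suc k - n)) * (?B n * F)" by (simp only: algebra_simps)
    also have "of_nat n + of_nat (Suc k - n) = (of_nat (Suc k) :: real fps)"
      using that by (simp only: of_nat_add[symmetric] le_add_diff_inverse)
    finally have eq: "(of_nat n * ?B n + fps_X * fps_deriv (?B n)) * F + (of_nat (Suc k - n) * ?B n - fps_X * fps_deriv (?B n)) * F
      = of_nat (Suc k) * (?B n * F)" .
    have "a * (g * w) = g * p + g * q" if "p + q = a * w" for a g w p q :: real
      using that by (metis distrib_left mult.left_commute)
    moreover have "?c n ((of_nat n * ?B n + fps_X * fps_deriv (?B n)) * F) + ?c n ((of_nat (Suc k - n) * ?B n - fps_X * fps_deriv (?B n)) * F)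
      = real (Suc k) * ?c n (?B n * F)"
      unfolding fps_add_nth[symmetric] eq by (rule fps_mult_of_nat_nth)
    ultimately show ?thesis by blast
  qed
  have "real (Suc k) * pairing s (Suc k) F =
      (\<Sum>n\<le>Suc k. gauss_moment (Suc k - n) * ?c n ((of_nat n * ?B n + fps_X * fps_deriv (?B n)) * F)) +
      (\<Sum>n\<le>Suc k. gauss_moment (Suc k - n) * ?c n ((of_nat (Suc k - n) * ?B n - fps_X * fps_deriv (?B n)) * F))"
    unfolding pairing_def sum_distrib_left sum.distrib[symmetric] by (intro sum.cong refl split_term) simp
  also have "(\<Sum>n\<le>Suc k. gauss_moment (Suc k - n) * ?c n ((of_nat n * ?B n + fps_X * fps_deriv (?B n)) * F)) =
      (\<Sum>n\<le>k. gauss_moment (k - n) * (Lfps s (?B n) * F) $ (2 * (k - n)))"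
  proof -
    have "heat_fps s 0 = 1" by (rule fps_ext) (simp add: heat_fps_def)
    thus ?thesis unfolding sum.atMost_Suc_shift by (simp only: heat_fps_Suc diff_Suc_Suc) simp
  qed
  also have "(\<Sum>n\<le>Suc k. gauss_moment (Suc k - n) * ?c n ((of_nat (Suc k - n) * ?B n - fps_X * fps_deriv (?B n)) * F)) =
      (\<Sum>n\<le>k. gauss_moment (k - n) * (?B n * fps_deriv (fps_deriv F) - fps_deriv (fps_deriv (?B n)) * F) $ (2 * (k - n)))"
  proof -
    have "gauss_moment (Suc k - n) * ?c n ((of_nat (Suc k - n) * ?B n - fps_X * fps_deriv (?B n)) * F) =
      gauss_moment (k - n) * (?B n * fps_deriv (fps_deriv F) - fps_deriv (fps_deriv (?B n)) * F) $ (2 * (k - n))" if "n \<le> k" for n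
      unfolding Suc_diff_le[OF that] by (rule gauss_integration_by_parts)
    thus ?thesis by simp
  qed
  also have "(\<Sum>n\<le>k. gauss_moment (k - n) * (Lfps s (?B n) * F) $ (2 * (k - n))) + \<dots> = pairing s k (Lfps s F)"
    unfolding pairing_def sum.distrib[symmetric] distrib_left[symmetric] fps_add_nth[symmetric]
    by (intro sum.cong refl arg_cong2[where f = "(*)"] arg_cong2[where f = "($)"]) (simp add: Lfps_def algebra_simps)
  finally show ?thesis .
qed

text \<open>\<open>pairing_Suc\<close> is iterated down to k = 0, where the pairing is evaluation at
  0 because a_0 = 1.\<close>

lemma Lfps_power_nth_0: "(Lfps s ^^ k) F $ 0 = fact k * pairing s k F"
proof (induction k arbitrary: F)
  case 0
  show ?case by (simp add: pairing_def gauss_moment_def heat_fps_def)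
next
  case (Suc k)
  have "(Lfps s ^^ Suc k) F $ 0 = fact k * pairing s k (Lfps s F)"
    unfolding funpow_Suc_right o_def by (rule Suc.IH)
  also have "\<dots> = fact (Suc k) * pairing s (Suc k) F"
    unfolding pairing_Suc[symmetric] by simp
  finally show ?case .
qed

lemma pairing_X_power:
  assumes "n \<le> k"
  shows "pairing s k (fps_X ^ (2 * (k - n))) = (\<Sum>l\<le>n. gauss_moment (k - n + l) * (heat_poly (n - l) (2 * l) s / fact (2 * l)))"
proof -
  have "pairing s k (fps_X ^ (2 * (k - n))) = (\<Sum>m\<le>n. gauss_moment (k - m) * (heat_fps s m * fps_X ^ (2 * (k - n))) $ (2 * (k - m)))"
    unfolding pairing_def by (rule sum.mono_neutral_right) (use assms in \<open>auto simp: fps_X_power_mult_right_nth\<close>)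
  also have "\<dots> = (\<Sum>m\<le>n. gauss_moment (k - m) * (heat_poly m (2 * (n - m)) s / fact (2 * (n - m))))"
  proof (intro sum.cong refl)
    fix m assume "m \<in> {..n}"
    hence "2 * (k - m) - 2 * (k - n) = 2 * (n - m)" "\<not> 2 * (k - m) < 2 * (k - n)" using assms by auto
    thus "gauss_moment (k - m) * (heat_fps s m * fps_X ^ (2 * (k - n))) $ (2 * (k - m)) =
      gauss_moment (k - m) * (heat_poly m (2 * (n - m)) s / fact (2 * (n - m)))"
      by (simp add: heat_fps_def fps_X_power_mult_right_nth)
  qed
  also have "\<dots> = (\<Sum>l\<le>n. gauss_moment (k - n + l) * (heat_poly (n - l) (2 * l) s / fact (2 * l)))"
    using assms by (intro sum.reindex_bij_witness[of _ "\<lambda>l. n - l" "\<lambda>m. n - m"]) auto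
  finally show ?thesis .
qed

text \<open>If u_q has weight q + 2, then \<open>heat_poly n i\<close> is homogeneous of weight i +
  2 n, so no variable with a larger weight can occur.\<close>

lemma heat_poly_cong:
  "(\<And>q. q + 2 \<le> i + 2 * n \<Longrightarrow> s q = s' q) \<Longrightarrow> heat_poly n i s = heat_poly n i s'"
proof (induction n arbitrary: i)
  case (Suc n)
  have "heat_poly n (i + 2) s = heat_poly n (i + 2) s'" using Suc.prems by (intro Suc.IH) auto
  moreover have "s j * heat_poly n (i - j) s = s' j * heat_poly n (i - j) s'" if "j \<le> i" for j
    using that Suc.prems Suc.IH[of "i - j"] by auto
  ultimately show ?case by simp
qed simp

lemma Lop_poly: "(Lop (poly p) ^^ k) (poly q) = poly (((\<lambda>q. pderiv (pderiv q) + p * q) ^^ k) q)"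
proof (induction k)
  case (Suc k)
  have d: "deriv (poly q) = poly (pderiv q)" for q :: "real poly"
    by (rule ext, rule DERIV_imp_deriv, rule poly_DERIV)
  show ?case by (simp add: Suc.IH) (simp add: Lop_def d fun_eq_iff)
qed simp

lemma P_eq_sum:
  assumes n: "1 \<le> n" "n \<le> k"
  shows "P k n s = fact k * (\<Sum>l\<le>n. gauss_moment (k - n + l) * (heat_poly (n - l) (2 * l) s / fact (2 * l)))"
proof -
  \<comment> \<open>\<open>s'\<close> is the jet at 0 of the polynomial potential in
    \<open>P\<close>. The coefficients that survive have weight 2 n and involve only u_q with q <= 2
    n - 2 <= 2 k - 2, where \<open>s'\<close> and \<open>s\<close> agree.\<close>
  define s' where "s' = (\<lambda>i. if i \<le> 2 * k - 2 then s i else 0)"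
  define p where "p = (\<Sum>i\<le>2 * k - 2. monom (s i / fact i) i)"
  have p: "poly p = (\<lambda>x. \<Sum>i\<le>2 * k - 2. s i * x ^ i / fact i)"
    by (simp add: p_def fun_eq_iff poly_sum poly_monom)
  have q: "poly (monom 1 (2 * k - 2 * n)) = (\<lambda>x::real. x ^ (2 * k - 2 * n))"
    by (simp add: fun_eq_iff poly_monom)
  have pU: "fps_of_poly p = jet_fps s'"
    by (rule fps_ext) (simp add: p_def jet_fps_def s'_def coeff_sum sum.delta')
  have L: "fps_of_poly (((\<lambda>q. pderiv (pderiv q) + p * q) ^^ j) r) = (Lfps s' ^^ j) (fps_of_poly r)" for j r
    by (induction j) (simp_all add: Lfps_def pU[symmetric] fps_of_poly_add fps_of_poly_mult fps_of_poly_pderiv)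
  have "P k n s = poly (((\<lambda>q. pderiv (pderiv q) + p * q) ^^ k) (monom 1 (2 * k - 2 * n))) 0"
    unfolding P_def Let_def p[symmetric] q[symmetric] Lop_poly ..
  also have "\<dots> = fps_of_poly (((\<lambda>q. pderiv (pderiv q) + p * q) ^^ k) (monom 1 (2 * k - 2 * n))) $ 0"
    by (simp add: poly_0_coeff_0)
  also have "\<dots> = fact k * pairing s' k (fps_X ^ (2 * (k - n)))"
    unfolding L Lfps_power_nth_0 by (simp add: fps_of_poly_monom diff_mult_distrib2)
  also have "\<dots> = fact k * (\<Sum>l\<le>n. gauss_moment (k - n + l) * (heat_poly (n - l) (2 * l) s' / fact (2 * l)))"
    unfolding pairing_X_power[OF n(2)] ..
  also have "\<dots> = fact k * (\<Sum>l\<le>n. gauss_moment (k - n + l) * (heat_poly (n - l) (2 * l) s / fact (2 * l)))"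
  proof -
    have "heat_poly (n - l) (2 * l) s' = heat_poly (n - l) (2 * l) s" if "l \<le> n" for l
      by (rule heat_poly_cong) (use that n in \<open>auto simp: s'_def\<close>)
    thus ?thesis by simp
  qed
  finally show ?thesis .
qed

section \<open>The binomial identity behind the double sum\<close>

lemma alternating_choose_choose:
  "(\<Sum>j\<le>M. (-1) ^ j * real (M choose j) * real (j choose i)) = (if M = i then (-1) ^ M else 0)"
proof (cases "i \<le> M")
  case False
  thus ?thesis by (intro trans[OF sum.neutral]) auto
next
  case True
  have "(\<Sum>j\<le>M. (-1) ^ j * real (M choose j) * real (j choose i)) = (\<Sum>j\<in>{i..M}. (-1) ^ j * real (M choose j) * real (j choose i))"
    by (rule sum.mono_neutral_right) auto
  \<comment> \<open>Up to sign the sum is the M-th finite difference at 0 of x choose i. Rewriting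
    the product of binomials leaves an alternating row sum of Pascal's triangle, which vanishes
    unless M = i.\<close>
  also have "\<dots> = (\<Sum>j\<in>{i..M}. (-1) ^ j * (real (M choose i) * real ((M - i) choose (j - i))))"
  proof (rule sum.cong[OF refl])
    fix j assume "j \<in> {i..M}"
    hence "real (M choose j) * real (j choose i) = real (M choose i) * real ((M - i) choose (j - i))"
      unfolding of_nat_mult[symmetric] by (subst choose_mult) auto
    thus "(-1) ^ j * real (M choose j) * real (j choose i) = (-1) ^ j * (real (M choose i) * real ((M - i) choose (j - i)))"
      by simp
  qed
  also have "\<dots> = (\<Sum>l\<le>M - i. (-1) ^ (l + i) * (real (M choose i) * real ((M - i) choose l)))"
    by (rule sum.reindex_bij_witness[of _ "\<lambda>l. l + i" "\<lambda>j. j - i"]) (use True in auto)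
  also have "\<dots> = (-1) ^ i * real (M choose i) * (\<Sum>l\<le>M - i. (-1) ^ l * real ((M - i) choose l))"
    unfolding sum_distrib_left by (intro sum.cong refl) (simp add: power_add)
  also have "\<dots> = (if M = i then (-1) ^ M else 0)"
  proof (cases "M = i")
    case False
    hence "0 < M - i" using True by simp
    from choose_alternating_sum[OF this, where 'a = real] show ?thesis using False by simp
  qed simp
  finally show ?thesis .
qed

text \<open>Vandermonde's identity expands the polynomial in \<open>j\<close> in the binomial basis,
  on which finite differences act by \<open>alternating_choose_choose\<close>.\<close>

lemma pochhammer_half_binomial:
  "pochhammer (real j + 1 / 2) l = fact l * (\<Sum>i\<le>l. real (j choose i) * ((real l - 1 / 2) gchoose (l - i)))"
proof -
  have "(\<Sum>i\<le>l. (real j gchoose i) * ((real l - 1 / 2) gchoose (l - i))) = (real j + (real l - 1 / 2)) gchoose l"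
    using gbinomial_Vandermonde[of "real j" "real l - 1 / 2" l] by (simp add: atLeast0AtMost)
  also have "\<dots> = pochhammer (real j + 1 / 2) l / fact l"
    unfolding gbinomial_pochhammer' by (simp add: algebra_simps)
  finally show ?thesis by (simp add: binomial_gbinomial)
qed

text \<open>Newton's forward difference formula for the polynomial \<open>x \<mapsto> (x + 1/2)\<^sub>l\<close>, evaluated at \<open>x = -1/2\<close>:
  the weights on the left are \<open>\<bar>binom (-1/2) M\<bar>\<close>.\<close>
lemma newton_interpolation_half:
  assumes "l \<le> n"
  shows "(\<Sum>M\<le>n. real ((2 * M) choose M) / 4 ^ M * (\<Sum>j\<le>M. (-1) ^ j * real (M choose j) * pochhammer (real j + 1 / 2) l))
    = (if l = 0 then 1 else 0)"
proof -
  have central: "real ((2 * M) choose M) / 4 ^ M = (-1) ^ M * ((- 1 / 2) gchoose M)" for M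
  proof -
    have "real ((2 * M) choose M) = fact (2 * M) / (fact M * fact M)"
      by (subst binomial_fact) (auto simp: mult_2)
    also have "\<dots> = 4 ^ M * pochhammer (1 / 2) M / fact M"
      unfolding fact_double by (simp add: power_mult)
    finally show ?thesis by (simp add: gbinomial_pochhammer flip: power_mult_distrib mult.assoc)
  qed
  have inner: "(\<Sum>j\<le>M. (-1) ^ j * real (M choose j) * pochhammer (real j + 1 / 2) l) =
      (if M \<le> l then (-1) ^ M * fact l * ((real l - 1 / 2) gchoose (l - M)) else 0)" for M
  proof -
    have "(\<Sum>j\<le>M. (-1) ^ j * real (M choose j) * pochhammer (real j + 1 / 2) l) =
      (\<Sum>j\<le>M. \<Sum>i\<le>l. fact l * ((real l - 1 / 2) gchoose (l - i)) * ((-1) ^ j * real (M choose j) * real (j choose i)))"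
      unfolding pochhammer_half_binomial sum_distrib_left by (intro sum.cong refl) (simp add: mult_ac)
    also have "\<dots> = (\<Sum>i\<le>l. fact l * ((real l - 1 / 2) gchoose (l - i)) * (\<Sum>j\<le>M. (-1) ^ j * real (M choose j) * real (j choose i)))"
      unfolding sum_distrib_left by (rule sum.swap)
    also have "\<dots> = (\<Sum>i\<le>l. if M = i then (-1) ^ M * fact l * ((real l - 1 / 2) gchoose (l - M)) else 0)"
      unfolding alternating_choose_choose by (intro sum.cong refl) auto
    finally show ?thesis by (simp add: sum.delta')
  qed
  have "(\<Sum>M\<le>n. real ((2 * M) choose M) / 4 ^ M * (\<Sum>j\<le>M. (-1) ^ j * real (M choose j) * pochhammer (real j + 1 / 2) l)) =
    (\<Sum>M\<le>l. ((-1) ^ M * ((- 1 / 2) gchoose M)) * ((-1) ^ M * fact l * ((real l - 1 / 2) gchoose (l - M))))"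
    unfolding central inner by (rule sum.mono_neutral_cong_right) (use assms in auto)
  also have "\<dots> = fact l * (\<Sum>M\<le>l. ((- 1 / 2) gchoose M) * ((real l - 1 / 2) gchoose (l - M)))"
    unfolding sum_distrib_left by (intro sum.cong refl) (simp flip: power_mult_distrib add: mult_ac)
  also have "\<dots> = fact l * ((- 1 / 2 + (real l - 1 / 2)) gchoose l)"
    using gbinomial_Vandermonde[of "- 1 / 2" "real l - 1 / 2" l] by (simp add: atLeast0AtMost)
  \<comment> \<open>The upper argument is l - 1, for l > 0 a natural number below \<open>l\<close>,
    so the binomial vanishes. This reflects the zero of the interpolated polynomial at -1/2.\<close>
  also have "\<dots> = (if l = 0 then 1 else 0)"
  proof (cases l)
    case (Suc l')
    have "- 1 / 2 + (real l - 1 / 2) = real l'" using Suc by simp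
    thus ?thesis using Suc by (simp add: binomial_eq_0 flip: binomial_gbinomial)
  qed simp
  finally show ?thesis .
qed

text \<open>With k = n + j, the factor (2k - 2n)! in the denominator of the formula turns the moment
  weight into a polynomial of degree \<open>l\<close> in \<open>j\<close>, divided by j!. This is
  what makes interpolation applicable.\<close>

lemma gauss_moment_quotient:
  "gauss_moment (j + l) / fact (2 * j) = 4 ^ l * pochhammer (real j + 1 / 2) l / fact j"
proof -
  have "(fact (2 * (j + l)) :: real) = 4 ^ j * 4 ^ l * (pochhammer (1 / 2) j * pochhammer (1 / 2 + real j) l) * fact (j + l)"
    unfolding fact_double pochhammer_product' by (simp add: power_add power_mult)
  moreover have "(fact (2 * j) :: real) = 4 ^ j * pochhammer (1 / 2) j * fact j"
    unfolding fact_double by (simp add: power_mult)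
  moreover have "pochhammer (1 / 2 :: real) j \<noteq> 0" by (simp add: pochhammer_pos less_imp_neq[symmetric])
  ultimately show ?thesis unfolding gauss_moment_def by (simp add: add.commute)
qed

text \<open>With m = n + M and k = n + j the coefficient of the formula separates into a constant
  depending on \<open>n\<close>, the factor 4^l and a Newton weight free of \<open>n\<close>.
  Everything is a quotient of factorials.\<close>

lemma coefficient_identity:
  assumes j: "j \<le> M"
  shows "(-1) ^ (n + (n + j)) * real ((n + M) choose (n + j)) * real ((n + M) choose n) * real ((2 * (n + M)) choose (n + M))
        / (2 ^ (2 * (n + M) - 2 * n + 1) * real ((2 * (n + M)) choose (2 * n)) * fact (2 * (n + j) - 2 * n)) * (fact (n + j) * gauss_moment (j + l))
     = fact (2 * n) / (2 * fact n) * (4 ^ l * (real ((2 * M) choose M) / 4 ^ M * ((-1) ^ j * real (M choose j) * pochhammer (real j + 1 / 2) l)))"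
proof -
  have b1: "real ((n + M) choose (n + j)) = fact (n + M) / (fact (n + j) * fact (M - j))"
    using j by (subst binomial_fact) auto
  have b2: "real ((n + M) choose n) = fact (n + M) / (fact n * fact M)" by (subst binomial_fact) auto
  have b3: "real ((2 * (n + M)) choose (n + M)) = fact (2 * (n + M)) / (fact (n + M) * fact (n + M))"
    by (subst binomial_fact) (auto simp: mult_2)
  have b4: "real ((2 * (n + M)) choose (2 * n)) = fact (2 * (n + M)) / (fact (2 * n) * fact (2 * M))"
    by (subst binomial_fact) auto
  have b5: "real ((2 * M) choose M) = fact (2 * M) / (fact M * fact M)"
    by (subst binomial_fact) (auto simp: mult_2)
  have b6: "real (M choose j) = fact M / (fact j * fact (M - j))" using j by (subst binomial_fact) auto
  have e1: "2 * (n + M) - 2 * n + 1 = Suc (2 * M)" and e2: "2 * (n + j) - 2 * n = 2 * j" by auto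
  have e3: "(-1 :: real) ^ (n + (n + j)) = (-1) ^ j" by (simp add: power_add flip: power_mult_distrib)
  have e4: "(2 :: real) ^ Suc (2 * M) = 2 * 4 ^ M" by (simp add: power_mult)
  have q: "gauss_moment (j + l) = 4 ^ l * pochhammer (real j + 1 / 2) l * fact (2 * j) / fact j"
    using gauss_moment_quotient[of j l] by (simp add: field_simps)
  \<comment> \<open>The letters replace the factorials, powers and the Pochhammer symbol, so that
    the identity becomes one about a rational function.\<close>
  have alg: "s * (a / (b * c)) * (a / (d * e)) * (f / (a * a)) / (2 * g * (f / (h * k)) * m) * (b * (r * p * m / q))
    = h / (2 * d) * (r * (k / (e * e) / g * (s * (e / (q * c)) * p)))"
    if "a \<noteq> 0" "b \<noteq> 0" "c \<noteq> 0" "d \<noteq> 0" "e \<noteq> 0" "f \<noteq> 0" "g \<noteq> 0" "h \<noteq> 0" "k \<noteq> 0" "m \<noteq> 0" "q \<noteq> 0"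
    for a b c d e f g h k m q r s p :: real
    using that by (simp add: divide_simps)
  show ?thesis unfolding b1 b2 b3 b4 b5 b6 e1 e2 e3 e4 q by (rule alg) simp_all
qed

text \<open>Once the Taylor index \<open>l\<close> is summed last, each \<open>l\<close> contributes
  a Newton interpolation with nodes 0, ..., n. It is exact for degree l <= n, which is why m runs up
  to 2 n, and only l = 0 survives.\<close>

lemma sum_P_eq_heat_poly:
  assumes n: "1 \<le> n"
  shows "(\<Sum>m = n..2 * n. \<Sum>k = n..m.
       ((-1) ^ (n + k) * real (m choose k) * real (m choose n) * real ((2 * m) choose m)
        / (2 ^ (2 * m - 2 * n + 1) * real ((2 * m) choose (2 * n)) * fact (2 * k - 2 * n)))
       * P k n s) = fact (2 * n) / (2 * fact n) * heat_poly n 0 s"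
proof -
  define \<beta> where "\<beta> = (\<lambda>l. heat_poly (n - l) (2 * l) s / fact (2 * l))"
  define c where "c = (\<lambda>m k. (-1) ^ (n + k) * real (m choose k) * real (m choose n) * real ((2 * m) choose m)
        / (2 ^ (2 * m - 2 * n + 1) * real ((2 * m) choose (2 * n)) * fact (2 * k - 2 * n)))"
  define W where "W = (\<lambda>l M j. real ((2 * M) choose M) / 4 ^ M * ((-1) ^ j * real (M choose j) * pochhammer (real j + 1 / 2) l))"
  define C where "C = (fact (2 * n) / (2 * fact n) :: real)"
  have "(\<Sum>m = n..2 * n. \<Sum>k = n..m. c m k * P k n s) = (\<Sum>M\<le>n. \<Sum>k = n..n + M. c (n + M) k * P k n s)"
    by (rule sum.reindex_bij_witness[of _ "\<lambda>M. n + M" "\<lambda>m. m - n"]) auto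
  also have "\<dots> = (\<Sum>M\<le>n. \<Sum>j\<le>M. c (n + M) (n + j) * P (n + j) n s)"
    by (intro sum.cong refl sum.reindex_bij_witness[of _ "\<lambda>j. n + j" "\<lambda>k. k - n"]) auto
  also have "\<dots> = (\<Sum>M\<le>n. \<Sum>j\<le>M. \<Sum>l\<le>n. C * (4 ^ l * W l M j) * \<beta> l)"
  proof (intro sum.cong refl)
    fix M j assume "M \<in> {..n}" "j \<in> {..M}"
    hence j: "j \<le> M" by simp
    have "c (n + M) (n + j) * P (n + j) n s = (\<Sum>l\<le>n. c (n + M) (n + j) * (fact (n + j) * gauss_moment (j + l)) * \<beta> l)"
      unfolding P_eq_sum[OF n le_add1] sum_distrib_left \<beta>_def by (intro sum.cong refl) (simp add: mult_ac)
    also have "\<dots> = (\<Sum>l\<le>n. C * (4 ^ l * W l M j) * \<beta> l)"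
      unfolding c_def W_def C_def coefficient_identity[OF j] ..
    finally show "c (n + M) (n + j) * P (n + j) n s = (\<Sum>l\<le>n. C * (4 ^ l * W l M j) * \<beta> l)" .
  qed
  also have "\<dots> = (\<Sum>M\<le>n. \<Sum>l\<le>n. \<Sum>j\<le>M. C * (4 ^ l * W l M j) * \<beta> l)"
    by (intro sum.cong refl sum.swap)
  also have "\<dots> = (\<Sum>l\<le>n. \<Sum>M\<le>n. \<Sum>j\<le>M. C * (4 ^ l * W l M j) * \<beta> l)"
    by (rule sum.swap)
  also have "\<dots> = (\<Sum>l\<le>n. C * 4 ^ l * \<beta> l * (\<Sum>M\<le>n. real ((2 * M) choose M) / 4 ^ M * (\<Sum>j\<le>M. (-1) ^ j * real (M choose j) * pochhammer (real j + 1 / 2) l)))"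
    unfolding W_def sum_distrib_left by (intro sum.cong refl) (simp add: mult_ac)
  also have "\<dots> = (\<Sum>l\<le>n. if l = 0 then C * \<beta> 0 else 0)"
  proof (intro sum.cong refl)
    fix l assume "l \<in> {..n}"
    hence "l \<le> n" by simp
    from newton_interpolation_half[OF this]
    show "C * 4 ^ l * \<beta> l * (\<Sum>M\<le>n. real ((2 * M) choose M) / 4 ^ M * (\<Sum>j\<le>M. (-1) ^ j * real (M choose j) * pochhammer (real j + 1 / 2) l)) =
      (if l = 0 then C * \<beta> 0 else 0)" by (simp only:) simp
  qed
  also have "\<dots> = C * heat_poly n 0 s" by (simp add: \<beta>_def sum.delta)
  finally show ?thesis unfolding c_def C_def .
qed

section \<open>Heat kernels of trigonometric polynomials\<close>

lemma continuous_on_compose4: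
  fixes F :: "'p::topological_space \<Rightarrow> real \<Rightarrow> real \<Rightarrow> real \<Rightarrow> real"
  assumes F: "continuous_on (S \<times> UNIV) (\<lambda>(p, \<kappa>, \<theta>, q). F p \<kappa> \<theta> q)"
    and c: "continuous_on R f" "continuous_on R g" "continuous_on R h" "continuous_on R r"
    and S: "\<And>x. x \<in> R \<Longrightarrow> f x \<in> S"
  shows "continuous_on R (\<lambda>x. F (f x) (g x) (h x) (r x))"
proof -
  have "continuous_on R (\<lambda>x. (\<lambda>(p, \<kappa>, \<theta>, q). F p \<kappa> \<theta> q) (f x, g x, h x, r x))"
    by (rule continuous_on_compose2[OF F]) (use c S in \<open>auto intro!: continuous_on_Pair\<close>)
  thus ?thesis by simp
qed

text \<open>\<open>sin0\<close> says that the sum of \<rho> exp(\<i> (k \<xi> + \<phi>)) is real.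
  Multiplying cos(\<kappa> \<xi> + \<theta>) by the potential then merely adds \<open>k i\<close> to
  \<kappa> and \<open>\<phi> i\<close> to \<theta>, by the addition theorem.\<close>

locale trig_potential =
  fixes I :: "'i set" and \<rho> k \<phi> :: "'i \<Rightarrow> real"
  assumes fin: "finite I" and sin0: "\<And>\<xi>. (\<Sum>i\<in>I. \<rho> i * sin (k i * \<xi> + \<phi> i)) = 0"
begin

definition pot :: "real \<Rightarrow> real" where
  "pot \<xi> = (\<Sum>i\<in>I. \<rho> i * cos (k i * \<xi> + \<phi> i))"

text \<open>The parameters \<open>(\<kappa>, \<theta>, q)\<close> encode \<open>exp (-t q) cos (\<kappa> \<xi> + \<theta>)\<close>. One step multiplies by the potential and then solves
  the transport-diffusion equation with this source; \<open>m\<close> steps give the term of order \<open>m\<close> in the potential.\<close>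
primrec T :: "nat \<Rightarrow> nat \<Rightarrow> (real \<Rightarrow> real \<Rightarrow> real \<Rightarrow> real) \<Rightarrow> real \<Rightarrow> real \<Rightarrow> real \<Rightarrow> real" where
  "T 0 N b \<kappa> \<theta> q = b \<kappa> \<theta> q"
| "T (Suc m) N b \<kappa> \<theta> q = (\<Sum>i\<in>I. \<rho> i * integral {0..1} (\<lambda>\<sigma>. \<sigma> ^ N *
     T m (Suc N) b (\<sigma> * (\<kappa> + k i)) (\<theta> + \<phi> i) (\<sigma> * q + \<sigma> * (1 - \<sigma>) * (\<kappa> + k i)\<^sup>2)))"

lemma T_continuous:
  fixes B :: "'p::topological_space \<Rightarrow> real \<Rightarrow> real \<Rightarrow> real \<Rightarrow> real"
  assumes B: "continuous_on (S \<times> UNIV) (\<lambda>(p, \<kappa>, \<theta>, q). B p \<kappa> \<theta> q)"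
  shows "continuous_on (S \<times> UNIV) (\<lambda>(p, \<kappa>, \<theta>, q). T m N (B p) \<kappa> \<theta> q)"
proof (induction m arbitrary: N)
  case 0
  show ?case using B by simp
next
  case (Suc m)
  have "continuous_on ((S \<times> UNIV) \<times> cbox 0 1) (\<lambda>(x, \<sigma>). \<sigma> ^ N * T m (Suc N) (B (fst x))
      (\<sigma> * (fst (snd x) + k i)) (fst (snd (snd x)) + \<phi> i) (\<sigma> * snd (snd (snd x)) + \<sigma> * (1 - \<sigma>) * (fst (snd x) + k i)\<^sup>2))" for i
    unfolding case_prod_beta
    by (intro continuous_intros continuous_on_compose4[OF Suc.IH]) auto
  from integral_continuous_on_param[OF this]
  show ?case unfolding case_prod_beta T.simps cbox_interval by (intro continuous_intros)
qed

lemmas T_compose = continuous_on_compose4[OF T_continuous]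

lemma T_cont_slice:
  assumes b: "continuous_on UNIV (\<lambda>(\<kappa>, \<theta>, q). b \<kappa> \<theta> q)"
    and c: "continuous_on R g" "continuous_on R h" "continuous_on R r"
  shows "continuous_on R (\<lambda>x. T m N b (g x) (h x) (r x))"
proof -
  have 1: "continuous_on (UNIV \<times> UNIV) (\<lambda>(p::real, \<kappa>, \<theta>, q). b \<kappa> \<theta> q)"
    unfolding case_prod_beta
    by (rule continuous_on_compose2[OF b, of _ snd, unfolded case_prod_beta]) (auto intro!: continuous_intros)
  show ?thesis by (rule T_compose[OF 1, of R "\<lambda>_. 0"]) (use c in auto)
qed

lemma T_linear:
  assumes b1: "continuous_on UNIV (\<lambda>(\<kappa>, \<theta>, q). b1 \<kappa> \<theta> q)" and b2: "continuous_on UNIV (\<lambda>(\<kappa>, \<theta>, q). b2 \<kappa> \<theta> q)"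
  shows "T m N (\<lambda>\<kappa> \<theta> q. a * b1 \<kappa> \<theta> q + c * b2 \<kappa> \<theta> q) \<kappa> \<theta> q = a * T m N b1 \<kappa> \<theta> q + c * T m N b2 \<kappa> \<theta> q"
proof (induction m arbitrary: N \<kappa> \<theta> q)
  case (Suc m)
  have int: "(\<lambda>\<sigma>. \<sigma> ^ N * T m (Suc N) b (\<sigma> * (\<kappa> + k i)) (\<theta> + \<phi> i) (\<sigma> * q + \<sigma> * (1 - \<sigma>) * (\<kappa> + k i)\<^sup>2)) integrable_on {0..1}"
    if "continuous_on UNIV (\<lambda>(\<kappa>, \<theta>, q). b \<kappa> \<theta> q)" for b i
    by (intro integrable_continuous_real continuous_intros T_cont_slice[OF that])
  let ?F = "\<lambda>b i \<sigma>. \<sigma> ^ N * T m (Suc N) b (\<sigma> * (\<kappa> + k i)) (\<theta> + \<phi> i) (\<sigma> * q + \<sigma> * (1 - \<sigma>) * (\<kappa> + k i)\<^sup>2)"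
  have "integral {0..1} (?F (\<lambda>\<kappa> \<theta> q. a * b1 \<kappa> \<theta> q + c * b2 \<kappa> \<theta> q) i) = a * integral {0..1} (?F b1 i) + c * integral {0..1} (?F b2 i)" for i
  proof -
    have "integral {0..1} (?F (\<lambda>\<kappa> \<theta> q. a * b1 \<kappa> \<theta> q + c * b2 \<kappa> \<theta> q) i) = integral {0..1} (\<lambda>\<sigma>. a * ?F b1 i \<sigma> + c * ?F b2 i \<sigma>)"
      unfolding Suc.IH by (rule arg_cong[where f = "integral {0..1}"]) (simp add: fun_eq_iff distrib_left mult_ac)
    also have "\<dots> = a * integral {0..1} (?F b1 i) + c * integral {0..1} (?F b2 i)"
      by (simp only: Henstock_Kurzweil_Integration.integral_add[OF integrable_on_mult_right[OF int[OF b1]] integrable_on_mult_right[OF int[OF b2]]]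
          Henstock_Kurzweil_Integration.integral_mult_right)
    finally show ?thesis .
  qed
  thus ?case unfolding T.simps sum_distrib_left sum.distrib[symmetric]
    by (intro sum.cong refl) (simp only: distrib_left mult.left_commute)
qed simp

text \<open>Applied with the parameter p = \<xi> or p = t, this reduces the derivatives of every
  term of the series to the explicit ones of the exponentials.\<close>

lemma T_DERIV:
  fixes B B' :: "real \<Rightarrow> real \<Rightarrow> real \<Rightarrow> real \<Rightarrow> real"
  assumes U: "open U" "convex U"
    and B: "continuous_on (U \<times> UNIV) (\<lambda>(p, \<kappa>, \<theta>, q). B p \<kappa> \<theta> q)"
    and B': "continuous_on (U \<times> UNIV) (\<lambda>(p, \<kappa>, \<theta>, q). B' p \<kappa> \<theta> q)"
    and d: "\<And>p \<kappa> \<theta> q. p \<in> U \<Longrightarrow> ((\<lambda>p. B p \<kappa> \<theta> q) has_real_derivative B' p \<kappa> \<theta> q) (at p)"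
    and p: "p \<in> U"
  shows "((\<lambda>p. T m N (B p) \<kappa> \<theta> q) has_real_derivative T m N (B' p) \<kappa> \<theta> q) (at p)"
  using p
proof (induction m arbitrary: N \<kappa> \<theta> q p)
  case 0
  thus ?case using d by simp
next
  case (Suc m)
  let ?F = "\<lambda>B i p \<sigma>. \<sigma> ^ N * T m (Suc N) (B p) (\<sigma> * (\<kappa> + k i)) (\<theta> + \<phi> i) (\<sigma> * q + \<sigma> * (1 - \<sigma>) * (\<kappa> + k i)\<^sup>2)"
  have "((\<lambda>p. integral {0..1} (?F B i p)) has_real_derivative integral {0..1} (?F B' i p)) (at p)" for i
  proof (rule DERIV_integral_param[where f = "?F B i" and f' = "?F B' i", OF U Suc.prems])
    fix y \<sigma> assume "y \<in> U"
    thus "((\<lambda>p. ?F B i p \<sigma>) has_real_derivative ?F B' i y \<sigma>) (at y)"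
      by (intro DERIV_cmult Suc.IH)
  next
    fix y assume "y \<in> U"
    thus "continuous_on {0..1} (?F B i y)"
      by (intro continuous_intros T_compose[OF B]) auto
  next
    show "continuous_on (U \<times> {0..1}) (\<lambda>(p, \<sigma>). ?F B' i p \<sigma>)"
      unfolding case_prod_beta by (intro continuous_intros T_compose[OF B']) auto
  qed
  thus ?case unfolding T.simps by (intro DERIV_sum DERIV_cmult)
qed

text \<open>\<open>A\<close> bounds the potential and \<open>K\<close> every single frequency;
  together they control one step of \<open>T\<close>.\<close>

definition A :: real where "A = (\<Sum>i\<in>I. \<bar>\<rho> i\<bar>)"
definition K :: real where "K = (\<Sum>i\<in>I. \<bar>k i\<bar>)"

lemma A_nonneg: "0 \<le> A" by (simp add: A_def sum_nonneg)
lemma K_nonneg: "0 \<le> K" by (simp add: K_def sum_nonneg)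
lemma k_le_K: "i \<in> I \<Longrightarrow> \<bar>k i\<bar> \<le> K"
  unfolding K_def by (rule member_le_sum) (use fin in auto)

lemma integral_power_01: "integral {0..1} (\<lambda>\<sigma>::real. \<sigma> ^ N * c) = c / real (Suc N)"
proof -
  have "((\<lambda>\<sigma>::real. \<sigma> ^ N * c) has_integral (1 ^ Suc N / real (Suc N) * c - 0 ^ Suc N / real (Suc N) * c)) {0..1}"
  proof (rule fundamental_theorem_of_calculus)
    show "((\<lambda>\<sigma>::real. \<sigma> ^ Suc N / real (Suc N) * c) has_vector_derivative \<sigma> ^ N * c) (at \<sigma> within {0..1})" for \<sigma>
      unfolding has_real_derivative_iff_has_vector_derivative[symmetric]
      by (rule DERIV_cong[OF DERIV_cmult_right[OF DERIV_cdivide[OF DERIV_power[OF DERIV_ident]]]]) (simp del: of_nat_Suc)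
  qed simp
  from integral_unique[OF this] show ?thesis by simp
qed

text \<open>One step enlarges the frequency by at most \<open>K\<close> and \<open>q\<close> by at
  most the square of the new frequency, which gives the range on which \<open>b\<close> has to be
  bounded. The integrals of \<sigma>^N, \<sigma>^(N+1), ... supply the quotient of factorials and
  hence convergence.\<close>

lemma T_bound:
  assumes b: "continuous_on UNIV (\<lambda>(\<kappa>, \<theta>, q). b \<kappa> \<theta> q)"
    and bb: "\<And>\<kappa> \<theta> q. \<bar>\<kappa>\<bar> \<le> R + real m * K \<Longrightarrow> 0 \<le> q \<Longrightarrow> q \<le> Q + real m * (R + real m * K)\<^sup>2 \<Longrightarrow> \<bar>b \<kappa> \<theta> q\<bar> \<le> \<beta>"
    and R: "\<bar>\<kappa>\<bar> \<le> R" and q: "0 \<le> q" "q \<le> Q" and \<beta>: "0 \<le> \<beta>"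
  shows "\<bar>T m N b \<kappa> \<theta> q\<bar> \<le> A ^ m * (fact N / fact (N + m)) * \<beta>"
  using bb R q
proof (induction m arbitrary: N \<kappa> \<theta> q R Q)
  case 0
  thus ?case by simp
next
  case (Suc m)
  define D where "D = A ^ m * (fact (Suc N) / fact (Suc N + m)) * \<beta>"
  have R0: "0 \<le> R" using Suc.prems(2) by linarith
  have est: "\<bar>T m (Suc N) b (\<sigma> * (\<kappa> + k i)) (\<theta> + \<phi> i) (\<sigma> * q + \<sigma> * (1 - \<sigma>) * (\<kappa> + k i)\<^sup>2)\<bar> \<le> D"
    if i: "i \<in> I" and s: "0 \<le> \<sigma>" "\<sigma> \<le> 1" for i \<sigma>
    unfolding D_def
  proof (rule Suc.IH[where R = "R + K" and Q = "Q + (R + K)\<^sup>2"])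
    have kk: "\<bar>\<kappa> + k i\<bar> \<le> R + K" using k_le_K[OF i] Suc.prems(2) by linarith
    have "\<bar>\<sigma> * (\<kappa> + k i)\<bar> \<le> 1 * (R + K)" unfolding abs_mult using kk s by (intro mult_mono) auto
    thus "\<bar>\<sigma> * (\<kappa> + k i)\<bar> \<le> R + K" by simp
    show "0 \<le> \<sigma> * q + \<sigma> * (1 - \<sigma>) * (\<kappa> + k i)\<^sup>2" using s Suc.prems(3) by simp
    have "\<sigma> * q \<le> 1 * Q" using s Suc.prems by (intro mult_mono) auto
    moreover have "\<sigma> * (1 - \<sigma>) * (\<kappa> + k i)\<^sup>2 \<le> (1 * 1) * (R + K)\<^sup>2"
    proof (intro mult_mono)
      have "\<bar>\<kappa> + k i\<bar>\<^sup>2 \<le> (R + K)\<^sup>2" using kk by (intro power_mono) auto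
      thus "(\<kappa> + k i)\<^sup>2 \<le> (R + K)\<^sup>2" by simp
    qed (use s in auto)
    ultimately show "\<sigma> * q + \<sigma> * (1 - \<sigma>) * (\<kappa> + k i)\<^sup>2 \<le> Q + (R + K)\<^sup>2" by simp
  next
    fix \<kappa>' \<theta>' q' assume a: "\<bar>\<kappa>'\<bar> \<le> R + K + real m * K" "0 \<le> q'" "q' \<le> Q + (R + K)\<^sup>2 + real m * (R + K + real m * K)\<^sup>2"
    have eq: "R + K + real m * K = R + real (Suc m) * K" by (simp add: algebra_simps)
    have "(R + K)\<^sup>2 \<le> (R + real (Suc m) * K)\<^sup>2"
      unfolding eq[symmetric] using R0 K_nonneg by (intro power_mono) auto
    moreover have "real (Suc m) * (R + real (Suc m) * K)\<^sup>2 = real m * (R + real (Suc m) * K)\<^sup>2 + (R + real (Suc m) * K)\<^sup>2"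
      by (simp add: algebra_simps)
    ultimately show "\<bar>b \<kappa>' \<theta>' q'\<bar> \<le> \<beta>" using a unfolding eq by (intro Suc.prems(1)) linarith+
  qed
  have int: "\<bar>integral {0..1} (\<lambda>\<sigma>. \<sigma> ^ N * T m (Suc N) b (\<sigma> * (\<kappa> + k i)) (\<theta> + \<phi> i) (\<sigma> * q + \<sigma> * (1 - \<sigma>) * (\<kappa> + k i)\<^sup>2))\<bar> \<le> D / real (Suc N)"
    if i: "i \<in> I" for i
    unfolding integral_power_01[symmetric] real_norm_def[symmetric]
  proof (rule Henstock_Kurzweil_Integration.integral_norm_bound_integral)
    show "(\<lambda>\<sigma>. \<sigma> ^ N * T m (Suc N) b (\<sigma> * (\<kappa> + k i)) (\<theta> + \<phi> i) (\<sigma> * q + \<sigma> * (1 - \<sigma>) * (\<kappa> + k i)\<^sup>2)) integrable_on {0..1}"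
      by (intro integrable_continuous_real continuous_intros T_cont_slice[OF b])
    show "(\<lambda>\<sigma>::real. \<sigma> ^ N * D) integrable_on {0..1}"
      by (intro integrable_continuous_real continuous_intros)
    fix \<sigma> :: real assume "\<sigma> \<in> {0..1}"
    thus "norm (\<sigma> ^ N * T m (Suc N) b (\<sigma> * (\<kappa> + k i)) (\<theta> + \<phi> i) (\<sigma> * q + \<sigma> * (1 - \<sigma>) * (\<kappa> + k i)\<^sup>2)) \<le> \<sigma> ^ N * D"
      unfolding real_norm_def abs_mult using est[OF i, of \<sigma>] by (intro mult_mono) auto
  qed
  have "\<bar>T (Suc m) N b \<kappa> \<theta> q\<bar> \<le> (\<Sum>i\<in>I. \<bar>\<rho> i\<bar> * (D / real (Suc N)))"
    unfolding T.simps
    by (rule order_trans[OF sum_abs sum_mono]) (unfold abs_mult, intro mult_left_mono int, auto)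
  also have "\<dots> = A * (D / real (Suc N))" by (simp only: A_def sum_distrib_right)
  also have "\<dots> = A ^ Suc m * (fact N / fact (N + Suc m)) * \<beta>"
  proof -
    have "a * (am * (s * f / g) * b / s) = a * am * (f / g) * b" if "s \<noteq> 0" for a am s f g b :: real
      using that by simp
    moreover have "fact (Suc N) = real (Suc N) * fact N" "Suc N + m = N + Suc m" by simp_all
    ultimately show ?thesis unfolding D_def by (simp only: power_Suc of_nat_Suc)
  qed
  finally show ?case .
qed

end

section \<open>Convergence of the perturbation series and its differential equation\<close>

lemma series_DERIV:
  fixes f f' :: "nat \<Rightarrow> real \<Rightarrow> real"
  assumes S: "open S" "convex S" "x \<in> S"
    and d: "\<And>n y. y \<in> S \<Longrightarrow> (f n has_real_derivative f' n y) (at y)"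
    and b: "\<And>n y. y \<in> S \<Longrightarrow> \<bar>f' n y\<bar> \<le> M n" and M: "summable M" and f: "summable (\<lambda>n. f n x)"
  shows "((\<lambda>y. \<Sum>n. f n y) has_real_derivative (\<Sum>n. f' n x)) (at x)"
proof (rule has_field_derivative_series'(2)[where S = S and f = f and f' = f' and ?x0.0 = x])
  show "(f n has_real_derivative f' n y) (at y within S)" if "y \<in> S" for n y
    using d[OF that] by (rule has_field_derivative_at_within)
  show "uniformly_convergent_on S (\<lambda>n x. \<Sum>i<n. f' i x)"
    by (rule Weierstrass_m_test'[OF _ M]) (use b in auto)
  show "x \<in> interior S" using S by (simp add: interior_open)
qed (use S f in auto)

text \<open>By 1 + m <= 2^m the cubic factor costs only 8^m. Cubic growth is what the time
  derivative produces: after m steps \<open>q\<close> is bounded by a multiple of m^3.\<close>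

lemma summable_poly_exp:
  fixes x :: real
  assumes "0 \<le> x"
  shows "summable (\<lambda>m. c * ((1 + real m) ^ 3 * (x ^ m / fact m)))"
proof (rule summable_mult, rule summable_comparison_test')
  show "summable (\<lambda>m. inverse (fact m) * (8 * x) ^ m)" by (rule summable_exp)
  fix m :: nat
  have "1 + real m \<le> 2 ^ m"
  proof (induction m)
    case (Suc m)
    have "1 \<le> (2::real) ^ m" by simp
    thus ?case using Suc by simp
  qed simp
  hence "(1 + real m) ^ 3 \<le> (2 ^ m) ^ 3" by (intro power_mono) auto
  also have "(2 ^ m) ^ 3 = (8::real) ^ m" by (simp add: power3_eq_cube flip: power_mult_distrib)
  finally have "(1 + real m) ^ 3 * (x ^ m / fact m) \<le> 8 ^ m * (x ^ m / fact m)"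
    using assms by (intro mult_right_mono) auto
  thus "norm ((1 + real m) ^ 3 * (x ^ m / fact m)) \<le> inverse (fact m) * (8 * x) ^ m"
    using assms by (simp add: power_mult_distrib field_simps)
qed

context trig_potential
begin

definition E :: "real \<Rightarrow> real \<Rightarrow> real \<Rightarrow> real \<Rightarrow> real \<Rightarrow> real" where
  "E t \<xi> \<kappa> \<theta> q = exp (- (t * q)) * cos (\<kappa> * \<xi> + \<theta>)"
definition E_x :: "real \<Rightarrow> real \<Rightarrow> real \<Rightarrow> real \<Rightarrow> real \<Rightarrow> real" where
  "E_x t \<xi> \<kappa> \<theta> q = - \<kappa> * (exp (- (t * q)) * sin (\<kappa> * \<xi> + \<theta>))"
definition E_xx :: "real \<Rightarrow> real \<Rightarrow> real \<Rightarrow> real \<Rightarrow> real \<Rightarrow> real" where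
  "E_xx t \<xi> \<kappa> \<theta> q = - (\<kappa>\<^sup>2) * (exp (- (t * q)) * cos (\<kappa> * \<xi> + \<theta>))"
definition E_t :: "real \<Rightarrow> real \<Rightarrow> real \<Rightarrow> real \<Rightarrow> real \<Rightarrow> real" where
  "E_t t \<xi> \<kappa> \<theta> q = - q * (exp (- (t * q)) * cos (\<kappa> * \<xi> + \<theta>))"

lemmas E_defs = E_def E_x_def E_xx_def E_t_def

lemma E_cont:
  "continuous_on S (\<lambda>(\<kappa>, \<theta>, q). E t \<xi> \<kappa> \<theta> q)" "continuous_on S (\<lambda>(\<kappa>, \<theta>, q). E_x t \<xi> \<kappa> \<theta> q)"
  "continuous_on S (\<lambda>(\<kappa>, \<theta>, q). E_xx t \<xi> \<kappa> \<theta> q)" "continuous_on S (\<lambda>(\<kappa>, \<theta>, q). E_t t \<xi> \<kappa> \<theta> q)"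
  unfolding E_defs case_prod_beta by (intro continuous_intros)+

lemma E_cont_x:
  "continuous_on S (\<lambda>(\<xi>, \<kappa>, \<theta>, q). E t \<xi> \<kappa> \<theta> q)" "continuous_on S (\<lambda>(\<xi>, \<kappa>, \<theta>, q). E_x t \<xi> \<kappa> \<theta> q)"
  "continuous_on S (\<lambda>(\<xi>, \<kappa>, \<theta>, q). E_xx t \<xi> \<kappa> \<theta> q)"
  unfolding E_defs case_prod_beta by (intro continuous_intros)+

lemma E_cont_t:
  "continuous_on S (\<lambda>(t, \<kappa>, \<theta>, q). E t \<xi> \<kappa> \<theta> q)" "continuous_on S (\<lambda>(t, \<kappa>, \<theta>, q). E_t t \<xi> \<kappa> \<theta> q)"
  unfolding E_defs case_prod_beta by (intro continuous_intros)+

text \<open>The integral over \<open>\<sigma>\<close> that defines \<open>T\<close> inverts the transport-diffusion operator: for a single exponential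
  this is the fundamental theorem of calculus for \<open>\<sigma>\<^sup>N\<^sup>+\<^sup>1 E\<close> along the curve of parameters.\<close>
lemma T_transport_diffusion:
  "T (Suc m) N (\<lambda>\<kappa> \<theta> q. (real (N + Suc m) - t * q + t * \<kappa>\<^sup>2) * E t \<xi> \<kappa> \<theta> q + \<xi> * E_x t \<xi> \<kappa> \<theta> q) \<kappa> \<theta> q
    = pot \<xi> * T m N (E t \<xi>) \<kappa> \<theta> q"
proof (induction m arbitrary: N \<kappa> \<theta> q)
  case 0
  have I: "integral {0..1} (\<lambda>\<sigma>. \<sigma> ^ N * ((real (N + Suc 0) - t * (\<sigma> * q + \<sigma> * (1 - \<sigma>) * K\<^sup>2) + t * (\<sigma> * K)\<^sup>2) * E t \<xi> (\<sigma> * K) \<Theta> (\<sigma> * q + \<sigma> * (1 - \<sigma>) * K\<^sup>2)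
      + \<xi> * E_x t \<xi> (\<sigma> * K) \<Theta> (\<sigma> * q + \<sigma> * (1 - \<sigma>) * K\<^sup>2))) = E t \<xi> K \<Theta> q" for K \<Theta>
  proof -
    \<comment> \<open>The curve q(\<sigma>) = \<sigma> q + \<sigma> (1 - \<sigma>) K^2 is the
      solution of \<sigma> q'(\<sigma>) = q(\<sigma>) - (\<sigma> K)^2 with q(1) = q. This equation
      is what turns the diffusion and time terms of the integrand into a derivative along the
      curve.\<close>
    define F where "F = (\<lambda>\<sigma>. \<sigma> ^ Suc N * E t \<xi> (\<sigma> * K) \<Theta> (\<sigma> * q + \<sigma> * (1 - \<sigma>) * K\<^sup>2))"
    have "((\<lambda>\<sigma>. \<sigma> ^ N * ((real (N + Suc 0) - t * (\<sigma> * q + \<sigma> * (1 - \<sigma>) * K\<^sup>2) + t * (\<sigma> * K)\<^sup>2) * E t \<xi> (\<sigma> * K) \<Theta> (\<sigma> * q + \<sigma> * (1 - \<sigma>) * K\<^sup>2)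
      + \<xi> * E_x t \<xi> (\<sigma> * K) \<Theta> (\<sigma> * q + \<sigma> * (1 - \<sigma>) * K\<^sup>2))) has_integral (F 1 - F 0)) {0..1}"
    proof (rule fundamental_theorem_of_calculus)
      fix \<sigma> :: real
      let ?q = "\<sigma> * q + \<sigma> * (1 - \<sigma>) * K\<^sup>2"
      have e: "((\<lambda>\<sigma>. exp (- (t * (\<sigma> * q + \<sigma> * (1 - \<sigma>) * K\<^sup>2)))) has_real_derivative exp (- (t * ?q)) * (- (t * (q + (1 - 2 * \<sigma>) * K\<^sup>2)))) (at \<sigma> within {0..1})"
        by (auto intro!: derivative_eq_intros simp: algebra_simps)
      have c: "((\<lambda>\<sigma>. cos (\<sigma> * K * \<xi> + \<Theta>)) has_real_derivative - sin (\<sigma> * K * \<xi> + \<Theta>) * (K * \<xi>)) (at \<sigma> within {0..1})"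
        by (auto intro!: derivative_eq_intros)
      have "(F has_real_derivative \<sigma> ^ Suc N * (exp (- (t * ?q)) * (- sin (\<sigma> * K * \<xi> + \<Theta>) * (K * \<xi>)) + exp (- (t * ?q)) * (- (t * (q + (1 - 2 * \<sigma>) * K\<^sup>2))) * cos (\<sigma> * K * \<xi> + \<Theta>))
        + real (Suc N) * (1 * \<sigma> ^ (Suc N - Suc 0)) * (exp (- (t * ?q)) * cos (\<sigma> * K * \<xi> + \<Theta>))) (at \<sigma> within {0..1})"
        unfolding F_def E_def by (rule DERIV_mult'[OF DERIV_power[OF DERIV_ident] DERIV_mult'[OF e c]])
      also have "\<sigma> ^ Suc N * (exp (- (t * ?q)) * (- sin (\<sigma> * K * \<xi> + \<Theta>) * (K * \<xi>)) + exp (- (t * ?q)) * (- (t * (q + (1 - 2 * \<sigma>) * K\<^sup>2))) * cos (\<sigma> * K * \<xi> + \<Theta>))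
        + real (Suc N) * (1 * \<sigma> ^ (Suc N - Suc 0)) * (exp (- (t * ?q)) * cos (\<sigma> * K * \<xi> + \<Theta>))
        = \<sigma> ^ N * ((real (N + Suc 0) - t * ?q + t * (\<sigma> * K)\<^sup>2) * E t \<xi> (\<sigma> * K) \<Theta> ?q + \<xi> * E_x t \<xi> (\<sigma> * K) \<Theta> ?q)"
      proof -
        have "\<sigma> * a * (e * (- s * (K * \<xi>)) + e * (- (t * (q + (1 - 2 * \<sigma>) * K\<^sup>2))) * c) + n * (1 * a) * (e * c)
          = a * ((n - t * ?q + t * (\<sigma> * K)\<^sup>2) * (e * c) + \<xi> * (- (\<sigma> * K) * (e * s)))" for a e s c n :: real
          by (simp add: algebra_simps power2_eq_square)
        thus ?thesis unfolding E_def E_x_def by simp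
      qed
      finally show "(F has_vector_derivative \<sigma> ^ N * ((real (N + Suc 0) - t * ?q + t * (\<sigma> * K)\<^sup>2) * E t \<xi> (\<sigma> * K) \<Theta> ?q + \<xi> * E_x t \<xi> (\<sigma> * K) \<Theta> ?q)) (at \<sigma> within {0..1})"
        unfolding has_real_derivative_iff_has_vector_derivative .
    qed simp
    from integral_unique[OF this] show ?thesis by (simp add: F_def)
  qed
  have "T (Suc 0) N (\<lambda>\<kappa> \<theta> q. (real (N + Suc 0) - t * q + t * \<kappa>\<^sup>2) * E t \<xi> \<kappa> \<theta> q + \<xi> * E_x t \<xi> \<kappa> \<theta> q) \<kappa> \<theta> q
    = (\<Sum>i\<in>I. \<rho> i * E t \<xi> (\<kappa> + k i) (\<theta> + \<phi> i) q)"
    unfolding T.simps I ..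
  also have "\<dots> = (\<Sum>i\<in>I. exp (- (t * q)) * (cos (\<kappa> * \<xi> + \<theta>) * (\<rho> i * cos (k i * \<xi> + \<phi> i)) - sin (\<kappa> * \<xi> + \<theta>) * (\<rho> i * sin (k i * \<xi> + \<phi> i))))"
  proof (rule sum.cong[OF refl])
    fix i
    have 1: "(\<kappa> + k i) * \<xi> + (\<theta> + \<phi> i) = (\<kappa> * \<xi> + \<theta>) + (k i * \<xi> + \<phi> i)" by (simp add: algebra_simps)
    have 2: "r * (e * (c1 * c2 - s1 * s2)) = e * (c1 * (r * c2) - s1 * (r * s2))" for r e c1 c2 s1 s2 :: real
      by (simp add: algebra_simps)
    show "\<rho> i * E t \<xi> (\<kappa> + k i) (\<theta> + \<phi> i) q = exp (- (t * q)) * (cos (\<kappa> * \<xi> + \<theta>) * (\<rho> i * cos (k i * \<xi> + \<phi> i)) - sin (\<kappa> * \<xi> + \<theta>) * (\<rho> i * sin (k i * \<xi> + \<phi> i)))"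
      unfolding E_def 1 cos_add[of "\<kappa> * \<xi> + \<theta>"] by (rule 2)
  qed
  also have "\<dots> = exp (- (t * q)) * (cos (\<kappa> * \<xi> + \<theta>) * pot \<xi> - sin (\<kappa> * \<xi> + \<theta>) * (\<Sum>i\<in>I. \<rho> i * sin (k i * \<xi> + \<phi> i)))"
    by (simp only: pot_def sum_distrib_left sum_subtractf right_diff_distrib)
  also have "\<dots> = pot \<xi> * T 0 N (E t \<xi>) \<kappa> \<theta> q" by (simp add: sin0 E_def)
  finally show ?case .
next
  case (Suc m)
  \<comment> \<open>The outer step raises \<open>N\<close> by one and lowers the number of remaining
    steps by one, so the factor keeps its value and the induction hypothesis applies under the
    integral.\<close>
  have "real (N + Suc (Suc m)) = real (Suc N + Suc m)" by simp
  thus ?case unfolding T.simps(2)[of "Suc m" N] T.simps(2)[of m N]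
    by (simp only: Suc.IH sum_distrib_left Henstock_Kurzweil_Integration.integral_mult_right mult.left_commute[of _ "pot \<xi>"])
qed

text \<open>A constant that dominates both \<open>K\<close> and its square; it is not the
  differential operator.\<close>

definition L :: real where "L = (1 + K)\<^sup>2"

text \<open>The start (0, 0, 0) encodes the constant 1, so after m steps |\<kappa>| <= m K and 0 <=
  q <= m (m K)^2. As t q >= 0, the exponential is at most 1, and only the factors \<kappa>,
  \<kappa>^2 and q of the derivatives need a bound.\<close>

lemma T_E_bounds:
  assumes t: "0 \<le> t"
  shows "\<bar>T m 0 (E t \<xi>) 0 0 0\<bar> \<le> A ^ m / fact m"
    "\<bar>T m 0 (E_x t \<xi>) 0 0 0\<bar> \<le> L * ((1 + real m) ^ 3 * (A ^ m / fact m))"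
    "\<bar>T m 0 (E_xx t \<xi>) 0 0 0\<bar> \<le> L * ((1 + real m) ^ 3 * (A ^ m / fact m))"
    "\<bar>T m 0 (E_t t \<xi>) 0 0 0\<bar> \<le> L * ((1 + real m) ^ 3 * (A ^ m / fact m))"
proof -
  have ec: "\<bar>exp (- (t * q)) * cos v\<bar> \<le> 1" "\<bar>exp (- (t * q)) * sin v\<bar> \<le> 1" if "0 \<le> q" for q v
    using mult_mono[of "exp (- (t * q))" 1 "\<bar>cos v\<bar>" 1] mult_mono[of "exp (- (t * q))" 1 "\<bar>sin v\<bar>" 1] that t
    by (auto simp: abs_mult)
  let ?M = "L * (1 + real m) ^ 3"
  have K0: "0 \<le> K" by (rule K_nonneg)
  have K1: "K \<le> L" "K\<^sup>2 \<le> L" using K0 by (auto simp: L_def power2_eq_square algebra_simps)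
  have L0: "0 \<le> L" by (simp add: L_def)
  have m1: "real m \<le> (1 + real m) ^ 3" "(real m)\<^sup>2 \<le> (1 + real m) ^ 3" "real m ^ 3 \<le> (1 + real m) ^ 3"
  proof -
    show "real m ^ 3 \<le> (1 + real m) ^ 3" by (intro power_mono) auto
    have "(1 + real m) ^ 1 \<le> (1 + real m) ^ 3" by (intro power_increasing) auto
    thus "real m \<le> (1 + real m) ^ 3" by simp
    have "(real m)\<^sup>2 \<le> (1 + real m)\<^sup>2" by (intro power_mono) auto
    also have "\<dots> \<le> (1 + real m) ^ 3" by (intro power_increasing) auto
    finally show "(real m)\<^sup>2 \<le> (1 + real m) ^ 3" .
  qed
  have M0: "0 \<le> ?M" using L0 by simp
  have b1: "real m * K \<le> ?M" using mult_mono[OF K1(1) m1(1)] K0 L0 by (simp add: mult.commute)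
  have b2: "(real m * K)\<^sup>2 \<le> ?M" using mult_mono[OF K1(2) m1(2)] K0 L0 by (simp add: mult.commute power_mult_distrib)
  have b3: "real m * (real m * K)\<^sup>2 \<le> ?M"
    using mult_mono[OF K1(2) m1(3)] K0 L0 by (simp add: mult_ac power_mult_distrib power2_eq_square power3_eq_cube)
  have *: "\<bar>T m 0 b 0 0 0\<bar> \<le> A ^ m * (fact 0 / fact (0 + m)) * \<beta>"
    if "continuous_on UNIV (\<lambda>(\<kappa>, \<theta>, q). b \<kappa> \<theta> q)" "0 \<le> \<beta>"
      "\<And>\<kappa> \<theta> q. \<bar>\<kappa>\<bar> \<le> real m * K \<Longrightarrow> 0 \<le> q \<Longrightarrow> q \<le> real m * (real m * K)\<^sup>2 \<Longrightarrow> \<bar>b \<kappa> \<theta> q\<bar> \<le> \<beta>" for b \<beta>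
    by (rule T_bound[OF that(1), of 0 m 0 \<beta>]) (use that in auto)
  have **: "\<bar>T m 0 b 0 0 0\<bar> \<le> L * ((1 + real m) ^ 3 * (A ^ m / fact m))"
    if "continuous_on UNIV (\<lambda>(\<kappa>, \<theta>, q). b \<kappa> \<theta> q)"
      "\<And>\<kappa> \<theta> q. \<bar>\<kappa>\<bar> \<le> real m * K \<Longrightarrow> 0 \<le> q \<Longrightarrow> q \<le> real m * (real m * K)\<^sup>2 \<Longrightarrow> \<bar>b \<kappa> \<theta> q\<bar> \<le> ?M" for b
    using *[OF that(1) M0 that(2)] by (simp add: mult_ac)
  have prod: "\<bar>a * w\<bar> \<le> ?M" if "\<bar>a\<bar> \<le> ?M" "\<bar>w\<bar> \<le> 1" for a w
    using mult_mono[OF that M0] by (simp add: abs_mult)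
  show "\<bar>T m 0 (E t \<xi>) 0 0 0\<bar> \<le> A ^ m / fact m"
    unfolding E_def using *[OF E_cont(1)[of UNIV t \<xi>, unfolded E_def], of 1] ec by simp
  show "\<bar>T m 0 (E_x t \<xi>) 0 0 0\<bar> \<le> L * ((1 + real m) ^ 3 * (A ^ m / fact m))"
    unfolding E_x_def by (rule **[OF E_cont(2)[unfolded E_x_def]], rule prod) (use ec b1 in auto)
  show "\<bar>T m 0 (E_xx t \<xi>) 0 0 0\<bar> \<le> L * ((1 + real m) ^ 3 * (A ^ m / fact m))"
    unfolding E_xx_def
  proof (rule **[OF E_cont(3)[unfolded E_xx_def]], rule prod)
    fix \<kappa> assume "\<bar>\<kappa>\<bar> \<le> real m * K"
    hence "\<bar>\<kappa>\<bar>\<^sup>2 \<le> (real m * K)\<^sup>2" by (intro power_mono) auto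
    thus "\<bar>- \<kappa>\<^sup>2\<bar> \<le> ?M" using b2 by simp
  qed (use ec in auto)
  show "\<bar>T m 0 (E_t t \<xi>) 0 0 0\<bar> \<le> L * ((1 + real m) ^ 3 * (A ^ m / fact m))"
    unfolding E_t_def by (rule **[OF E_cont(4)[unfolded E_t_def]], rule prod) (use ec b3 in auto)
qed

text \<open>The heat kernel with pole 0 divided by the Gaussian, as a series in the order of
  perturbation.\<close>

definition W :: "real \<Rightarrow> real \<Rightarrow> real" where "W t \<xi> = (\<Sum>m. t ^ m * T m 0 (E t \<xi>) 0 0 0)"
definition W_x :: "real \<Rightarrow> real \<Rightarrow> real" where "W_x t \<xi> = (\<Sum>m. t ^ m * T m 0 (E_x t \<xi>) 0 0 0)"
definition W_xx :: "real \<Rightarrow> real \<Rightarrow> real" where "W_xx t \<xi> = (\<Sum>m. t ^ m * T m 0 (E_xx t \<xi>) 0 0 0)"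
definition W_t :: "real \<Rightarrow> real \<Rightarrow> real" where
  "W_t t \<xi> = (\<Sum>m. t ^ m * T m 0 (E_t t \<xi>) 0 0 0 + real m * t ^ (m - 1) * T m 0 (E t \<xi>) 0 0 0)"

text \<open>The base contains 1 + \<tau> instead of \<tau>: being at least 1, its powers also
  dominate the power m - 1 that differentiation in time produces.\<close>

definition maj :: "real \<Rightarrow> nat \<Rightarrow> real" where
  "maj \<tau> m = (2 * L + 1) * ((1 + real m) ^ 3 * (((1 + \<tau>) * A) ^ m / fact m))"

lemma summable_maj: "0 \<le> \<tau> \<Longrightarrow> summable (maj \<tau>)"
  unfolding maj_def using summable_poly_exp[of "(1 + \<tau>) * A"] A_nonneg by simp

lemma summand_bounds:
  assumes t: "0 < t" "t \<le> \<tau>"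
  shows "\<bar>t ^ m * T m 0 (E t \<xi>) 0 0 0\<bar> \<le> maj \<tau> m" "\<bar>t ^ m * T m 0 (E_x t \<xi>) 0 0 0\<bar> \<le> maj \<tau> m"
    "\<bar>t ^ m * T m 0 (E_xx t \<xi>) 0 0 0\<bar> \<le> maj \<tau> m"
    "\<bar>t ^ m * T m 0 (E_t t \<xi>) 0 0 0 + real m * t ^ (m - 1) * T m 0 (E t \<xi>) 0 0 0\<bar> \<le> maj \<tau> m"
proof -
  define a where "a = A ^ m / fact m"
  define c where "c = (1 + real m) ^ 3"
  define p where "p = (1 + \<tau>) ^ m"
  have a0: "0 \<le> a" using A_nonneg by (simp add: a_def)
  have c1: "1 \<le> c" unfolding c_def by (rule one_le_power) simp
  have cm: "real m \<le> c"
  proof -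
    have "(1 + real m) ^ 1 \<le> c" unfolding c_def by (intro power_increasing) auto
    thus ?thesis by simp
  qed
  have L0: "0 \<le> L" by (simp add: L_def)
  have p0: "0 \<le> p" using t by (simp add: p_def)
  have tp: "t ^ m \<le> p" unfolding p_def using t by (intro power_mono) auto
  have tp': "t ^ (m - 1) \<le> p"
  proof -
    have "t ^ (m - 1) \<le> (1 + \<tau>) ^ (m - 1)" using t by (intro power_mono) auto
    also have "\<dots> \<le> p" unfolding p_def using t by (intro power_increasing) auto
    finally show ?thesis .
  qed
  have maj: "maj \<tau> m = p * (2 * L * (c * a)) + p * (c * a)"
  proof -
    have "(l + 1) * (x * (y * z / w)) = y * (l * (x * (z / w))) + y * (x * (z / w))" for l x y z w :: real
      by (simp add: algebra_simps add_divide_distrib)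
    thus ?thesis unfolding maj_def a_def c_def p_def power_mult_distrib .
  qed
  have t0: "0 \<le> t" using t by simp
  note B = T_E_bounds[OF t0, of m \<xi>, folded a_def c_def]
  have nn: "0 \<le> p * (2 * L * (c * a))" "0 \<le> p * (c * a)" "0 \<le> p * (L * (c * a))" using p0 L0 c1 a0 by auto
  have ac: "a \<le> c * a" using mult_right_mono[OF c1 a0] by simp
  have 1: "\<bar>t ^ m * T m 0 (E t \<xi>) 0 0 0\<bar> \<le> p * (c * a)"
    unfolding abs_mult using B(1) tp t p0 ac by (intro mult_mono) auto
  have 2: "\<bar>t ^ m * x\<bar> \<le> p * (L * (c * a))" if "\<bar>x\<bar> \<le> L * (c * a)" for x
    unfolding abs_mult using that tp t p0 by (intro mult_mono) auto
  have 3: "\<bar>real m * t ^ (m - 1) * T m 0 (E t \<xi>) 0 0 0\<bar> \<le> p * (c * a)"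
  proof -
    have "\<bar>real m * t ^ (m - 1) * T m 0 (E t \<xi>) 0 0 0\<bar> \<le> c * p * a"
      unfolding abs_mult using B(1) tp' t p0 cm c1 by (intro mult_mono) auto
    thus ?thesis by (simp add: mult_ac)
  qed
  have two: "p * (2 * L * (c * a)) = p * (L * (c * a)) + p * (L * (c * a))" by simp
  show "\<bar>t ^ m * T m 0 (E t \<xi>) 0 0 0\<bar> \<le> maj \<tau> m" unfolding maj using 1 nn by linarith
  show "\<bar>t ^ m * T m 0 (E_x t \<xi>) 0 0 0\<bar> \<le> maj \<tau> m" unfolding maj two using 2[OF B(2)] nn by linarith
  show "\<bar>t ^ m * T m 0 (E_xx t \<xi>) 0 0 0\<bar> \<le> maj \<tau> m" unfolding maj two using 2[OF B(3)] nn by linarith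
  show "\<bar>t ^ m * T m 0 (E_t t \<xi>) 0 0 0 + real m * t ^ (m - 1) * T m 0 (E t \<xi>) 0 0 0\<bar> \<le> maj \<tau> m"
    unfolding maj two using 2[OF B(4)] 3 nn by linarith
qed

lemma summand_summable:
  assumes t: "0 < t"
  shows "summable (\<lambda>m. t ^ m * T m 0 (E t \<xi>) 0 0 0)" "summable (\<lambda>m. t ^ m * T m 0 (E_x t \<xi>) 0 0 0)"
    "summable (\<lambda>m. t ^ m * T m 0 (E_xx t \<xi>) 0 0 0)"
    "summable (\<lambda>m. t ^ m * T m 0 (E_t t \<xi>) 0 0 0 + real m * t ^ (m - 1) * T m 0 (E t \<xi>) 0 0 0)"
  using summand_bounds[OF t order_refl] summable_maj[of t] t
  by (auto intro!: summable_comparison_test'[of "maj t" 0])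

lemma E_x_DERIV: "((\<lambda>\<xi>. E t \<xi> \<kappa> \<theta> q) has_real_derivative E_x t \<xi> \<kappa> \<theta> q) (at \<xi>)"
  unfolding E_defs by (auto intro!: derivative_eq_intros)

lemma E_xx_DERIV: "((\<lambda>\<xi>. E_x t \<xi> \<kappa> \<theta> q) has_real_derivative E_xx t \<xi> \<kappa> \<theta> q) (at \<xi>)"
  unfolding E_defs by (auto intro!: derivative_eq_intros simp: power2_eq_square)

lemma E_t_DERIV: "((\<lambda>t. E t \<xi> \<kappa> \<theta> q) has_real_derivative E_t t \<xi> \<kappa> \<theta> q) (at t)"
  unfolding E_defs by (auto intro!: derivative_eq_intros)

lemma W_DERIV_x: "0 < t \<Longrightarrow> (W t has_real_derivative W_x t \<xi>) (at \<xi>)"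
  unfolding W_def W_x_def
  by (rule series_DERIV[where S = UNIV and M = "maj t"])
    (auto intro!: DERIV_cmult T_DERIV[where U = UNIV] E_cont_x E_x_DERIV summand_bounds summable_maj summand_summable)

lemma W_DERIV_xx: "0 < t \<Longrightarrow> (W_x t has_real_derivative W_xx t \<xi>) (at \<xi>)"
  unfolding W_x_def W_xx_def
  by (rule series_DERIV[where S = UNIV and M = "maj t"])
    (auto intro!: DERIV_cmult T_DERIV[where U = UNIV] E_cont_x E_xx_DERIV summand_bounds summable_maj summand_summable)

lemma W_DERIV_t:
  assumes t: "0 < t"
  shows "((\<lambda>t. W t \<xi>) has_real_derivative W_t t \<xi>) (at t)"
  unfolding W_def W_t_def
proof (rule series_DERIV[where S = "{0<..<t + 1}" and M = "maj (t + 1)"])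
  fix m s assume s: "s \<in> {0<..<t + 1}"
  have d: "((\<lambda>s. T m 0 (E s \<xi>) 0 0 0) has_real_derivative T m 0 (E_t s \<xi>) 0 0 0) (at s)"
    by (rule T_DERIV[where U = UNIV]) (auto intro!: E_cont_t E_t_DERIV)
  show "((\<lambda>s. s ^ m * T m 0 (E s \<xi>) 0 0 0) has_real_derivative s ^ m * T m 0 (E_t s \<xi>) 0 0 0 + real m * s ^ (m - 1) * T m 0 (E s \<xi>) 0 0 0) (at s)"
    by (rule DERIV_cong[OF DERIV_mult'[OF DERIV_power[OF DERIV_ident] d]]) simp
  show "\<bar>s ^ m * T m 0 (E_t s \<xi>) 0 0 0 + real m * s ^ (m - 1) * T m 0 (E s \<xi>) 0 0 0\<bar> \<le> maj (t + 1) m"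
    using s by (intro summand_bounds) auto
qed (use t in \<open>auto intro!: summable_maj summand_summable\<close>)

text \<open>This is the condition on the quotient for Gaussian times \<open>W\<close> to solve the
  heat equation. By \<open>T_transport_diffusion\<close> the left-hand operator sends term m + 1 of
  the series to the potential times term m, and it kills term 0.\<close>

lemma W_pde:
  assumes t: "0 < t"
  shows "W_t t \<xi> + \<xi> / t * W_x t \<xi> - W_xx t \<xi> = pot \<xi> * W t \<xi>"
proof -
  define g where "g = (\<lambda>m. (t ^ m * T m 0 (E_t t \<xi>) 0 0 0 + real m * t ^ (m - 1) * T m 0 (E t \<xi>) 0 0 0)
    + \<xi> / t * (t ^ m * T m 0 (E_x t \<xi>) 0 0 0) - t ^ m * T m 0 (E_xx t \<xi>) 0 0 0)"
  note s = summand_summable[OF t, of \<xi>]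
  have g: "g sums (W_t t \<xi> + \<xi> / t * W_x t \<xi> - W_xx t \<xi>)"
    unfolding g_def W_t_def W_x_def W_xx_def
    by (intro sums_diff sums_add sums_mult summable_sums s)
  have g0: "g 0 = 0" by (simp add: g_def E_defs)
  have gS: "g (Suc m) = pot \<xi> * (t ^ m * T m 0 (E t \<xi>) 0 0 0)" for m
  proof -
    have c1: "continuous_on UNIV (\<lambda>(\<kappa>, \<theta>, q). real (Suc m) * E t \<xi> \<kappa> \<theta> q + t * E_t t \<xi> \<kappa> \<theta> q)"
      "continuous_on UNIV (\<lambda>(\<kappa>, \<theta>, q). \<xi> * E_x t \<xi> \<kappa> \<theta> q + (- t) * E_xx t \<xi> \<kappa> \<theta> q)"
      unfolding case_prod_beta by (intro continuous_intros E_cont[unfolded case_prod_beta])+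
    have "pot \<xi> * T m 0 (E t \<xi>) 0 0 0 =
      T (Suc m) 0 (\<lambda>\<kappa> \<theta> q. 1 * (real (Suc m) * E t \<xi> \<kappa> \<theta> q + t * E_t t \<xi> \<kappa> \<theta> q) + 1 * (\<xi> * E_x t \<xi> \<kappa> \<theta> q + (- t) * E_xx t \<xi> \<kappa> \<theta> q)) 0 0 0"
      unfolding T_transport_diffusion[symmetric]
      by (intro arg_cong[where f = "\<lambda>b. T (Suc m) 0 b 0 0 0"] ext) (simp add: E_defs algebra_simps)
    also have "\<dots> = (real (Suc m) * T (Suc m) 0 (E t \<xi>) 0 0 0 + t * T (Suc m) 0 (E_t t \<xi>) 0 0 0)
      + (\<xi> * T (Suc m) 0 (E_x t \<xi>) 0 0 0 + (- t) * T (Suc m) 0 (E_xx t \<xi>) 0 0 0)"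
      unfolding T_linear[OF c1] T_linear[OF E_cont(1) E_cont(4)] T_linear[OF E_cont(2) E_cont(3)] by (simp only: mult_1)
    finally have eq: "pot \<xi> * T m 0 (E t \<xi>) 0 0 0 = \<dots>" .
    have "t * a * b + n * a * d + \<xi> / t * (t * a * e) - t * a * f = a * ((n * d + t * b) + (\<xi> * e + (- t) * f))" for a b d e f n :: real
      using t by (simp add: algebra_simps)
    hence "g (Suc m) = t ^ m * (pot \<xi> * T m 0 (E t \<xi>) 0 0 0)" unfolding g_def eq power_Suc diff_Suc_1 .
    thus ?thesis by (simp only: mult.left_commute)
  qed
  have "(\<lambda>m. g (Suc m)) sums (pot \<xi> * W t \<xi>)"
    unfolding gS W_def by (intro sums_mult summable_sums s)
  hence "g sums (pot \<xi> * W t \<xi>)" using g0 by (simp add: sums_Suc_iff)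
  thus ?thesis using g by (rule sums_unique2[symmetric])
qed

lemma W_bounds:
  assumes t: "0 < t"
  shows "\<bar>W t \<xi>\<bar> \<le> exp (t * A)" "\<bar>W t \<xi> - 1\<bar> \<le> exp (t * A) - 1"
proof -
  let ?w = "\<lambda>m. t ^ m * T m 0 (E t \<xi>) 0 0 0"
  have e: "(\<lambda>m. (t * A) ^ m / fact m) sums exp (t * A)"
    using exp_converges[of "t * A"] by (simp add: divide_inverse mult.commute)
  have b: "\<bar>?w m\<bar> \<le> (t * A) ^ m / fact m" for m
    using mult_left_mono[OF T_E_bounds(1)[of t m \<xi>], of "t ^ m"] t by (simp add: abs_mult power_mult_distrib)
  have "(\<lambda>m. ?w (Suc m)) sums (W t \<xi> - ?w 0)"
    unfolding W_def using summand_summable(1)[OF t, of \<xi>] by (intro sums_Suc_iff[THEN iffD2]) (simp add: summable_sums)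
  hence s: "(\<lambda>m. ?w (Suc m)) sums (W t \<xi> - 1)" by (simp add: E_def)
  have e1: "(\<lambda>m. (t * A) ^ Suc m / fact (Suc m)) sums (exp (t * A) - 1)"
    using e by (intro sums_Suc_iff[THEN iffD2]) simp
  have "W t \<xi> - 1 \<le> exp (t * A) - 1"
    by (rule sums_le[OF abs_le_D1[OF b] s e1])
  moreover have "- (W t \<xi> - 1) \<le> exp (t * A) - 1"
    by (rule sums_le[OF abs_le_D2[OF b] sums_minus[OF s] e1])
  ultimately show "\<bar>W t \<xi> - 1\<bar> \<le> exp (t * A) - 1" by linarith
  thus "\<bar>W t \<xi>\<bar> \<le> exp (t * A)" by linarith
qed

end

section \<open>The heat kernel of a trigonometric polynomial\<close>

context trig_potential
begin

text \<open>Translating the potential by \<open>y\<close> only changes the phases, so the series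
  with pole 0 serves every pole \<open>y\<close>.\<close>

lemma trig_potential_shift: "trig_potential I \<rho> k (\<lambda>i. k i * y + \<phi> i)"
proof
  show "finite I" by (rule fin)
  fix \<xi>
  have "(\<Sum>i\<in>I. \<rho> i * sin (k i * \<xi> + (k i * y + \<phi> i))) = (\<Sum>i\<in>I. \<rho> i * sin (k i * (\<xi> + y) + \<phi> i))"
    by (simp add: distrib_left add.assoc)
  thus "(\<Sum>i\<in>I. \<rho> i * sin (k i * \<xi> + (k i * y + \<phi> i))) = 0" by (simp add: sin0)
qed

lemma deriv_pot: "(deriv ^^ j) pot = (\<lambda>x. \<Sum>i\<in>I. \<rho> i * k i ^ j * cos (k i * x + \<phi> i + real j * (pi / 2)))"
proof (induction j)
  case 0
  show ?case by (simp add: pot_def fun_eq_iff)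
next
  case (Suc j)
  have "((\<lambda>x. \<Sum>i\<in>I. \<rho> i * k i ^ j * cos (k i * x + \<phi> i + real j * (pi / 2))) has_real_derivative
      (\<Sum>i\<in>I. \<rho> i * k i ^ Suc j * cos (k i * x + \<phi> i + real (Suc j) * (pi / 2)))) (at x)" for x
  proof (rule DERIV_sum)
    fix i
    have c: "cos (k i * x + \<phi> i + real (Suc j) * (pi / 2)) = - sin (k i * x + \<phi> i + real j * (pi / 2))"
    proof -
      have "k i * x + \<phi> i + real (Suc j) * (pi / 2) = (k i * x + \<phi> i + real j * (pi / 2)) + pi / 2"
        by (simp add: field_simps)
      thus ?thesis by (simp only: cos_add cos_pi_half sin_pi_half)
    qed
    have "((\<lambda>x. cos (k i * x + \<phi> i + real j * (pi / 2))) has_real_derivative - sin (k i * x + \<phi> i + real j * (pi / 2)) * k i) (at x)"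
      by (auto intro!: derivative_eq_intros)
    from DERIV_cmult[OF this, of "\<rho> i * k i ^ j"]
    show "((\<lambda>x. \<rho> i * k i ^ j * cos (k i * x + \<phi> i + real j * (pi / 2))) has_real_derivative
      \<rho> i * k i ^ Suc j * cos (k i * x + \<phi> i + real (Suc j) * (pi / 2))) (at x)"
      unfolding c by (simp add: mult_ac)
  qed
  thus ?case unfolding funpow.simps o_def Suc.IH by (intro ext DERIV_imp_deriv)
qed

lemma smooth_bdd_pot: "smooth_bdd pot"
  unfolding smooth_bdd_def deriv_pot
proof (intro conjI allI)
  fix j x
  show "(\<lambda>x. \<Sum>i\<in>I. \<rho> i * k i ^ j * cos (k i * x + \<phi> i + real j * (pi / 2))) differentiable (at x)"
    unfolding real_differentiable_def by (rule exI, (rule derivative_eq_intros refl)+)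
  show "bounded (range (\<lambda>x. \<Sum>i\<in>I. \<rho> i * k i ^ j * cos (k i * x + \<phi> i + real j * (pi / 2))))"
    unfolding bounded_iff
  proof (intro exI ballI)
    fix v assume "v \<in> range (\<lambda>x. \<Sum>i\<in>I. \<rho> i * k i ^ j * cos (k i * x + \<phi> i + real j * (pi / 2)))"
    then obtain x where v: "v = (\<Sum>i\<in>I. \<rho> i * k i ^ j * cos (k i * x + \<phi> i + real j * (pi / 2)))" by blast
    show "norm v \<le> (\<Sum>i\<in>I. \<bar>\<rho> i * k i ^ j\<bar>)"
      unfolding v real_norm_def
      by (rule order_trans[OF sum_abs sum_mono]) (simp add: abs_mult mult_left_le)
  qed
qed

lemma heat_kernel_pot: "\<exists>H. heat_kernel pot H"
proof -
  interpret S: trig_potential I \<rho> k "\<lambda>i. k i * y + \<phi> i" for y by (rule trig_potential_shift)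
  define H where "H = (\<lambda>t x y. heatG t (x - y) * S.W y t (x - y))"
  have potS: "S.pot y (x - y) = pot x" for x y
    unfolding S.pot_def pot_def by (simp add: right_diff_distrib)
  let ?Gx = "\<lambda>t x. - x / (2 * t) * heatG t x"
  let ?Gxx = "\<lambda>t x. (x\<^sup>2 / (4 * t\<^sup>2) - 1 / (2 * t)) * heatG t x"
  define Hx where "Hx = (\<lambda>t x y. heatG t (x - y) * S.W_x y t (x - y) + ?Gx t (x - y) * S.W y t (x - y))"
  define Hxx where "Hxx = (\<lambda>t x y. (heatG t (x - y) * S.W_xx y t (x - y) + ?Gx t (x - y) * S.W_x y t (x - y))
    + (?Gx t (x - y) * S.W_x y t (x - y) + ?Gxx t (x - y) * S.W y t (x - y)))"
  define Ht where "Ht = (\<lambda>t x y. heatG t (x - y) * S.W_t y t (x - y) + ?Gxx t (x - y) * S.W y t (x - y))"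
  have shift: "((\<lambda>x. f (x - y)) has_real_derivative D) (at x)" if "(f has_real_derivative D) (at (x - y))" for f D x and y :: real
    using DERIV_shift[of f D x "- y"] that by simp
  have dGx: "(?Gx t has_real_derivative ?Gxx t x) (at x)" if t: "0 < t" for t x
  proof -
    have 1: "((\<lambda>x. - x / (2 * t)) has_real_derivative - 1 / (2 * t)) (at x)"
      using t by (auto intro!: derivative_eq_intros)
    have 2: "- x / (2 * t) * ?Gx t x + - 1 / (2 * t) * heatG t x = ?Gxx t x"
      using t by (simp add: field_simps power2_eq_square)
    show ?thesis using DERIV_mult'[OF 1 heatG_DERIV_x[OF t]] unfolding 2 .
  qed
  have dH: "((\<lambda>x. H t x y) has_real_derivative Hx t x y) (at x)" if t: "0 < t" for t x y
    unfolding H_def Hx_def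
    by (rule shift[OF DERIV_mult'[OF heatG_DERIV_x[OF t] S.W_DERIV_x[OF t]]])
  have dHx: "((\<lambda>x. Hx t x y) has_real_derivative Hxx t x y) (at x)" if t: "0 < t" for t x y
    unfolding Hx_def Hxx_def
    by (rule shift[OF DERIV_add[OF DERIV_mult'[OF heatG_DERIV_x[OF t] S.W_DERIV_xx[OF t]] DERIV_mult'[OF dGx[OF t] S.W_DERIV_x[OF t]]]])
  have dHt: "((\<lambda>s. H s x y) has_real_derivative Ht t x y) (at t)" if t: "0 < t" for t x y
    unfolding H_def Ht_def by (rule DERIV_mult'[OF heatG_DERIV_t[OF t] S.W_DERIV_t[OF t]])
  have pde: "Ht t x y = Hxx t x y + pot x * H t x y" if t: "0 < t" for t x y
  proof -
    have w: "S.W_t y t (x - y) = S.W_xx y t (x - y) - (x - y) / t * S.W_x y t (x - y) + pot x * S.W y t (x - y)"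
      using S.W_pde[OF t, where y = y and \<xi> = "x - y"] unfolding potS by linarith
    have alg: "g * (b - z / t * a + p * w) + d * w = (g * b + - z / (2 * t) * g * a) + (- z / (2 * t) * g * a + d * w) + p * (g * w)"
      for g b z a p w d :: real using t by (simp add: field_simps)
    show ?thesis unfolding Ht_def Hxx_def H_def w by (rule alg)
  qed
  have "heat_kernel pot H" unfolding heat_kernel_def
  proof (intro conjI allI impI)
    fix t x y :: real assume t: "0 < t"
    have dx: "deriv (\<lambda>w. H t w y) = (\<lambda>x. Hx t x y)" by (rule ext, rule DERIV_imp_deriv, rule dH[OF t])
    show "(\<lambda>s. H s x y) differentiable (at t)" using dHt[OF t] by (auto simp: real_differentiable_def)
    show "(\<lambda>z. H t z y) differentiable (at x)" using dH[OF t] by (auto simp: real_differentiable_def)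
    show "deriv (\<lambda>w. H t w y) differentiable (at x)" unfolding dx using dHx[OF t] by (auto simp: real_differentiable_def)
    show "deriv (\<lambda>s. H s x y) t = deriv (deriv (\<lambda>w. H t w y)) x + pot x * H t x y"
      unfolding dx DERIV_imp_deriv[OF dHt[OF t]] DERIV_imp_deriv[OF dHx[OF t]] by (rule pde[OF t])
  next
    show "\<exists>C c. c > 0 \<and> (\<forall>t\<in>{0<..1}. \<forall>x y. \<bar>H t x y\<bar> \<le> C / sqrt t * exp (- ((x - y)\<^sup>2) / (c * t)))"
    proof (rule exI[of _ "exp A / sqrt (4 * pi)"], rule exI[of _ 4], intro conjI ballI allI)
      fix t x y :: real assume "t \<in> {0<..1}"
      hence t: "0 < t" "t \<le> 1" by auto
      have "\<bar>S.W y t (x - y)\<bar> \<le> exp (t * A)" by (rule S.W_bounds(1)[OF t(1)])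
      also have "\<dots> \<le> exp A" using t A_nonneg by (simp add: mult_left_le_one_le)
      finally have "\<bar>H t x y\<bar> \<le> heatG t (x - y) * exp A"
        unfolding H_def abs_mult using heatG_nonneg[OF t(1)] by (intro mult_mono) auto
      also have "\<dots> = exp A / sqrt (4 * pi) / sqrt t * exp (- ((x - y)\<^sup>2) / (4 * t))"
        by (simp add: heatG_def real_sqrt_mult)
      finally show "\<bar>H t x y\<bar> \<le> exp A / sqrt (4 * pi) / sqrt t * exp (- ((x - y)\<^sup>2) / (4 * t))" .
    qed simp
  next
    fix f :: "real \<Rightarrow> real" and y :: real
    assume cf: "continuous_on UNIV f" and bf: "bounded (range f)"
    obtain M where M: "\<And>x. \<bar>f x\<bar> \<le> M" using bf by (auto simp: bounded_iff)
    have M0: "0 \<le> M" using M[of 0] by linarith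
    show "((\<lambda>t. LINT x|lborel. H t x y * f x) \<longlongrightarrow> f y) (at_right 0)"
      unfolding tendsto_iff
    proof (intro allI impI)
      fix e :: real assume e: "0 < e"
      have "isCont f y" using cf by (simp add: continuous_on_eq_continuous_at)
      then obtain d where d: "0 < d" "\<And>x. \<bar>x - y\<bar> < d \<Longrightarrow> \<bar>f x - f y\<bar> < e / 3"
        using e unfolding continuous_at_eps_delta dist_real_def by (metis zero_less_divide_iff zero_less_numeral)
      define B where "B = 2 * M / d\<^sup>2"
      have B0: "0 \<le> B" using M0 by (simp add: B_def)
      have fb: "\<bar>f x - f y\<bar> \<le> e / 3 + B * (x - y)\<^sup>2" for x
      proof (cases "\<bar>x - y\<bar> < d")
        case True
        have "0 \<le> B * (x - y)\<^sup>2" using B0 by simp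
        thus ?thesis using d(2)[OF True] by linarith
      next
        case False
        have "d\<^sup>2 \<le> (x - y)\<^sup>2" using False d by (simp add: abs_le_square_iff[symmetric])
        hence "B * d\<^sup>2 \<le> B * (x - y)\<^sup>2" using B0 by (rule mult_left_mono)
        moreover have "B * d\<^sup>2 = 2 * M" using d by (simp add: B_def)
        ultimately show ?thesis using M[of x] M[of y] e by linarith
      qed
      have est: "\<bar>(LINT x|lborel. H t x y * f x) - f y\<bar> \<le> e / 3 + (exp (t * A) - 1) * M + B * (2 * t)" if t: "0 < t" for t
      proof -
        have Hg: "H t x y * f x = heatG t (y - x) * (S.W y t (x - y) * f x)" for x
          unfolding H_def heatG_minus[of t x y] by simp
        have cW: "continuous_on UNIV (\<lambda>x. S.W y t (x - y))"
          by (intro continuous_at_imp_continuous_on ballI DERIV_isCont[OF shift[OF S.W_DERIV_x[OF t]]])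
        have m: "(\<lambda>x. S.W y t (x - y) * f x) \<in> borel_measurable borel"
          by (intro borel_measurable_continuous_onI continuous_intros cW cf)
        have b: "\<bar>S.W y t (x - y) * f x - f y\<bar> \<le> (e / 3 + (exp (t * A) - 1) * M) + B * (x - y)\<^sup>2" for x
        proof -
          have "S.W y t (x - y) * f x - f y = (S.W y t (x - y) - 1) * f x + (f x - f y)" by (simp add: algebra_simps)
          moreover have "\<bar>(S.W y t (x - y) - 1) * f x\<bar> \<le> (exp (t * A) - 1) * M"
            unfolding abs_mult using S.W_bounds(2)[OF t] M A_nonneg t by (intro mult_mono) auto
          ultimately show ?thesis using fb[of x] by linarith
        qed
        show ?thesis unfolding Hg using heatG_approx_identity(1)[OF t m b, of y] by simp
      qed
      have "((\<lambda>t. e / 3 + (exp (t * A) - 1) * M + B * (2 * t)) \<longlongrightarrow> e / 3 + (exp (0 * A) - 1) * M + B * (2 * 0)) (at_right 0)"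
        by (intro tendsto_intros)
      hence "eventually (\<lambda>t. e / 3 + (exp (t * A) - 1) * M + B * (2 * t) < e) (at_right 0)"
        by (rule order_tendstoD(2)) (use e in simp)
      moreover have "eventually (\<lambda>t::real. 0 < t) (at_right 0)" by (rule eventually_at_right_less)
      ultimately show "eventually (\<lambda>t. dist (LINT x|lborel. H t x y * f x) (f y) < e) (at_right 0)"
      proof eventually_elim
        case (elim t)
        thus ?case using est[of t] by (simp add: dist_real_def)
      qed
    qed
  qed
  thus ?thesis by (rule exI[of _ H])
qed

end

section \<open>Prescribing a finite jet\<close>

lemma vandermonde_solvable:
  fixes x :: "nat \<Rightarrow> complex"
  assumes "inj_on x {..<M}"
  shows "\<exists>\<alpha>. \<forall>j<M. (\<Sum>i<M. \<alpha> i * x i ^ j) = s j"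
  using assms
proof (induction M arbitrary: s)
  case (Suc M)
  have "inj_on x {..<M}" using Suc.prems by (rule inj_on_subset) auto
  \<comment> \<open>Combining consecutive equations eliminates the last node and leaves a system for
    the first M nodes, whose solution is then divided by x_i - x_M. The equation j = 0 fixes the
    last coefficient, and the others follow by induction on j.\<close>
  from Suc.IH[OF this, of "\<lambda>j. s (Suc j) - x M * s j"] obtain \<beta> where
    \<beta>: "\<And>j. j < M \<Longrightarrow> (\<Sum>i<M. \<beta> i * x i ^ j) = s (Suc j) - x M * s j" by blast
  define \<alpha> where "\<alpha> = (\<lambda>i. if i < M then \<beta> i / (x i - x M) else s 0 - (\<Sum>i<M. \<beta> i / (x i - x M)))"
  have ne: "x i \<noteq> x M" if "i < M" for i
    using Suc.prems that by (auto simp: inj_on_def)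
  have step: "(\<Sum>i<Suc M. \<alpha> i * x i ^ Suc j) - x M * (\<Sum>i<Suc M. \<alpha> i * x i ^ j) = (\<Sum>i<M. \<beta> i * x i ^ j)" for j
  proof -
    have "(\<Sum>i<Suc M. \<alpha> i * x i ^ Suc j) - x M * (\<Sum>i<Suc M. \<alpha> i * x i ^ j) = (\<Sum>i<Suc M. \<alpha> i * (x i - x M) * x i ^ j)"
      unfolding sum_distrib_left sum_subtractf[symmetric] by (intro sum.cong refl) (simp add: algebra_simps)
    also have "\<dots> = (\<Sum>i<M. \<alpha> i * (x i - x M) * x i ^ j)" by simp
    also have "\<dots> = (\<Sum>i<M. \<beta> i * x i ^ j)" using ne by (intro sum.cong refl) (simp add: \<alpha>_def)
    finally show ?thesis .
  qed
  have "(\<Sum>i<Suc M. \<alpha> i * x i ^ j) = s j" if "j < Suc M" for j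
    using that
  proof (induction j)
    case 0
    show ?case by (simp add: \<alpha>_def)
  next
    case (Suc j)
    thus ?case using step[of j] \<beta>[of j] by (simp add: algebra_simps)
  qed
  thus ?case by blast
qed simp

text \<open>For the real part of the sum of c_i exp(\<i> (i + 1) \<xi>), the j-th derivative at 0 is
  the real part of the sum of c_i x_i^j with the distinct nodes x_i = \<i> (i + 1). Prescribing the
  jet is therefore a complex Vandermonde system.\<close>

lemma heat_kernel_with_jet:
  "\<exists>u H. smooth_bdd u \<and> heat_kernel u H \<and> (\<forall>j<M. jet u 0 j = s j)"
proof -
  define x where "x = (\<lambda>i::nat. \<i> * of_nat (Suc i))"
  have "inj_on x {..<M}" by (auto simp: inj_on_def x_def)
  from vandermonde_solvable[OF this, of "\<lambda>j. of_real (s j)"] obtain c where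
    c: "\<And>j. j < M \<Longrightarrow> (\<Sum>i<M. c i * x i ^ j) = of_real (s j)" by blast
  \<comment> \<open>Each frequency occurs twice, with opposite frequency and phase and half the
    amplitude. The sines cancel, as \<open>trig_potential\<close> demands, and the cosines add up to
    the real part.\<close>
  define I where "I = ({..<M} \<times> UNIV :: (nat \<times> bool) set)"
  define \<rho> where "\<rho> = (\<lambda>(i::nat, b::bool). cmod (c i) / 2)"
  define k where "k = (\<lambda>(i, b). if b then real (Suc i) else - real (Suc i))"
  define \<phi> where "\<phi> = (\<lambda>(i, b). if b then Arg (c i) else - Arg (c i))"
  have sumI: "(\<Sum>p\<in>I. f p) = (\<Sum>i<M. f (i, True) + f (i, False))" for f :: "nat \<times> bool \<Rightarrow> real"
    unfolding I_def by (simp add: sum.cartesian_product' UNIV_bool add.commute)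
  interpret trig_potential I \<rho> k \<phi>
  proof
    show "finite I" by (simp add: I_def)
    fix \<xi>
    have "sin (- r * \<xi> + - a) = - sin (r * \<xi> + a)" for r a :: real
      using sin_minus[of "r * \<xi> + a"] by simp
    thus "(\<Sum>i\<in>I. \<rho> i * sin (k i * \<xi> + \<phi> i)) = 0"
      unfolding sumI by (simp add: \<rho>_def k_def \<phi>_def del: of_nat_Suc)
  qed
  have "jet pot 0 j = s j" if j: "j < M" for j
  proof -
    have "jet pot 0 j = (\<Sum>i<M. cmod (c i) * (real (Suc i) ^ j * cos (Arg (c i) + real j * (pi / 2))))"
      unfolding jet_def deriv_pot sumI
    proof (rule sum.cong[OF refl])
      fix i
      have "- Arg (c i) + real j * (pi / 2) = - ((Arg (c i) + real j * (pi / 2)) - real j * pi)" by (simp add: field_simps)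
      hence 1: "cos (- Arg (c i) + real j * (pi / 2)) = (-1) ^ j * cos (Arg (c i) + real j * (pi / 2))"
        using cos_diff[of "Arg (c i) + real j * (pi / 2)" "real j * pi"]
        by (simp only: cos_minus cos_npi sin_npi) simp
      have 2: "(- real (Suc i)) ^ j = (-1) ^ j * real (Suc i) ^ j" by (rule power_minus)
      have 3: "(-1 :: real) ^ j * (-1) ^ j = 1" by (simp flip: power_mult_distrib)
      have "(m * a) * (m * b) = (m * m) * (a * b)" for m a b :: real by (simp only: mult_ac)
      hence "(- real (Suc i)) ^ j * cos (- Arg (c i) + real j * (pi / 2)) = real (Suc i) ^ j * cos (Arg (c i) + real j * (pi / 2))"
        unfolding 1 2 using 3 by (simp only: mult_1)
      thus "\<rho> (i, True) * k (i, True) ^ j * cos (k (i, True) * 0 + \<phi> (i, True) + real j * (pi / 2)) +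
        \<rho> (i, False) * k (i, False) ^ j * cos (k (i, False) * 0 + \<phi> (i, False) + real j * (pi / 2)) =
        cmod (c i) * (real (Suc i) ^ j * cos (Arg (c i) + real j * (pi / 2)))"
        by (simp add: \<rho>_def k_def \<phi>_def mult.assoc del: of_nat_Suc)
    qed
    also have "\<dots> = (\<Sum>i<M. Re (c i * x i ^ j))"
    proof (rule sum.cong[OF refl])
      fix i
      have "c i * x i ^ j = of_real (cmod (c i) * real (Suc i) ^ j) * (cis (Arg (c i)) * cis (pi / 2) ^ j)"
        using rcis_cmod_Arg[of "c i"] by (simp add: x_def power_mult_distrib cis_pi_half rcis_def mult_ac del: of_nat_Suc)
      also have "cis (Arg (c i)) * cis (pi / 2) ^ j = cis (Arg (c i) + real j * (pi / 2))"
        by (simp only: Complex.DeMoivre cis_mult)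
      finally show "cmod (c i) * (real (Suc i) ^ j * cos (Arg (c i) + real j * (pi / 2))) = Re (c i * x i ^ j)"
        by simp
    qed
    also have "\<dots> = s j" unfolding Re_sum[symmetric] c[OF j] by simp
    finally show ?thesis .
  qed
  thus ?thesis using smooth_bdd_pot heat_kernel_pot by blast
qed

section \<open>The heat invariants\<close>

lemma poly_fun_sum: "finite S \<Longrightarrow> (\<And>i. i \<in> S \<Longrightarrow> p i \<in> poly_fun) \<Longrightarrow> (\<lambda>s. \<Sum>i\<in>S. p i s) \<in> poly_fun"
  by (induction S rule: finite_induct) (auto intro: poly_fun.intros)

lemma heat_poly_poly_fun: "heat_poly n j \<in> poly_fun"
proof (induction n arbitrary: j)
  case 0
  have "heat_poly 0 j = (\<lambda>s. if j = 0 then 1 else 0)" by (simp add: fun_eq_iff)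
  thus ?case by (simp add: pf_const)
next
  case (Suc n)
  have "(\<lambda>s. (1 / real (n + j + 1)) * (heat_poly n (j + 2) s + (\<Sum>i\<le>j. real (j choose i) * (s i * heat_poly n (j - i) s)))) \<in> poly_fun"
    by (intro poly_fun.intros poly_fun_sum Suc.IH) auto
  thus ?case by (simp add: fun_eq_iff[symmetric] del: of_nat_add)
qed

text \<open>This is what lets a finite jet, and hence a trigonometric polynomial, determine the
  value of an invariant.\<close>

lemma poly_fun_finitely_many_variables:
  assumes "p \<in> poly_fun"
  shows "\<exists>M. \<forall>s s'. (\<forall>j<M. s j = s' j) \<longrightarrow> p s = p s'"
  using assms
proof induction
  case (pf_var i)
  show ?case by (rule exI[of _ "Suc i"]) simp
next
  case (pf_add p q)
  then obtain M1 M2 where "\<forall>s s'. (\<forall>j<M1. s j = s' j) \<longrightarrow> p s = p s'" "\<forall>s s'. (\<forall>j<M2. s j = s' j) \<longrightarrow> q s = q s'" by blast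
  thus ?case by (intro exI[of _ "max M1 M2"] allI impI arg_cong2[where f = "(+)"]) (simp_all add: less_max_iff_disj)
next
  case (pf_mult p q)
  then obtain M1 M2 where "\<forall>s s'. (\<forall>j<M1. s j = s' j) \<longrightarrow> p s = p s'" "\<forall>s s'. (\<forall>j<M2. s j = s' j) \<longrightarrow> q s = q s'" by blast
  thus ?case by (intro exI[of _ "max M1 M2"] allI impI arg_cong2[where f = "(*)"]) (simp_all add: less_max_iff_disj)
qed simp

lemma powr_minus_half: "0 < t \<Longrightarrow> t powr (real N - 1 / 2) = t ^ N / sqrt t"
  by (simp add: powr_diff powr_realpow powr_half_sqrt)

lemma heat_poly_is_heat_invariants: "is_heat_invariants (\<lambda>n. heat_poly n 0)"
  unfolding is_heat_invariants_def
proof (intro conjI allI impI)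
  fix u H x N assume u: "smooth_bdd u" and H: "heat_kernel u H"
  obtain E where E: "\<And>t. 0 < t \<Longrightarrow> t < 1 \<Longrightarrow>
    \<bar>H t x x - 1 / sqrt (4 * pi * t) * (\<Sum>n\<le>N. heat_poly n 0 (jet u x) * t ^ n)\<bar> \<le> E * (t ^ N * sqrt t)"
    using heat_kernel_diagonal_expansion[OF u H, of x N] by blast
  \<comment> \<open>The expansion is taken one term further than required: the term n = N has
    exactly the order t^(N - 1/2) of the permitted error and is moved into it with the constant
    \<open>a\<close>.\<close>
  define a where "a = \<bar>heat_poly N 0 (jet u x)\<bar>"
  show "(\<lambda>t. H t x x - (1 / sqrt (4 * pi * t)) * (\<Sum>n<N. heat_poly n 0 (jet u x) * t ^ n)) \<in> O[at_right 0](\<lambda>t. t powr (real N - 1 / 2))"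
  proof (rule bigoI[of _ "\<bar>E\<bar> + a"])
    show "eventually (\<lambda>t. norm (H t x x - (1 / sqrt (4 * pi * t)) * (\<Sum>n<N. heat_poly n 0 (jet u x) * t ^ n)) \<le> (\<bar>E\<bar> + a) * norm (t powr (real N - 1 / 2))) (at_right 0)"
      unfolding eventually_at_right_field
    proof (intro exI[of _ 1] conjI allI impI)
      fix t :: real assume t: "0 < t" "t < 1"
      define Z where "Z = t ^ N / sqrt t"
      have Z0: "0 \<le> Z" using t by (simp add: Z_def)
      have "t ^ N * sqrt t \<le> Z"
      proof -
        have "sqrt t \<le> 1 / sqrt t" using t by (simp add: field_simps)
        hence "t ^ N * sqrt t \<le> t ^ N * (1 / sqrt t)" using t by (intro mult_left_mono) auto
        thus ?thesis by (simp add: Z_def)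
      qed
      hence "\<bar>E\<bar> * (t ^ N * sqrt t) \<le> \<bar>E\<bar> * Z" by (intro mult_left_mono) auto
      moreover have "E * (t ^ N * sqrt t) \<le> \<bar>E\<bar> * (t ^ N * sqrt t)" using t by (intro mult_right_mono) auto
      moreover have "\<bar>1 / sqrt (4 * pi * t) * (heat_poly N 0 (jet u x) * t ^ N)\<bar> \<le> a * Z"
      proof -
        have "1 \<le> sqrt (4 * pi)" using pi_gt3 by simp
        hence "sqrt t \<le> sqrt (4 * pi * t)" using t mult_right_mono[of 1 "sqrt (4 * pi)" "sqrt t"] by (simp add: real_sqrt_mult)
        hence "1 / sqrt (4 * pi * t) \<le> 1 / sqrt t" using t by (intro divide_left_mono) auto
        hence "1 / sqrt (4 * pi * t) * (a * t ^ N) \<le> 1 / sqrt t * (a * t ^ N)" using t by (intro mult_right_mono) (auto simp: a_def)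
        thus ?thesis using t by (simp add: a_def Z_def abs_mult)
      qed
      moreover have "1 / sqrt (4 * pi * t) * (\<Sum>n\<le>N. heat_poly n 0 (jet u x) * t ^ n) =
        1 / sqrt (4 * pi * t) * (\<Sum>n<N. heat_poly n 0 (jet u x) * t ^ n) + 1 / sqrt (4 * pi * t) * (heat_poly N 0 (jet u x) * t ^ N)"
        by (simp only: lessThan_Suc_atMost[symmetric] sum.lessThan_Suc distrib_left)
      ultimately have "\<bar>H t x x - (1 / sqrt (4 * pi * t)) * (\<Sum>n<N. heat_poly n 0 (jet u x) * t ^ n)\<bar> \<le> \<bar>E\<bar> * Z + a * Z"
        using E[OF t] by linarith
      thus "norm (H t x x - (1 / sqrt (4 * pi * t)) * (\<Sum>n<N. heat_poly n 0 (jet u x) * t ^ n)) \<le> (\<bar>E\<bar> + a) * norm (t powr (real N - 1 / 2))"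
        unfolding powr_minus_half[OF t(1)] Z_def[symmetric] using Z0 by (simp add: distrib_right)
    qed simp
  qed
qed (rule heat_poly_poly_fun)

text \<open>Once the lower invariants agree, the two expansions of the same kernel differ by d t^n /
  sqrt(4 pi t), which must be O(t^(n + 1/2)). Hence |d| = O(t), and d = 0.\<close>

lemma is_heat_invariants_unique:
  assumes h: "is_heat_invariants h" and h': "is_heat_invariants h'"
  shows "h n s = h' n s"
proof (induction n rule: less_induct)
  case (less n)
  have pf: "h m \<in> poly_fun" "h' m \<in> poly_fun" for m using h h' by (auto simp: is_heat_invariants_def)
  obtain M where M: "\<And>m s s'. (\<forall>j<M m. s j = s' j) \<Longrightarrow> h m s = h m s'"
    using poly_fun_finitely_many_variables[OF pf(1)] by metis
  obtain M' where M': "\<And>m s s'. (\<forall>j<M' m. s j = s' j) \<Longrightarrow> h' m s = h' m s'"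
    using poly_fun_finitely_many_variables[OF pf(2)] by metis
  \<comment> \<open>The sum is a common bound for the variables of all invariants up to order
    \<open>n\<close> in both families, so one potential realises every jet entry involved.\<close>
  define J where "J = (\<Sum>m\<le>n. M m + M' m)"
  have J: "M m \<le> J" "M' m \<le> J" if "m \<le> n" for m
    using that member_le_sum[of m "{..n}" "\<lambda>m. M m + M' m"] by (auto simp: J_def)
  obtain u H where u: "smooth_bdd u" and H: "heat_kernel u H" and jet: "\<And>j. j < J \<Longrightarrow> jet u 0 j = s j"
    using heat_kernel_with_jet[of J s] by blast
  have hs: "h m (jet u 0) = h m s" "h' m (jet u 0) = h' m s" if "m \<le> n" for m
    using J[OF that] jet by (auto intro!: M M')
  let ?c = "\<lambda>t::real. 1 / sqrt (4 * pi * t)"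
  have O1: "(\<lambda>t. H t 0 0 - ?c t * (\<Sum>m<Suc n. h m (jet u 0) * t ^ m)) \<in> O[at_right 0](\<lambda>t. t powr (real (Suc n) - 1 / 2))"
    using h u H unfolding is_heat_invariants_def by blast
  have O2: "(\<lambda>t. H t 0 0 - ?c t * (\<Sum>m<Suc n. h' m (jet u 0) * t ^ m)) \<in> O[at_right 0](\<lambda>t. t powr (real (Suc n) - 1 / 2))"
    using h' u H unfolding is_heat_invariants_def by blast
  define d where "d = h n s - h' n s"
  have "(H t 0 0 - ?c t * (\<Sum>m<Suc n. h' m (jet u 0) * t ^ m)) - (H t 0 0 - ?c t * (\<Sum>m<Suc n. h m (jet u 0) * t ^ m)) = ?c t * (d * t ^ n)" for t
  proof -
    have "(\<Sum>m<n. h m (jet u 0) * t ^ m) = (\<Sum>m<n. h' m (jet u 0) * t ^ m)"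
      using less.IH hs by (intro sum.cong) auto
    hence "(\<Sum>m<Suc n. h m (jet u 0) * t ^ m) = (\<Sum>m<Suc n. h' m (jet u 0) * t ^ m) + d * t ^ n"
      using hs[of n] by (simp add: d_def algebra_simps)
    thus ?thesis by (simp add: distrib_left)
  qed
  with sum_in_bigo(2)[OF O2 O1] have "(\<lambda>t. ?c t * (d * t ^ n)) \<in> O[at_right 0](\<lambda>t. t powr (real (Suc n) - 1 / 2))" by simp
  then obtain C where C: "eventually (\<lambda>t. norm (?c t * (d * t ^ n)) \<le> C * norm (t powr (real (Suc n) - 1 / 2))) (at_right 0)"
    by (elim landau_o.bigE)
  have "eventually (\<lambda>t. \<bar>d\<bar> \<le> C * sqrt (4 * pi) * t) (at_right 0)"
    using C eventually_at_right_less[of 0]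
  proof eventually_elim
    case (elim t)
    hence t: "0 < t" by simp
    have "\<bar>d\<bar> * t ^ n / sqrt (4 * pi) / sqrt t \<le> C * (t * t ^ n / sqrt t)"
      using elim(1) t unfolding powr_minus_half[OF t] by (simp add: abs_mult real_sqrt_mult mult.commute)
    hence "\<bar>d\<bar> / sqrt (4 * pi) * (t ^ n / sqrt t) \<le> C * t * (t ^ n / sqrt t)" by (simp add: mult_ac)
    hence "\<bar>d\<bar> / sqrt (4 * pi) \<le> C * t" using t by (simp only: mult_le_cancel_right) (auto simp: not_less)
    hence "\<bar>d\<bar> \<le> C * t * sqrt (4 * pi)" by (subst (asm) pos_divide_le_eq) auto
    thus ?case by (simp add: mult_ac)
  qed
  moreover have "((\<lambda>t. C * sqrt (4 * pi) * t) \<longlongrightarrow> C * sqrt (4 * pi) * 0) (at_right 0)" by (intro tendsto_intros)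
  ultimately have "\<bar>d\<bar> \<le> C * sqrt (4 * pi) * 0"
    by (intro tendsto_lowerbound[of _ _ "at_right 0"]) auto
  thus ?case by (simp add: d_def)
qed

lemma heat_inv_eq: "heat_inv = (\<lambda>n. heat_poly n 0)"
  unfolding heat_inv_def
proof (rule the_equality)
  show "is_heat_invariants (\<lambda>n. heat_poly n 0)" by (rule heat_poly_is_heat_invariants)
  fix h assume "is_heat_invariants h"
  thus "h = (\<lambda>n. heat_poly n 0)"
    by (intro ext is_heat_invariants_unique[OF _ heat_poly_is_heat_invariants])
qed

theorem theorem1p1:
  fixes n :: nat and s :: "nat \<Rightarrow> real"
  assumes "n \<ge> 1"
  shows "KdV_G n s =
    (\<Sum>m = n..2 * n. \<Sum>k = n..m.
       ((-1) ^ (n + k) * real (m choose k) * real (m choose n) * real ((2 * m) choose m)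
        / (2 ^ (2 * m - 2 * n + 1) * real ((2 * m) choose (2 * n)) * fact (2 * k - 2 * n)))
       * P k n s)"
  unfolding sum_P_eq_heat_poly[OF assms] KdV_G_def heat_inv_eq ..

end
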